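(* Let $n\in\mathbb N$ and let $\mathfrak f^\bullet=\mathfrak f^\bullet(\mathbb R^n)$ be the dg Lie algebra described in the context. Set $$\mathfrak g_n^{-1}:=\mathfrak f^{-1}/d[\mathfrak f^{-1},\mathfrak f^{-1}],\qquad \mathfrak g_n^{0}:=\mathfrak f^{0},$$ and equip $\mathfrak g_n^{-1}$ with the derived bracket $[x,y]_{\mathfrak g_n^{-1}}:=[dx,y]$. Let $\tau\colon\mathfrak g_n^{-1}\to\mathfrak g_n^0$ be the map induced by $d$, and let $\ddot\triangleright$ be the action of $\mathfrak g_n^0$ on $\mathfrak g_n^{-1}$ induced by the adjoint action of $\mathfrak f^0$ on $\mathfrak f^{-1}$. Then: 1. $(\tau\colon\mathfrak g_n^{-1}\to\mathfrak g_n^0,\ddot\triangleright)$ is a crossed module of Lie algebras, and it is the free crossed module of Lie algebras over the free Lie algebra $\mathfrak g_n^0$ and the map $E=\{\mathtt Z_{ij}:1\le i<j\le n\}\to\mathfrak g_n^0$, $\mathtt Z_{ij}\mapsto[\mathtt Z_i,\mathtt Z_j]$. 2. $\mathfrak g_n^0$ is the free Lie algebra over $\mathbb R^n$ and, as Lie algebras and as $\mathrm{GL}(\mathbb R^n)$-representations, $$\mathfrak g_n^{-1}\cong\ker\tau\oplus[\mathfrak g_n^0,\mathfrak g_n^0].$$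
   Context: $\mathfrak f^\bullet(\mathbb R^n)$: the free graded Lie algebra over $\mathbb R$ on symbols $\mathtt Z_I$, $I=\{i_1<\dots<i_p\}\subset\{1,\dots,n\}$, $p\ge1$, with $\deg\mathtt Z_I=1-p$; its bracket satisfies $[x,y]=(-1)^{|x||y|+1}[y,x]$ and the graded Jacobi identity. In particular $\mathfrak f^0$ is the free Lie algebra on $\mathtt Z_1,\dots,\mathtt Z_n$, and $\mathfrak f^{-1}$ is spanned by brackets in letters $\mathtt Z_i$ and exactly one letter $\mathtt Z_{ij}$, $i<j$. The differential $d$ has degree $+1$ and satisfies $d[x,y]=[dx,y]+(-1)^{|x|}[x,dy]$, with $d\mathtt Z_i=0$, $d\mathtt Z_{ij}=[\mathtt Z_i,\mathtt Z_j]$. Only these values of $d$ on generators are needed for the objects in the claim (on a general generator, $d\mathtt Z_I$ is a signed sum of brackets $[\mathtt Z_J,\mathtt Z_K]$, $J\sqcup K=I$). $[\mathfrak f^{-1},\mathfrak f^{-1}]\subset\mathfrak f^{-2}$ denotes the linear span of brackets of two elements of $\mathfrak f^{-1}$. $\mathrm{GL}(\mathbb R^n)$ acts on the generators by identifying $\mathrm{span}\{\mathtt Z_i\}=\mathbb R^n$ and $\mathrm{span}\{\mathtt Z_{ij}\}_{i<j}=\Lambda^2\mathbb R^n$ ($\mathtt Z_{ij}\leftrightarrow \mathtt Z_i\wedge \mathtt Z_j$), and on brackets by graded Lie algebra automorphisms. Crossed module of Lie algebras $(\mathfrak t\colon\mathfrak h\to\mathfrak g,\ddot m)$: Lie algebra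 morphisms $\mathfrak t\colon\mathfrak h\to\mathfrak g$ and $\ddot m\colon\mathfrak g\to\mathrm{Der}(\mathfrak h)$ with $\mathfrak t(\ddot m_x(y'))=[x,\mathfrak t(y')]$ and $\ddot m_{\mathfrak t(y)}(y')=[y,y']$. A morphism from $(\mathfrak t\colon\mathfrak h\to\mathfrak g,\ddot m)$ to $(\mathfrak t'\colon\mathfrak h'\to\mathfrak g',\ddot m')$ is a pair of Lie algebra morphisms $(\psi\colon\mathfrak h\to\mathfrak h',\phi\colon\mathfrak g\to\mathfrak g')$ with $\phi\circ\mathfrak t=\mathfrak t'\circ\psi$ and $\psi(\ddot m_g(h))=\ddot m'_{\phi(g)}(\psi(h))$. Free crossed module: a crossed module $(\mathfrak t\colon\mathfrak h\to\mathfrak g,\ddot m)$ with an injection $\iota\colon E\to\mathfrak h$, $\mathfrak t\circ\iota=\mathfrak t_0$, is free over a map $\mathfrak t_0\colon E\to\mathfrak g$ if for every crossed module $(\mathfrak t'\colon\mathfrak h'\to\mathfrak g',\ddot m')$, Lie algebra morphism $\phi\colon\mathfrak g\to\mathfrak g'$ and map $\psi_0\colon E\to\mathfrak h'$ with $\phi\circ\mathfrak t_0=\mathfrak t'\circ\psi_0$ there is a unique $\psi\colon\mathfrak h\to\mathfrak h'$ with $\psi\circ\iota=\psi_0$ such that $(\psi,\phi)$ is a morphism of crossed modules. Here $\iota(\mathtt Z_{ij})$ is the class of $\mathtt Z_{ij}$ in $\mathfrak g_n^{-1}$. *)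

theory Defs
  imports
    "Jordan_Normal_Form.VS_Connect"
    "Jordan_Normal_Form.DL_Submatrix"
    "HOL-Algebra.QuotRing"
    "HOL-Library.Poly_Mapping"
begin

hide_const (open) Modules.module_hom Multiset.mult Polynomial.smult

section \<open>Real Lie algebras with explicit carrier\<close>

text \<open>
  A real algebra, associative or not, is a \<^type>\<open>module\<close> record over \<^term>\<open>class_ring :: real ring\<close>
  whose field \<^const>\<open>mult\<close> (written \<open>\<otimes>\<close>) is the product. For Lie algebras and for graded Lie
  algebras the product is the bracket. The field \<^const>\<open>one\<close> plays no role anywhere.

  Maps between carriers are only meaningful on the carrier. Where a universal property asserts
  uniqueness, the maps are taken to be \<^const>\<open>extensional\<close>.
\<close>

definition lie_algebra :: "(real, 'a) module \<Rightarrow> bool" where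
  "lie_algebra L \<longleftrightarrow>
     vectorspace class_ring L \<and>
     (\<forall>x\<in>carrier L. (\<lambda>y. x \<otimes>\<^bsub>L\<^esub> y) \<in> module_hom class_ring L L) \<and>
     (\<forall>y\<in>carrier L. (\<lambda>x. x \<otimes>\<^bsub>L\<^esub> y) \<in> module_hom class_ring L L) \<and>
     (\<forall>x\<in>carrier L. x \<otimes>\<^bsub>L\<^esub> x = \<zero>\<^bsub>L\<^esub>) \<and>
     (\<forall>x\<in>carrier L. \<forall>y\<in>carrier L. \<forall>z\<in>carrier L.
        x \<otimes>\<^bsub>L\<^esub> (y \<otimes>\<^bsub>L\<^esub> z) \<oplus>\<^bsub>L\<^esub> y \<otimes>\<^bsub>L\<^esub> (z \<otimes>\<^bsub>L\<^esub> x) \<oplus>\<^bsub>L\<^esub> z \<otimes>\<^bsub>L\<^esub> (x \<otimes>\<^bsub>L\<^esub> y) = \<zero>\<^bsub>L\<^esub>)"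

definition lie_hom :: "(real, 'a) module \<Rightarrow> (real, 'b) module \<Rightarrow> ('a \<Rightarrow> 'b) set" where
  "lie_hom L M =
     {f \<in> module_hom class_ring L M.
        \<forall>x\<in>carrier L. \<forall>y\<in>carrier L. f (x \<otimes>\<^bsub>L\<^esub> y) = f x \<otimes>\<^bsub>M\<^esub> f y}"

definition lie_der :: "(real, 'a) module \<Rightarrow> ('a \<Rightarrow> 'a) set" where
  "lie_der L =
     {\<delta> \<in> module_hom class_ring L L.
        \<forall>x\<in>carrier L. \<forall>y\<in>carrier L. \<delta> (x \<otimes>\<^bsub>L\<^esub> y) = \<delta> x \<otimes>\<^bsub>L\<^esub> y \<oplus>\<^bsub>L\<^esub> x \<otimes>\<^bsub>L\<^esub> \<delta> y}"

text \<open>A Lie algebra morphism \<open>m\<close> from \<open>G\<close> to the Lie algebra of derivations of \<open>H\<close>, the latter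
  with pointwise operations and the commutator bracket.\<close>

definition lie_action :: "(real, 'g) module \<Rightarrow> (real, 'h) module \<Rightarrow> ('g \<Rightarrow> 'h \<Rightarrow> 'h) \<Rightarrow> bool" where
  "lie_action G H m \<longleftrightarrow>
     (\<forall>x\<in>carrier G. m x \<in> lie_der H) \<and>
     (\<forall>y\<in>carrier H. (\<lambda>x. m x y) \<in> module_hom class_ring G H) \<and>
     (\<forall>x\<in>carrier G. \<forall>x'\<in>carrier G. \<forall>y\<in>carrier H.
        m (x \<otimes>\<^bsub>G\<^esub> x') y = m x (m x' y) \<ominus>\<^bsub>H\<^esub> m x' (m x y))"

definition lie_derived :: "(real, 'a) module \<Rightarrow> (real, 'a) module" where
  "lie_derived L =
     L\<lparr>carrier := LinearCombinations.module.span class_ring L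
       {x \<otimes>\<^bsub>L\<^esub> y | x y. x \<in> carrier L \<and> y \<in> carrier L}\<rparr>"

definition lie_kernel :: "(real, 'a) module \<Rightarrow> (real, 'b) module \<Rightarrow> ('a \<Rightarrow> 'b) \<Rightarrow> (real, 'a) module" where
  "lie_kernel L M f = L\<lparr>carrier := a_kernel L M f\<rparr>"

text \<open>The product of the library's \<^const>\<open>direct_sum\<close> is zero; here it is componentwise.\<close>

definition lie_direct_sum :: "(real, 'a) module \<Rightarrow> (real, 'b) module \<Rightarrow> (real, 'a \<times> 'b) module" where
  "lie_direct_sum L M =
     (direct_sum L M)\<lparr>mult := \<lambda>v w. (fst v \<otimes>\<^bsub>L\<^esub> fst w, snd v \<otimes>\<^bsub>M\<^esub> snd w)\<rparr>"

text \<open>HOL has no quantification over types inside a formula: the universal properties below take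
  as argument the carrier types of the test objects. A theorem in which these are type variables
  states the property for all types.\<close>

definition free_lie_algebra ::
    "'l itself \<Rightarrow> (real, 'v) module \<Rightarrow> (real, 'a) module \<Rightarrow> ('v \<Rightarrow> 'a) \<Rightarrow> bool" where
  "free_lie_algebra _ V L \<eta> \<longleftrightarrow>
     vectorspace class_ring V \<and> lie_algebra L \<and> \<eta> \<in> module_hom class_ring V L \<and>
     (\<forall>(M :: (real, 'l) module) f. lie_algebra M \<longrightarrow> f \<in> module_hom class_ring V M \<longrightarrow>
        (\<exists>!F. F \<in> extensional (carrier L) \<and> F \<in> lie_hom L M \<and> (\<forall>v\<in>carrier V. F (\<eta> v) = f v)))"


section \<open>Crossed modules of Lie algebras\<close>

definition crossed_module ::
    "(real, 'h) module \<Rightarrow> (real, 'g) module \<Rightarrow> ('h \<Rightarrow> 'g) \<Rightarrow> ('g \<Rightarrow> 'h \<Rightarrow> 'h) \<Rightarrow> bool" where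
  "crossed_module H G t m \<longleftrightarrow>
     lie_algebra H \<and> lie_algebra G \<and> t \<in> lie_hom H G \<and> lie_action G H m \<and>
     (\<forall>x\<in>carrier G. \<forall>y'\<in>carrier H. t (m x y') = x \<otimes>\<^bsub>G\<^esub> t y') \<and>
     (\<forall>y\<in>carrier H. \<forall>y'\<in>carrier H. m (t y) y' = y \<otimes>\<^bsub>H\<^esub> y')"

definition crossed_module_hom ::
    "(real, 'h) module \<Rightarrow> (real, 'g) module \<Rightarrow> ('h \<Rightarrow> 'g) \<Rightarrow> ('g \<Rightarrow> 'h \<Rightarrow> 'h) \<Rightarrow>
     (real, 'k) module \<Rightarrow> (real, 'l) module \<Rightarrow> ('k \<Rightarrow> 'l) \<Rightarrow> ('l \<Rightarrow> 'k \<Rightarrow> 'k) \<Rightarrow>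
     ('h \<Rightarrow> 'k) \<Rightarrow> ('g \<Rightarrow> 'l) \<Rightarrow> bool" where
  "crossed_module_hom H G t m H' G' t' m' \<psi> \<phi> \<longleftrightarrow>
     \<psi> \<in> lie_hom H H' \<and> \<phi> \<in> lie_hom G G' \<and>
     (\<forall>y\<in>carrier H. \<phi> (t y) = t' (\<psi> y)) \<and>
     (\<forall>x\<in>carrier G. \<forall>y\<in>carrier H. \<psi> (m x y) = m' (\<phi> x) (\<psi> y))"

definition free_crossed_module ::
    "'k itself \<Rightarrow> 'l itself \<Rightarrow>
     (real, 'h) module \<Rightarrow> (real, 'g) module \<Rightarrow> ('h \<Rightarrow> 'g) \<Rightarrow> ('g \<Rightarrow> 'h \<Rightarrow> 'h) \<Rightarrow>
     'e set \<Rightarrow> ('e \<Rightarrow> 'h) \<Rightarrow> ('e \<Rightarrow> 'g) \<Rightarrow> bool" where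
  "free_crossed_module _ _ H G t m E \<iota> t0 \<longleftrightarrow>
     crossed_module H G t m \<and>
     \<iota> \<in> E \<rightarrow> carrier H \<and> inj_on \<iota> E \<and> t0 \<in> E \<rightarrow> carrier G \<and> (\<forall>e\<in>E. t (\<iota> e) = t0 e) \<and>
     (\<forall>(H' :: (real, 'k) module) (G' :: (real, 'l) module) t' m' \<phi> \<psi>0.
        crossed_module H' G' t' m' \<longrightarrow> \<phi> \<in> lie_hom G G' \<longrightarrow> \<psi>0 \<in> E \<rightarrow> carrier H' \<longrightarrow>
        (\<forall>e\<in>E. \<phi> (t0 e) = t' (\<psi>0 e)) \<longrightarrow>
        (\<exists>!\<psi>. \<psi> \<in> extensional (carrier H) \<and> (\<forall>e\<in>E. \<psi> (\<iota> e) = \<psi>0 e) \<and>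
              crossed_module_hom H G t m H' G' t' m' \<psi> \<phi>))"


section \<open>Quotients\<close>

text \<open>The map on cosets of \<open>N\<close> in \<open>M\<close> induced by a map \<open>f\<close> into \<open>M\<close> that respects these cosets
  (compare \<^const>\<open>rcoset_mult\<close>).\<close>

definition coset_map ::
    "('r, 'a) module \<Rightarrow> 'a set \<Rightarrow> ('b \<Rightarrow> 'a) \<Rightarrow> 'b set \<Rightarrow> 'a set" where
  "coset_map M N f X = (\<Union>x\<in>X. N +>\<^bsub>M\<^esub> f x)"

definition quot_module :: "('r, 'a) module \<Rightarrow> 'a set \<Rightarrow> ('r, 'a set) module" where
  "quot_module M N =
     ring.extend (M Quot N) (module.fields (\<lambda>c. coset_map M N (\<lambda>x. c \<odot>\<^bsub>M\<^esub> x)))"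


section \<open>The free graded Lie algebra on the symbols \<open>Z\<^sub>I\<close>\<close>

text \<open>
  The index set \<open>{1, \<dots>, n}\<close> is replaced by \<open>{..<n}\<close>, and the symbol \<open>Z\<^sub>I\<close> is represented by \<open>I\<close>.
  The free graded Lie algebra is the free nonassociative algebra on the symbols (finite formal
  real linear combinations of bracketed words) modulo the two-sided ideal generated by graded
  antisymmetry and the graded Jacobi identity.
\<close>

definition symbols :: "nat \<Rightarrow> nat set set" where
  "symbols n = {I. I \<noteq> {} \<and> I \<subseteq> {..<n}}"

datatype 'a bword = Gen 'a | Br "'a bword" "'a bword"

type_synonym nalg = "nat set bword \<Rightarrow>\<^sub>0 real"

primrec wdeg :: "nat set bword \<Rightarrow> int" where
  "wdeg (Gen I) = 1 - int (card I)"
| "wdeg (Br s t) = wdeg s + wdeg t"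

definition scal :: "real \<Rightarrow> nalg \<Rightarrow> nalg" where
  "scal c p = Poly_Mapping.map ((*) c) p"

definition word :: "nat set bword \<Rightarrow> nalg" where
  "word t = Poly_Mapping.single t 1"

definition linear_ext :: "(nat set bword \<Rightarrow> nalg) \<Rightarrow> nalg \<Rightarrow> nalg" where
  "linear_ext f p = (\<Sum>t\<in>Poly_Mapping.keys p. scal (Poly_Mapping.lookup p t) (f t))"

definition br :: "nalg \<Rightarrow> nalg \<Rightarrow> nalg" where
  "br p q = linear_ext (\<lambda>s. linear_ext (\<lambda>t. word (Br s t)) q) p"

definition free_nalg :: "nat \<Rightarrow> (real, nalg) module" where
  "free_nalg n =
     \<lparr>carrier = {p. \<forall>t\<in>Poly_Mapping.keys p. set_bword t \<subseteq> symbols n},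
      mult = br, one = 0, zero = 0, add = (+), smult = scal\<rparr>"

definition homogeneous :: "nat \<Rightarrow> int \<Rightarrow> nalg set" where
  "homogeneous n k = {p \<in> carrier (free_nalg n). \<forall>t\<in>Poly_Mapping.keys p. wdeg t = k}"

inductive_set lie_ideal :: "nat \<Rightarrow> nalg set" for n where
  antisymmetry: "x \<in> homogeneous n i \<Longrightarrow> y \<in> homogeneous n j \<Longrightarrow>
     br x y - scal ((-1) powi (i * j + 1)) (br y x) \<in> lie_ideal n"
| jacobi: "x \<in> homogeneous n i \<Longrightarrow> y \<in> homogeneous n j \<Longrightarrow> z \<in> homogeneous n k \<Longrightarrow>
     br x (br y z) - (br (br x y) z + scal ((-1) powi (i * j)) (br y (br x z))) \<in> lie_ideal n"
| add: "x \<in> lie_ideal n \<Longrightarrow> y \<in> lie_ideal n \<Longrightarrow> x + y \<in> lie_ideal n"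
| scal: "x \<in> lie_ideal n \<Longrightarrow> scal c x \<in> lie_ideal n"
| br_left: "a \<in> carrier (free_nalg n) \<Longrightarrow> x \<in> lie_ideal n \<Longrightarrow> br a x \<in> lie_ideal n"
| br_right: "x \<in> lie_ideal n \<Longrightarrow> a \<in> carrier (free_nalg n) \<Longrightarrow> br x a \<in> lie_ideal n"

definition free_gla :: "nat \<Rightarrow> (real, nalg set) module" where
  "free_gla n = quot_module (free_nalg n) (lie_ideal n)"

definition gla_class :: "nat \<Rightarrow> nalg \<Rightarrow> nalg set" where
  "gla_class n p = lie_ideal n +>\<^bsub>free_nalg n\<^esub> p"

definition gla_part :: "nat \<Rightarrow> int \<Rightarrow> nalg set set" where
  "gla_part n k = gla_class n ` homogeneous n k"

definition Z :: "nat \<Rightarrow> nat set \<Rightarrow> nalg set" where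
  "Z n I = gla_class n (word (Gen I))"

text \<open>
  The differential on a generator is
  \<open>d Z\<^sub>I = \<Sum> (-1)\<^bsup>|J|+1\<^esup> \<epsilon>(J, K) [Z\<^sub>J, Z\<^sub>K]\<close> over the unordered partitions \<open>I = J \<squnion> K\<close>
  into nonempty parts, where \<open>e\<^sub>J \<and> e\<^sub>K = \<epsilon>(J, K) e\<^sub>I\<close> in the exterior algebra. The summand is
  symmetric in \<open>J\<close> and \<open>K\<close>, so \<open>J\<close> may be taken to be the part that contains \<open>Min I\<close>. In
  particular \<open>d Z\<^sub>i = 0\<close>, and \<open>d Z\<^sub>i\<^sub>j = [Z\<^sub>i, Z\<^sub>j]\<close> for \<open>i < j\<close>.
\<close>

definition shuffle_sign :: "nat set \<Rightarrow> nat set \<Rightarrow> real" where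
  "shuffle_sign J K = (-1) ^ card {(j, k). j \<in> J \<and> k \<in> K \<and> k < j}"

definition diff_symbol :: "nat set \<Rightarrow> nalg" where
  "diff_symbol I =
     (\<Sum>J | J \<subset> I \<and> Min I \<in> J.
        scal ((-1) ^ (card J + 1) * shuffle_sign J (I - J)) (word (Br (Gen J) (Gen (I - J)))))"

primrec diff_word :: "nat set bword \<Rightarrow> nalg" where
  "diff_word (Gen I) = diff_symbol I"
| "diff_word (Br s t) =
     br (diff_word s) (word t) + scal ((-1) powi wdeg s) (br (word s) (diff_word t))"

definition gla_diff :: "nat \<Rightarrow> nalg set \<Rightarrow> nalg set" where
  "gla_diff n = coset_map (free_nalg n) (lie_ideal n) (linear_ext diff_word)"


section \<open>The crossed module\<close>

definition g0 :: "nat \<Rightarrow> (real, nalg set) module" where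
  "g0 n = (free_gla n)\<lparr>carrier := gla_part n 0\<rparr>"

definition f_minus1 :: "nat \<Rightarrow> (real, nalg set) module" where
  "f_minus1 n = (free_gla n)\<lparr>carrier := gla_part n (-1)\<rparr>"

text \<open>The subspace \<open>d[f\<^sup>-\<^sup>1, f\<^sup>-\<^sup>1]\<close> of \<open>f\<^sup>-\<^sup>1\<close>.\<close>

definition exact_brackets :: "nat \<Rightarrow> nalg set set" where
  "exact_brackets n =
     gla_diff n ` LinearCombinations.module.span class_ring (free_gla n)
       {x \<otimes>\<^bsub>free_gla n\<^esub> y | x y. x \<in> gla_part n (-1) \<and> y \<in> gla_part n (-1)}"

text \<open>The product inherited by the quotient is replaced by the derived bracket.\<close>

definition g1 :: "nat \<Rightarrow> (real, nalg set set) module" where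
  "g1 n = (quot_module (f_minus1 n) (exact_brackets n))
     \<lparr>mult := \<lambda>X Y. \<Union>x\<in>X. \<Union>y\<in>Y.
        exact_brackets n +>\<^bsub>f_minus1 n\<^esub> (gla_diff n x \<otimes>\<^bsub>free_gla n\<^esub> y)\<rparr>"

definition g1_class :: "nat \<Rightarrow> nalg set \<Rightarrow> nalg set set" where
  "g1_class n x = exact_brackets n +>\<^bsub>f_minus1 n\<^esub> x"

definition tau :: "nat \<Rightarrow> nalg set set \<Rightarrow> nalg set" where
  "tau n X = the_elem (gla_diff n ` X)"

definition act :: "nat \<Rightarrow> nalg set \<Rightarrow> nalg set set \<Rightarrow> nalg set set" where
  "act n g = coset_map (f_minus1 n) (exact_brackets n) (\<lambda>x. g \<otimes>\<^bsub>free_gla n\<^esub> x)"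

text \<open>The linear inclusion \<open>\<real>\<^sup>n \<rightarrow> f\<^sup>0\<close> that sends the \<open>i\<close>-th basis vector to \<open>Z\<^sub>i\<close>.\<close>

definition g0_incl :: "nat \<Rightarrow> real vec \<Rightarrow> nalg set" where
  "g0_incl n v = gla_class n (\<Sum>i<n. scal (v $ i) (word (Gen {i})))"


section \<open>The action of \<open>GL(\<real>\<^sup>n)\<close>\<close>

definition GL :: "nat \<Rightarrow> real mat set" where
  "GL n = {A \<in> carrier_mat n n. invertible_mat A}"

text \<open>
  The span of the \<open>Z\<^sub>I\<close> with \<open>|I| = p\<close> is identified with the \<open>p\<close>-th exterior power of \<open>\<real>\<^sup>n\<close>, on
  which \<open>A\<close> acts by its \<open>p \<times> p\<close> minors. For \<open>p = 1\<close> this is \<open>A Z\<^sub>i = \<Sum>\<^sub>k A\<^sub>k\<^sub>i Z\<^sub>k\<close>, and for \<open>p = 2\<close>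
  it is \<open>A Z\<^sub>i\<^sub>j = \<Sum>\<^sub>k\<^sub><\<^sub>l (A\<^sub>k\<^sub>i A\<^sub>l\<^sub>j - A\<^sub>k\<^sub>j A\<^sub>l\<^sub>i) Z\<^sub>k\<^sub>l\<close>.
\<close>

primrec gl_word :: "real mat \<Rightarrow> nat set bword \<Rightarrow> nalg" where
  "gl_word A (Gen I) =
     (\<Sum>K | K \<subseteq> {..<dim_row A} \<and> card K = card I.
        scal (Determinant.det (submatrix A K I)) (word (Gen K)))"
| "gl_word A (Br s t) = br (gl_word A s) (gl_word A t)"

definition gl_gla :: "nat \<Rightarrow> real mat \<Rightarrow> nalg set \<Rightarrow> nalg set" where
  "gl_gla n A = coset_map (free_nalg n) (lie_ideal n) (linear_ext (gl_word A))"

definition gl_g1 :: "nat \<Rightarrow> real mat \<Rightarrow> nalg set set \<Rightarrow> nalg set set" where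
  "gl_g1 n A = coset_map (f_minus1 n) (exact_brackets n) (gl_gla n A)"

definition gl_representation ::
    "nat \<Rightarrow> (real, 'a) module \<Rightarrow> (real mat \<Rightarrow> 'a \<Rightarrow> 'a) \<Rightarrow> bool" where
  "gl_representation n V \<rho> \<longleftrightarrow>
     vectorspace class_ring V \<and>
     (\<forall>A\<in>GL n. \<rho> A \<in> module_hom class_ring V V) \<and>
     (\<forall>x\<in>carrier V. \<rho> (1\<^sub>m n) x = x) \<and>
     (\<forall>A\<in>GL n. \<forall>B\<in>GL n. \<forall>x\<in>carrier V. \<rho> (A * B) x = \<rho> A (\<rho> B x))"

text \<open>One linear bijection that respects both the Lie brackets and the \<open>GL(\<real>\<^sup>n)\<close>-actions.\<close>

definition lie_gl_iso ::
    "nat \<Rightarrow> (real, 'a) module \<Rightarrow> (real mat \<Rightarrow> 'a \<Rightarrow> 'a) \<Rightarrow>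
     (real, 'b) module \<Rightarrow> (real mat \<Rightarrow> 'b \<Rightarrow> 'b) \<Rightarrow> ('a \<Rightarrow> 'b) \<Rightarrow> bool" where
  "lie_gl_iso n L \<rho> M \<sigma> F \<longleftrightarrow>
     lie_algebra L \<and> lie_algebra M \<and> gl_representation n L \<rho> \<and> gl_representation n M \<sigma> \<and>
     F \<in> lie_hom L M \<and> bij_betw F (carrier L) (carrier M) \<and>
     (\<forall>A\<in>GL n. \<forall>x\<in>carrier L. F (\<rho> A x) = \<sigma> A (F x))"

end

theory Submission
  imports Defs
begin

text \<open>
  The crossed module axioms reduce to the identity \<open>d[x, y] = [dx, y] + [dy, x]\<close> for \<open>x\<close>, \<open>y\<close> of
  degree \<open>-1\<close>: modulo its image the derived bracket is antisymmetric and satisfies Peiffer's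
  identity. For freeness, a bracketed word with exactly one letter \<open>Z\<^sub>i\<^sub>j\<close> is evaluated
  letter by letter in the target, and the same identity shows that the value on \<open>d[x, y]\<close> vanishes.

  The splitting avoids the Shirshov--Witt theorem and complete reducibility. For \<open>v \<in> \<real>\<^sup>n\<close> let
  \<open>W\<^sub>v : g\<^sup>0 \<rightarrow> g\<^sup>-\<^sup>1\<close> be the derivation with \<open>W\<^sub>v(w) = v \<and> w\<close> on \<open>\<real>\<^sup>n\<close>. Then
  \<open>J\<^sub>v = v - W\<^sub>v \<circ> \<tau>\<close> is a \<open>g\<^sup>0\<close>-linear map \<open>g\<^sup>-\<^sup>1 \<rightarrow> ker \<tau>\<close>, which sends \<open>Z\<^sub>k\<^sub>l\<close> to the Koszul
  boundary of \<open>v \<and> Z\<^sub>k \<and> Z\<^sub>l\<close>. Define \<open>H : g\<^sup>-\<^sup>1 \<rightarrow> ker \<tau>\<close> and \<open>R : g\<^sup>0 \<rightarrow> g\<^sup>-\<^sup>1\<close> by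
  \<open>H(s t) = s H(t) + J\<^sub>s(t)\<close>, \<open>H(Z\<^sub>k\<^sub>l) = 0\<close> and
  \<open>R[s, t] = s R(t) + W\<^sub>s(t) - t R(s) - W\<^sub>t(s)\<close>, \<open>R(Z\<^sub>i) = 0\<close>, where the indices \<open>s\<close>, \<open>t\<close> stand for
  linear parts. Then \<open>H\<close> kills all brackets and is equivariant, and \<open>H + R \<circ> \<tau>\<close> multiplies a word
  by its length. Hence \<open>H\<close> is invertible on \<open>ker \<tau>\<close>, and \<open>(H, \<tau>)\<close> is the required isomorphism.
  Below, \<open>W\<close>, \<open>J\<close>, \<open>H\<close>, \<open>R\<close> and \<open>H + R \<circ> \<tau>\<close> are \<open>wedge_der\<close>, \<open>koszul\<close>, \<open>kernel_map\<close>,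
  \<open>euler_lift\<close> and \<open>euler\<close>.
\<close>

section \<open>Formal combinations of bracketed words as a real vector space\<close>

text \<open>Maps are built on formal combinations of words, where prescribing values on words is
  enough; equality in a quotient becomes membership in \<open>lie_ideal n\<close> or
  \<open>peiffer n\<close>. The obstacle is that \<open>lie_ideal n\<close> contains relations of
  every degree, while the maps concern only degrees 0 and -1. They are therefore given on all words,
  with degree-0 factors passed through the projection \<open>pr0\<close>, so that relations of the
  remaining degrees are respected as well. H kills brackets for this reason: J_s depends only on the
  linear part of s, and an element dx has none, so H([dx, y]) = [dx, H(y)]; this is -[dH(y), x] = 0
  by Peiffer's identity. Killing brackets is what makes (H, tau) a map of Lie algebras, because ker
  tau is central. The length counts Z_ij twice, in accordance with d Z_ij = [Z_i, Z_j].
  Invertibility of H on ker tau rests on all lengths being positive: R d vanishes there, so H itself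
  acts as the length operator.\<close>

instantiation poly_mapping :: (type, real_vector) real_vector
begin

lift_definition scaleR_poly_mapping :: "real \<Rightarrow> ('a \<Rightarrow>\<^sub>0 'b) \<Rightarrow> 'a \<Rightarrow>\<^sub>0 'b"
  is "\<lambda>c f x. c *\<^sub>R f x"
  by (erule rev_finite_subset) auto

instance
  by standard (transfer, simp add: algebra_simps fun_eq_iff)+

end

abbreviation lin :: "('a::real_vector \<Rightarrow> 'b::real_vector) \<Rightarrow> bool" where
  "lin \<equiv> Real_Vector_Spaces.linear"

abbreviation subsp :: "'a::real_vector set \<Rightarrow> bool" where
  "subsp \<equiv> Real_Vector_Spaces.subspace"

lemma lookup_scaleR [simp]:
  "Poly_Mapping.lookup (c *\<^sub>R p) t = c *\<^sub>R Poly_Mapping.lookup p t"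
  by transfer simp

lemma scal_eq_scaleR [simp]: "scal c p = c *\<^sub>R p"
  by (rule poly_mapping_eqI) (simp add: scal_def map.rep_eq when_def)

lemma poly_mapping_sum_words:
  "p = (\<Sum>t\<in>Poly_Mapping.keys p. Poly_Mapping.lookup p t *\<^sub>R word t)"
proof (rule poly_mapping_eqI)
  fix t
  have "Poly_Mapping.lookup (\<Sum>s\<in>Poly_Mapping.keys p. Poly_Mapping.lookup p s *\<^sub>R word s) t =
      (\<Sum>s\<in>Poly_Mapping.keys p. Poly_Mapping.lookup p s * (1 when s = t))"
    by (simp add: lookup_sum word_def lookup_single)
  also have "\<dots> = (\<Sum>s\<in>Poly_Mapping.keys p. if s = t then Poly_Mapping.lookup p s else 0)"
    by (rule sum.cong) (auto simp: when_def)
  also have "\<dots> = Poly_Mapping.lookup p t"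
    by (simp add: sum.delta in_keys_iff)
  finally show "Poly_Mapping.lookup p t =
    Poly_Mapping.lookup (\<Sum>s\<in>Poly_Mapping.keys p. Poly_Mapping.lookup p s *\<^sub>R word s) t" ..
qed

text \<open>\<open>p\<close>, \<open>q\<close> and \<open>p + q\<close> have different supports.
  Summing over a common finite superset reduces additivity to the coefficients.\<close>

lemma linear_ext_superset:
  assumes "finite T" "Poly_Mapping.keys p \<subseteq> T"
  shows "linear_ext f p = (\<Sum>t\<in>T. Poly_Mapping.lookup p t *\<^sub>R f t)"
  unfolding linear_ext_def scal_eq_scaleR
  by (rule sum.mono_neutral_left) (use assms in \<open>auto simp: in_keys_iff\<close>)

lemma linear_linear_ext: "lin (linear_ext f)"
proof (rule linearI)
  fix p q :: nalg
  let ?T = "Poly_Mapping.keys p \<union> Poly_Mapping.keys q"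
  show "linear_ext f (p + q) = linear_ext f p + linear_ext f q"
    by (subst (1 2 3) linear_ext_superset[of ?T])
      (auto simp: lookup_add scaleR_left_distrib sum.distrib dest: subsetD[OF keys_add])
next
  fix c :: real and p :: nalg
  have "linear_ext f (c *\<^sub>R p) =
      (\<Sum>t\<in>Poly_Mapping.keys p. Poly_Mapping.lookup (c *\<^sub>R p) t *\<^sub>R f t)"
    by (rule linear_ext_superset) (auto simp: in_keys_iff)
  then show "linear_ext f (c *\<^sub>R p) = c *\<^sub>R linear_ext f p"
    by (simp add: linear_ext_def scaleR_sum_right)
qed

lemma linear_ext_word [simp]: "linear_ext f (word t) = f t"
  by (simp add: linear_ext_def word_def)

lemma linear_eq_on_words:
  fixes f :: "nalg \<Rightarrow> 'b::real_vector"
  assumes "lin f" "lin g" and "\<And>t. f (word t) = g (word t)"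
  shows "f p = g p"
proof -
  let ?p = "\<Sum>t\<in>Poly_Mapping.keys p. Poly_Mapping.lookup p t *\<^sub>R word t"
  have "f ?p = g ?p"
    by (simp only: linear_sum[OF assms(1)] linear_sum[OF assms(2)] linear_scale[OF assms(1)]
      linear_scale[OF assms(2)] assms(3))
  then show ?thesis by (simp only: poly_mapping_sum_words[symmetric])
qed

lemma linear_in_subspace_on_words:
  fixes f :: "nalg \<Rightarrow> 'b::real_vector"
  assumes "lin f" "subsp N" and "\<And>t. t \<in> Poly_Mapping.keys p \<Longrightarrow> f (word t) \<in> N"
  shows "f p \<in> N"
proof -
  let ?p = "\<Sum>t\<in>Poly_Mapping.keys p. Poly_Mapping.lookup p t *\<^sub>R word t"
  have "f ?p \<in> N"
    unfolding linear_sum[OF assms(1)] linear_scale[OF assms(1)]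
    by (intro real_vector.subspace_sum real_vector.subspace_scale assms)
  then show ?thesis by (simp only: poly_mapping_sum_words[symmetric])
qed

section \<open>Bilinear extension of the bracket\<close>

lemma br_word_word [simp]: "br (word s) (word t) = word (Br s t)"
  by (simp add: br_def)

lemma linear_br_left: "lin (\<lambda>p. br p q)"
  unfolding br_def by (rule linear_linear_ext)

lemma linear_br_right: "lin (br p)"
  unfolding br_def linear_ext_def[of "\<lambda>s. linear_ext (\<lambda>t. word (Br s t)) _" p] scal_eq_scaleR
  by (intro linear_compose_sum ballI linear_compose_scale_right linear_linear_ext)

lemmas br_add_left = linear_add[OF linear_br_left]
  and br_add_right = linear_add[OF linear_br_right]
  and br_diff_left = linear_diff[OF linear_br_left]
  and br_diff_right = linear_diff[OF linear_br_right]
  and br_neg_left = linear_neg[OF linear_br_left]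
  and br_neg_right = linear_neg[OF linear_br_right]
  and br_scale_left = linear_scale[OF linear_br_left]
  and br_scale_right = linear_scale[OF linear_br_right]
  and br_zero_left [simp] = linear_0[OF linear_br_left]
  and br_zero_right [simp] = linear_0[OF linear_br_right]
  and br_sum_left = linear_sum[OF linear_br_left]
  and br_sum_right = linear_sum[OF linear_br_right]

lemmas br_simps = br_add_left br_add_right br_diff_left br_diff_right br_neg_left br_neg_right
  br_scale_left br_scale_right

lemma bilinear_eq_on_words:
  fixes B C :: "nalg \<Rightarrow> nalg \<Rightarrow> 'b::real_vector"
  assumes "\<And>q. lin (\<lambda>p. B p q)" "\<And>p. lin (B p)" "\<And>q. lin (\<lambda>p. C p q)" "\<And>p. lin (C p)"
    and "\<And>s t. B (word s) (word t) = C (word s) (word t)"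
  shows "B p q = C p q"
proof (rule linear_eq_on_words[where f = "\<lambda>p. B p q" and g = "\<lambda>p. C p q"])
  show "B (word s) q = C (word s) q" for s
    by (rule linear_eq_on_words[where f = "B (word s)" and g = "C (word s)"]) (rule assms)+
qed (rule assms)+

text \<open>The source of all product rules below: on words a rule is the defining recursion, and
  bilinearity does the rest. The right-hand side has to be bilinear on all elements, which is why
  degree-dependent signs and projections are packaged as linear operators.\<close>

lemma linear_on_br:
  fixes f :: "nalg \<Rightarrow> 'b::real_vector"
  assumes "lin f" "\<And>q. lin (\<lambda>p. B p q)" "\<And>p. lin (B p)"
    and "\<And>s t. f (word (Br s t)) = B (word s) (word t)"
  shows "f (br p q) = B p q"
proof (rule bilinear_eq_on_words[where B = "\<lambda>p q. f (br p q)"])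
  show "lin (\<lambda>p. f (br p q))" for q
    using linear_compose[OF linear_br_left assms(1)] by (simp add: o_def)
  show "lin (\<lambda>q. f (br p q))" for p
    using linear_compose[OF linear_br_right assms(1)] by (simp add: o_def)
  show "f (br (word s) (word t)) = B (word s) (word t)" for s t
    by (simp add: assms(4))
qed (rule assms)+

lemma bilinear_in_subspace_on_words:
  fixes B :: "nalg \<Rightarrow> nalg \<Rightarrow> 'b::real_vector"
  assumes "\<And>q. lin (\<lambda>p. B p q)" "\<And>p. lin (B p)" "subsp N"
    and "\<And>s t. s \<in> Poly_Mapping.keys p \<Longrightarrow> t \<in> Poly_Mapping.keys q \<Longrightarrow> B (word s) (word t) \<in> N"
  shows "B p q \<in> N"
proof (rule linear_in_subspace_on_words[where f = "\<lambda>p. B p q"])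
  show "B (word s) q \<in> N" if "s \<in> Poly_Mapping.keys p" for s
    by (rule linear_in_subspace_on_words[where f = "B (word s)"]) (rule assms that | assumption)+
qed (rule assms)+

subsection \<open>Homogeneous elements\<close>

text \<open>The carrier and every homogeneous part are spaces of this kind, so one linearity
  argument serves both.\<close>

definition words_space :: "nat set bword set \<Rightarrow> nalg set" where
  "words_space T = {p. Poly_Mapping.keys p \<subseteq> T}"

lemma words_space_iff: "p \<in> words_space T \<longleftrightarrow> (\<forall>t. t \<notin> T \<longrightarrow> Poly_Mapping.lookup p t = 0)"
  unfolding words_space_def by (auto simp: in_keys_iff subset_iff)

lemma subspace_words_space: "subsp (words_space T)"
  by (rule real_vector.subspaceI) (simp_all add: words_space_iff lookup_add)

lemma word_in_words_space [simp]: "word t \<in> words_space T \<longleftrightarrow> t \<in> T"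
  by (simp add: words_space_def word_def)

lemma carrier_words: "carrier (free_nalg n) = words_space {t. set_bword t \<subseteq> symbols n}"
  by (auto simp: free_nalg_def words_space_def)

lemma homogeneous_words:
  "homogeneous n k = words_space {t. set_bword t \<subseteq> symbols n \<and> wdeg t = k}"
  by (auto simp: homogeneous_def carrier_words words_space_def)

lemma homogeneous_carrier: "p \<in> homogeneous n k \<Longrightarrow> p \<in> carrier (free_nalg n)"
  by (simp add: homogeneous_def)

lemma subspace_carrier: "subsp (carrier (free_nalg n))"
  by (simp add: carrier_words subspace_words_space)

lemma subspace_homogeneous: "subsp (homogeneous n k)"
  by (simp add: homogeneous_words subspace_words_space)

lemmas homogeneous_add = real_vector.subspace_add[OF subspace_homogeneous]
  and homogeneous_diff = real_vector.subspace_diff[OF subspace_homogeneous]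
  and homogeneous_scale = real_vector.subspace_scale[OF subspace_homogeneous]
  and homogeneous_zero = real_vector.subspace_0[OF subspace_homogeneous]

lemma linear_words_space:
  assumes "lin f" "subsp N" "\<And>t. t \<in> T \<Longrightarrow> f (word t) \<in> N" "p \<in> words_space T"
  shows "f p \<in> N"
  by (rule linear_in_subspace_on_words) (use assms in \<open>auto simp: words_space_def\<close>)

lemma linear_carrier:
  assumes "lin f" "subsp N" "\<And>t. set_bword t \<subseteq> symbols n \<Longrightarrow> f (word t) \<in> N"
    and "p \<in> carrier (free_nalg n)"
  shows "f p \<in> N"
  by (rule linear_words_space[OF assms(1,2), of "{t. set_bword t \<subseteq> symbols n}"])
    (use assms in \<open>auto simp: carrier_words\<close>)

lemma linear_homogeneous:
  assumes "lin f" "subsp N" "\<And>t. set_bword t \<subseteq> symbols n \<Longrightarrow> wdeg t = k \<Longrightarrow> f (word t) \<in> N"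
    and "p \<in> homogeneous n k"
  shows "f p \<in> N"
  by (rule linear_words_space[OF assms(1,2), of "{t. set_bword t \<subseteq> symbols n \<and> wdeg t = k}"])
    (use assms in \<open>auto simp: homogeneous_words\<close>)

lemma br_words_space:
  assumes "p \<in> words_space S" "q \<in> words_space T"
    and "\<And>s t. s \<in> S \<Longrightarrow> t \<in> T \<Longrightarrow> Br s t \<in> U"
  shows "br p q \<in> words_space U"
proof (rule bilinear_in_subspace_on_words[where B = br])
  fix s t
  assume "s \<in> Poly_Mapping.keys p" "t \<in> Poly_Mapping.keys q"
  then have "s \<in> S" "t \<in> T" using assms(1,2) by (auto simp: words_space_def)
  then show "br (word s) (word t) \<in> words_space U" by (simp add: assms(3))
qed (rule linear_br_left linear_br_right subspace_words_space)+

lemma br_carrier: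
  assumes "p \<in> carrier (free_nalg n)" "q \<in> carrier (free_nalg n)"
  shows "br p q \<in> carrier (free_nalg n)"
  using assms unfolding carrier_words by (rule br_words_space) auto

lemma br_homogeneous:
  assumes "p \<in> homogeneous n i" "q \<in> homogeneous n j"
  shows "br p q \<in> homogeneous n (i + j)"
  using assms unfolding homogeneous_words by (rule br_words_space) auto

lemma word_homogeneous: "set_bword t \<subseteq> symbols n \<Longrightarrow> word t \<in> homogeneous n (wdeg t)"
  by (simp add: homogeneous_words)

section \<open>Words of degree zero and minus one\<close>

lemma symbols_card: "I \<in> symbols n \<Longrightarrow> finite I \<and> card I \<ge> 1"
  by (auto simp: symbols_def Suc_le_eq card_gt_0_iff dest: finite_subset)

text \<open>No letter has positive degree, so degrees cannot cancel in a word: degree 0 forces all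
  letters to be Z_i, and degree -1 forces exactly one letter with two indices.\<close>

lemma wdeg_nonpos: "set_bword t \<subseteq> symbols n \<Longrightarrow> wdeg t \<le> 0"
  by (induction t) (auto dest: symbols_card)

lemma singleton_symbol [simp]: "{i} \<in> symbols n \<longleftrightarrow> i < n"
  by (auto simp: symbols_def)

lemma pair_symbol [simp]: "{i, j} \<in> symbols n \<longleftrightarrow> i < n \<and> j < n"
  by (auto simp: symbols_def)

lemma symbol_card_1: "I \<in> symbols n \<Longrightarrow> card I = 1 \<Longrightarrow> \<exists>i<n. I = {i}"
  by (auto simp: symbols_def card_1_singleton_iff)

lemma symbol_card_2: "I \<in> symbols n \<Longrightarrow> card I = 2 \<Longrightarrow> \<exists>i j. i < j \<and> j < n \<and> I = {i, j}"
  by (clarsimp simp: symbols_def card_2_iff)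
    (metis doubleton_eq_iff linorder_neqE_nat)

lemma homogeneous_0_induct [consumes 2, case_names gen br]:
  assumes "set_bword t \<subseteq> symbols n" "wdeg t = 0"
    and "\<And>i. i < n \<Longrightarrow> P (Gen {i})"
    and "\<And>s t. set_bword s \<subseteq> symbols n \<Longrightarrow> wdeg s = 0 \<Longrightarrow> P s \<Longrightarrow>
      set_bword t \<subseteq> symbols n \<Longrightarrow> wdeg t = 0 \<Longrightarrow> P t \<Longrightarrow> P (Br s t)"
  shows "P t"
  using assms(1,2)
proof (induction t)
  case (Gen I)
  then show ?case using symbol_card_1[of I n] assms(3) by auto
next
  case (Br s t)
  then have "wdeg s = 0" "wdeg t = 0" using wdeg_nonpos[of s n] wdeg_nonpos[of t n] by auto
  then show ?case using Br assms(4) by auto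
qed

text \<open>One factor carries the whole degree -1 and the other has degree 0. Only the former gets
  an induction hypothesis, since the latter enters as an operator.\<close>

lemma homogeneous_1_induct [consumes 2, case_names gen left right]:
  assumes "set_bword t \<subseteq> symbols n" "wdeg t = - 1"
    and "\<And>i j. i < j \<Longrightarrow> j < n \<Longrightarrow> P (Gen {i, j})"
    and "\<And>s t. set_bword s \<subseteq> symbols n \<Longrightarrow> wdeg s = 0 \<Longrightarrow>
      set_bword t \<subseteq> symbols n \<Longrightarrow> wdeg t = - 1 \<Longrightarrow> P t \<Longrightarrow> P (Br s t)"
    and "\<And>s t. set_bword s \<subseteq> symbols n \<Longrightarrow> wdeg s = 0 \<Longrightarrow>
      set_bword t \<subseteq> symbols n \<Longrightarrow> wdeg t = - 1 \<Longrightarrow> P t \<Longrightarrow> P (Br t s)"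
  shows "P t"
  using assms(1,2)
proof (induction t)
  case (Gen I)
  then show ?case using symbol_card_2[of I n] assms(3) by auto
next
  case (Br s t)
  then have "wdeg s = 0 \<and> wdeg t = - 1 \<or> wdeg s = - 1 \<and> wdeg t = 0"
    using wdeg_nonpos[of s n] wdeg_nonpos[of t n] by auto
  then show ?case using Br assms(4,5) by auto
qed

section \<open>The Lie ideal and the differential\<close>

text \<open>The generating rules have no clause for zero; it is the antisymmetry relation of 0 with
  0.\<close>

lemma zero_in_lie_ideal: "0 \<in> lie_ideal n"
  using lie_ideal.antisymmetry[of 0 n 0 0 0] subspace_homogeneous[THEN real_vector.subspace_0]
  by simp

lemma subspace_lie_ideal: "subsp (lie_ideal n)"
  by (rule real_vector.subspaceI)
    (use zero_in_lie_ideal lie_ideal.add lie_ideal.scal in auto)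

lemmas lie_ideal_add = real_vector.subspace_add[OF subspace_lie_ideal]
  and lie_ideal_diff = real_vector.subspace_diff[OF subspace_lie_ideal]
  and lie_ideal_neg = real_vector.subspace_neg[OF subspace_lie_ideal]
  and lie_ideal_scale = real_vector.subspace_scale[OF subspace_lie_ideal]

text \<open>Rule induction in the form used for linear maps. The two ideal cases also provide
  \<open>x \<in> lie_ideal n\<close>, because a twisted Leibniz rule involves
  \<open>parity x\<close> or a projection of \<open>x\<close> besides \<open>f x\<close>.\<close>

lemma lie_ideal_image:
  fixes f :: "nalg \<Rightarrow> 'b::real_vector"
  assumes "lin f" "subsp N"
    and "\<And>x y i j. x \<in> homogeneous n i \<Longrightarrow> y \<in> homogeneous n j \<Longrightarrow>
      f (br x y - ((-1) powi (i * j + 1)) *\<^sub>R br y x) \<in> N"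
    and "\<And>x y z i j k. x \<in> homogeneous n i \<Longrightarrow> y \<in> homogeneous n j \<Longrightarrow> z \<in> homogeneous n k \<Longrightarrow>
      f (br x (br y z) - (br (br x y) z + ((-1) powi (i * j)) *\<^sub>R br y (br x z))) \<in> N"
    and "\<And>a x. a \<in> carrier (free_nalg n) \<Longrightarrow> x \<in> lie_ideal n \<Longrightarrow> f x \<in> N \<Longrightarrow> f (br a x) \<in> N"
    and "\<And>a x. a \<in> carrier (free_nalg n) \<Longrightarrow> x \<in> lie_ideal n \<Longrightarrow> f x \<in> N \<Longrightarrow> f (br x a) \<in> N"
    and "x \<in> lie_ideal n"
  shows "f x \<in> N"
  using assms(7)
proof (induction rule: lie_ideal.induct)
  case (add x y)
  then show ?case
    by (simp add: linear_add[OF assms(1)] real_vector.subspace_add[OF assms(2)])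
next
  case (scal x c)
  then show ?case
    by (simp add: linear_scale[OF assms(1)] real_vector.subspace_scale[OF assms(2)])
next
  case (antisymmetry x i y j)
  then show ?case unfolding scal_eq_scaleR by (rule assms(3))
next
  case (jacobi x i y j z k)
  then show ?case unfolding scal_eq_scaleR by (rule assms(4))
next
  case (br_left a x)
  then show ?case by (intro assms(5))
next
  case (br_right x a)
  then show ?case by (intro assms(6))
qed

lemma lie_ideal_antisymmetry:
  assumes "x \<in> homogeneous n i" "y \<in> homogeneous n j"
  shows "br x y - ((-1) powi (i * j + 1)) *\<^sub>R br y x \<in> lie_ideal n"
  using lie_ideal.antisymmetry[OF assms] by simp

lemma lie_ideal_jacobi:
  assumes "x \<in> homogeneous n i" "y \<in> homogeneous n j" "z \<in> homogeneous n k"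
  shows "br x (br y z) - (br (br x y) z + ((-1) powi (i * j)) *\<^sub>R br y (br x z)) \<in> lie_ideal n"
  using lie_ideal.jacobi[OF assms] by simp

lemma linear_id: "lin (\<lambda>x. x)"
  by (rule linearI) auto

lemma lie_ideal_carrier:
  assumes "x \<in> lie_ideal n"
  shows "x \<in> carrier (free_nalg n)"
proof (rule lie_ideal_image[OF linear_id subspace_carrier _ _ _ _ assms])
qed (auto intro!: real_vector.subspace_add[OF subspace_carrier]
  real_vector.subspace_diff[OF subspace_carrier] real_vector.subspace_scale[OF subspace_carrier]
  br_carrier dest: homogeneous_carrier)

lemma lie_ideal_hom:
  assumes "lin h" "\<And>p q. h (br p q) = br (h p) (h q)"
    and "\<And>k x. x \<in> homogeneous n k \<Longrightarrow> h x \<in> homogeneous n k"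
    and "\<And>x. x \<in> carrier (free_nalg n) \<Longrightarrow> h x \<in> carrier (free_nalg n)"
    and "x \<in> lie_ideal n"
  shows "h x \<in> lie_ideal n"
proof (rule lie_ideal_image[OF assms(1) subspace_lie_ideal _ _ _ _ assms(5)])
  fix x y i j assume "x \<in> homogeneous n i" "y \<in> homogeneous n j"
  then show "h (br x y - ((-1) powi (i * j + 1)) *\<^sub>R br y x) \<in> lie_ideal n"
    using lie_ideal_antisymmetry[of "h x" n i "h y" j]
    by (simp add: linear_diff[OF assms(1)] linear_scale[OF assms(1)] assms(2,3))
next
  fix x y z i j k assume "x \<in> homogeneous n i" "y \<in> homogeneous n j" "z \<in> homogeneous n k"
  then show "h (br x (br y z) - (br (br x y) z + ((-1) powi (i * j)) *\<^sub>R br y (br x z)))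
      \<in> lie_ideal n"
    using lie_ideal_jacobi[of "h x" n i "h y" j "h z" k]
    by (simp add: linear_diff[OF assms(1)] linear_add[OF assms(1)] linear_scale[OF assms(1)]
      assms(2,3))
qed (simp_all add: assms(2,4) lie_ideal.br_left lie_ideal.br_right)

section \<open>The differential on formal combinations\<close>

definition nalg_diff :: "nalg \<Rightarrow> nalg" where
  "nalg_diff = linear_ext diff_word"

text \<open>The sign in the Leibniz rule depends on the degree of the left factor. As a linear
  operator it also makes sense on inhomogeneous elements, so the rule for \<open>nalg_diff\<close>
  becomes bilinear.\<close>

definition parity :: "nalg \<Rightarrow> nalg" where
  "parity = linear_ext (\<lambda>t. ((-1) powi wdeg t) *\<^sub>R word t)"

lemma linear_nalg_diff: "lin nalg_diff" and linear_parity: "lin parity"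
  by (simp_all add: nalg_diff_def parity_def linear_linear_ext)

lemmas nalg_diff_simps = linear_add[OF linear_nalg_diff] linear_diff[OF linear_nalg_diff]
  linear_scale[OF linear_nalg_diff] linear_neg[OF linear_nalg_diff]

lemma parity_homogeneous:
  assumes "x \<in> homogeneous n k"
  shows "parity x = ((-1) powi k) *\<^sub>R x"
proof -
  have "lin (\<lambda>x. parity x - ((-1) powi k) *\<^sub>R x)"
    by (intro linear_compose_sub linear_parity linear_compose_scale_right linear_id)
  then have "parity x - ((-1) powi k) *\<^sub>R x \<in> {0}"
    by (rule linear_homogeneous[OF _ _ _ assms]) (auto simp: parity_def)
  then show ?thesis by simp
qed

lemma parity_br: "parity (br p q) = br (parity p) (parity q)"
proof (rule linear_on_br[OF linear_parity])
  show "lin (\<lambda>p. br (parity p) (parity q))" for q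
    using linear_compose[OF linear_parity linear_br_left] by (simp add: o_def)
  show "lin (\<lambda>q. br (parity p) (parity q))" for p
    using linear_compose[OF linear_parity linear_br_right] by (simp add: o_def)
  show "parity (word (Br s t)) = br (parity (word s)) (parity (word t))" for s t
    by (simp add: parity_def br_simps power_int_add mult.commute)
qed

lemma parity_carrier: "x \<in> carrier (free_nalg n) \<Longrightarrow> parity x \<in> carrier (free_nalg n)"
  by (rule linear_carrier[OF linear_parity subspace_carrier])
    (auto simp: parity_def carrier_words intro!: real_vector.subspace_scale[OF
        subspace_words_space])

lemma parity_lie_ideal: "x \<in> lie_ideal n \<Longrightarrow> parity x \<in> lie_ideal n"
  by (rule lie_ideal_hom[OF linear_parity parity_br])
    (simp_all add: parity_homogeneous parity_carrier
      homogeneous_scale)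

lemma nalg_diff_br: "nalg_diff (br p q) = br (nalg_diff p) q + br (parity p) (nalg_diff q)"
proof (rule linear_on_br[OF linear_nalg_diff])
  show "lin (\<lambda>p. br (nalg_diff p) q + br (parity p) (nalg_diff q))" for q
    using linear_compose_add[OF linear_compose[OF linear_nalg_diff linear_br_left[of q]]
      linear_compose[OF linear_parity linear_br_left[of "nalg_diff q"]]]
    by (simp add: o_def)
  show "lin (\<lambda>q. br (nalg_diff p) q + br (parity p) (nalg_diff q))" for p
    using linear_compose_add[OF linear_br_right[of "nalg_diff p"]
      linear_compose[OF linear_nalg_diff linear_br_right[of "parity p"]]]
    by (simp add: o_def)
  show "nalg_diff (word (Br s t)) =
      br (nalg_diff (word s)) (word t) + br (parity (word s)) (nalg_diff (word t))" for s t
    by (simp add: nalg_diff_def parity_def br_simps)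
qed

lemma diff_symbol_homogeneous:
  assumes "I \<in> symbols n"
  shows "diff_symbol I \<in> homogeneous n (2 - int (card I))"
  unfolding diff_symbol_def scal_eq_scaleR
proof (rule real_vector.subspace_sum[OF subspace_homogeneous],
    rule homogeneous_scale)
  fix J assume J: "J \<in> {J. J \<subset> I \<and> Min I \<in> J}"
  have "finite I" using assms symbols_card by blast
  then have "finite J" "card (I - J) = card I - card J" "card J \<le> card I"
    using J by (auto intro: finite_subset card_Diff_subset card_mono)
  moreover have "J \<in> symbols n" "I - J \<in> symbols n" using J assms by (auto simp: symbols_def)
  ultimately show "word (Br (Gen J) (Gen (I - J))) \<in> homogeneous n (2 - int (card I))"
    by (simp add: homogeneous_words)
qed

lemma diff_word_homogeneous:
  "set_bword t \<subseteq> symbols n \<Longrightarrow> diff_word t \<in> homogeneous n (wdeg t + 1)"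
proof (induction t)
  case (Gen I)
  then show ?case using diff_symbol_homogeneous[of I n] by (simp add: algebra_simps)
next
  case (Br s t)
  then have "br (diff_word s) (word t) \<in> homogeneous n (wdeg s + 1 + wdeg t)"
    "br (word s) (diff_word t) \<in> homogeneous n (wdeg s + (wdeg t + 1))"
    by (auto intro!: br_homogeneous word_homogeneous)
  then show ?case
    by (simp add: algebra_simps homogeneous_add
      homogeneous_scale)
qed

lemma nalg_diff_homogeneous: "x \<in> homogeneous n k \<Longrightarrow> nalg_diff x \<in> homogeneous n (k + 1)"
  by (rule linear_homogeneous[OF linear_nalg_diff subspace_homogeneous])
    (auto simp: nalg_diff_def diff_word_homogeneous)

lemma nalg_diff_carrier: "x \<in> carrier (free_nalg n) \<Longrightarrow> nalg_diff x \<in> carrier (free_nalg n)"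
  by (rule linear_carrier[OF linear_nalg_diff subspace_carrier])
    (auto simp: nalg_diff_def intro: homogeneous_carrier diff_word_homogeneous)

text \<open>\<open>d\<close> turns the antisymmetry relation of (x, y) into those of (dx, y) and (x,
  dy), and the Jacobi relation of (x, y, z) into the three with one entry differentiated. The ideal
  steps hold because \<open>parity\<close> preserves the ideal.\<close>

lemma nalg_diff_lie_ideal:
  assumes "x \<in> lie_ideal n"
  shows "nalg_diff x \<in> lie_ideal n"
proof (rule lie_ideal_image[OF linear_nalg_diff subspace_lie_ideal _ _ _ _ assms])
  fix x y i j assume x: "x \<in> homogeneous n i" and y: "y \<in> homogeneous n j"
  define a b c :: real where "a = (-1) powi i" and "b = (-1) powi j" and "c = (-1) powi (i * j)"
  have "nalg_diff (br x y - ((-1) powi (i * j + 1)) *\<^sub>R br y x) =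
    (br (nalg_diff x) y - ((-1) powi ((i + 1) * j + 1)) *\<^sub>R br y (nalg_diff x)) +
    a *\<^sub>R (br x (nalg_diff y) - ((-1) powi (i * (j + 1) + 1)) *\<^sub>R br (nalg_diff y) x)"
    by (simp add: nalg_diff_br nalg_diff_simps parity_homogeneous[OF x] parity_homogeneous[OF y]
      br_simps power_int_add distrib_left distrib_right algebra_simps
      flip: a_def b_def c_def)
       (simp add: a_def power_int_minus_one_mult_self flip: mult.assoc)
  then show "nalg_diff (br x y - ((-1) powi (i * j + 1)) *\<^sub>R br y x) \<in> lie_ideal n"
    using lie_ideal_antisymmetry[OF nalg_diff_homogeneous[OF x] y]
      lie_ideal_antisymmetry[OF x nalg_diff_homogeneous[OF y]]
    by (simp add: lie_ideal_add lie_ideal_scale)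
next
  fix x y z i j k
  assume x: "x \<in> homogeneous n i" and y: "y \<in> homogeneous n j" and z: "z \<in> homogeneous n k"
  define a b c :: real where "a = (-1) powi i" and "b = (-1) powi j" and "c = (-1) powi (i * j)"
  \<comment> \<open>In the term with \<open>nalg_diff y\<close> the sign of x occurs twice: as the
    outer factor \<open>a\<close>, and through the exponent i * (j + 1).\<close>
  have aa: "a * a = 1" "a * (a * u) = u" for u
    by (simp_all add: a_def power_int_minus_one_mult_self flip: mult.assoc)
  have "nalg_diff (br x (br y z) - (br (br x y) z + ((-1) powi (i * j)) *\<^sub>R br y (br x z))) =
    (br (nalg_diff x) (br y z) - (br (br (nalg_diff x) y) z +
      ((-1) powi ((i + 1) * j)) *\<^sub>R br y (br (nalg_diff x) z))) +
    a *\<^sub>R (br x (br (nalg_diff y) z) - (br (br x (nalg_diff y)) z +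
      ((-1) powi (i * (j + 1))) *\<^sub>R br (nalg_diff y) (br x z))) +
    (a * b) *\<^sub>R (br x (br y (nalg_diff z)) - (br (br x y) (nalg_diff z) +
      ((-1) powi (i * j)) *\<^sub>R br y (br x (nalg_diff z))))"
    by (simp add: nalg_diff_br nalg_diff_simps parity_br parity_homogeneous[OF x]
      parity_homogeneous[OF y] br_simps power_int_add distrib_left distrib_right algebra_simps
      flip: a_def b_def c_def) (simp add: aa algebra_simps)
  then show "nalg_diff (br x (br y z) - (br (br x y) z + ((-1) powi (i * j)) *\<^sub>R br y (br x z)))
      \<in> lie_ideal n"
    using lie_ideal_jacobi[OF nalg_diff_homogeneous[OF x] y z]
      lie_ideal_jacobi[OF x nalg_diff_homogeneous[OF y] z]
      lie_ideal_jacobi[OF x y nalg_diff_homogeneous[OF z]]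
    by (simp add: lie_ideal_add lie_ideal_scale)
next
  fix a x assume "a \<in> carrier (free_nalg n)" "x \<in> lie_ideal n" "nalg_diff x \<in> lie_ideal n"
  then show "nalg_diff (br a x) \<in> lie_ideal n" "nalg_diff (br x a) \<in> lie_ideal n"
    unfolding nalg_diff_br
    by (simp_all add: lie_ideal_add lie_ideal.br_left lie_ideal.br_right nalg_diff_carrier
      parity_carrier parity_lie_ideal)
qed

subsection \<open>Degrees zero and minus one\<close>

lemma degree_0_hom_antisymmetry:
  assumes "x \<in> homogeneous n 0" "y \<in> homogeneous n j"
  shows "br x y + br y x \<in> lie_ideal n" "br y x + br x y \<in> lie_ideal n"
  using lie_ideal_antisymmetry[OF assms] by (simp_all add: add.commute)

lemma degree_0_jacobi:
  assumes "x \<in> homogeneous n 0" "y \<in> homogeneous n j" "z \<in> homogeneous n k"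
  shows "br x (br y z) - br (br x y) z - br y (br x z) \<in> lie_ideal n"
  using lie_ideal_jacobi[OF assms] by (simp add: algebra_simps)

lemma homogeneous_pos: "k > 0 \<Longrightarrow> x \<in> homogeneous n k \<Longrightarrow> x = 0"
  using linear_homogeneous[OF linear_id real_vector.subspace_single_0, of n k x] wdeg_nonpos
  by fastforce

text \<open>The value would have degree 1, where there are no words.\<close>

lemma nalg_diff_degree_0: "x \<in> homogeneous n 0 \<Longrightarrow> nalg_diff x = 0"
  using nalg_diff_homogeneous[of x n 0] homogeneous_pos[of 1 "nalg_diff x" n] by simp

lemma nalg_diff_degree_m1: "x \<in> homogeneous n (- 1) \<Longrightarrow> nalg_diff x \<in> homogeneous n 0"
  using nalg_diff_homogeneous[of x n "- 1"] by simp

lemma nalg_diff_br_0_m1: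
  assumes "g \<in> homogeneous n 0" "x \<in> homogeneous n k"
  shows "nalg_diff (br g x) = br g (nalg_diff x)"
  using assms by (simp add: nalg_diff_br nalg_diff_degree_0 parity_homogeneous)

lemma nalg_diff_br_m1_0:
  assumes "g \<in> homogeneous n 0" "x \<in> homogeneous n k"
  shows "nalg_diff (br x g) = br (nalg_diff x) g"
  using assms by (simp add: nalg_diff_br nalg_diff_degree_0)

lemma nalg_diff_br_m1_m1:
  assumes "x \<in> homogeneous n (- 1)" "y \<in> homogeneous n (- 1)"
  shows "nalg_diff (br x y) = br (nalg_diff x) y - br x (nalg_diff y)"
  using assms by (simp add: nalg_diff_br parity_homogeneous br_simps)

section \<open>Vector spaces presented by quotient maps\<close>

text \<open>A record whose operations are computed on representatives from a subspace of a real
  vector space type, so that the linear algebra takes place in the type class. When two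
  representatives have the same class is settled separately for each instance, by
  \<open>cls_eq_iff\<close> and \<open>cls1_eq_iff\<close>.\<close>

locale presentation =
  fixes L :: "(real, 'a) module" and S :: "'b::real_vector set" and c :: "'b \<Rightarrow> 'a"
  assumes subspace: "subsp S"
    and carrier_eq: "carrier L = c ` S"
    and add_eq: "p \<in> S \<Longrightarrow> q \<in> S \<Longrightarrow> c p \<oplus>\<^bsub>L\<^esub> c q = c (p + q)"
    and smult_eq: "p \<in> S \<Longrightarrow> r \<odot>\<^bsub>L\<^esub> c p = c (r *\<^sub>R p)"
    and zero_eq: "\<zero>\<^bsub>L\<^esub> = c 0"
begin

lemmas S_simps [simp] = real_vector.subspace_0[OF subspace] real_vector.subspace_add[OF subspace]
  real_vector.subspace_diff[OF subspace] real_vector.subspace_neg[OF subspace]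
  real_vector.subspace_scale[OF subspace]

lemma class_closed: "p \<in> S \<Longrightarrow> c p \<in> carrier L"
  by (simp add: carrier_eq)

lemma abelian_group: "abelian_group L"
proof (rule abelian_groupI)
  fix x assume "x \<in> carrier L"
  then obtain p where "p \<in> S" "x = c p" by (auto simp: carrier_eq)
  then show "\<exists>y\<in>carrier L. y \<oplus>\<^bsub>L\<^esub> x = \<zero>\<^bsub>L\<^esub>"
    by (intro bexI[of _ "c (- p)"]) (simp_all add: add_eq zero_eq carrier_eq)
qed (auto simp: carrier_eq zero_eq add_eq ac_simps)

lemma vectorspace: "vectorspace class_ring L"
proof (intro vectorspace.intro moduleI abelian_group)
qed (auto simp: carrier_eq add_eq smult_eq scaleR_add_left scaleR_add_right
    class_field.field_axioms class_cring.cring_axioms)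

lemma uminus_eq: "p \<in> S \<Longrightarrow> \<ominus>\<^bsub>L\<^esub> c p = c (- p)"
  using abelian_group.minus_equality[OF abelian_group, of "c (- p)" "c p"]
  by (simp add: carrier_eq add_eq zero_eq)

lemma minus_eq: "p \<in> S \<Longrightarrow> q \<in> S \<Longrightarrow> c p \<ominus>\<^bsub>L\<^esub> c q = c (p - q)"
  by (simp add: a_minus_def uminus_eq add_eq)

lemma lie_algebraI:
  assumes closed: "\<And>p q. p \<in> S \<Longrightarrow> q \<in> S \<Longrightarrow> B p q \<in> S"
    and left: "\<And>q. lin (\<lambda>p. B p q)" and right: "\<And>p. lin (B p)"
    and mult: "\<And>p q. p \<in> S \<Longrightarrow> q \<in> S \<Longrightarrow> c p \<otimes>\<^bsub>L\<^esub> c q = c (B p q)"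
    and alt: "\<And>p. p \<in> S \<Longrightarrow> c (B p p) = c 0"
    and jacobi: "\<And>p q r. p \<in> S \<Longrightarrow> q \<in> S \<Longrightarrow> r \<in> S \<Longrightarrow>
      c (B p (B q r) + B q (B r p) + B r (B p q)) = c 0"
  shows "lie_algebra L"
  unfolding lie_algebra_def
proof (intro conjI ballI)
  fix x assume "x \<in> carrier L"
  then obtain p where p: "p \<in> S" "x = c p" by (auto simp: carrier_eq)
  show "(\<lambda>y. x \<otimes>\<^bsub>L\<^esub> y) \<in> module_hom class_ring L L"
    using p by (auto simp: LinearCombinations.module_hom_def carrier_eq mult closed add_eq smult_eq
        linear_add[OF right] linear_scale[OF right])
  show "(\<lambda>y. y \<otimes>\<^bsub>L\<^esub> x) \<in> module_hom class_ring L L"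
    using p by (auto simp: LinearCombinations.module_hom_def carrier_eq mult closed add_eq smult_eq
        linear_add[OF left] linear_scale[OF left])
  show "x \<otimes>\<^bsub>L\<^esub> x = \<zero>\<^bsub>L\<^esub>" using p by (simp add: mult zero_eq alt)
  fix y z assume "y \<in> carrier L" "z \<in> carrier L"
  then obtain q r where "q \<in> S" "y = c q" "r \<in> S" "z = c r" by (auto simp: carrier_eq)
  with p show "x \<otimes>\<^bsub>L\<^esub> (y \<otimes>\<^bsub>L\<^esub> z) \<oplus>\<^bsub>L\<^esub> y \<otimes>\<^bsub>L\<^esub> (z \<otimes>\<^bsub>L\<^esub> x) \<oplus>\<^bsub>L\<^esub> z \<otimes>\<^bsub>L\<^esub> (x \<otimes>\<^bsub>L\<^esub> y) = \<zero>\<^bsub>L\<^esub>"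
    by (simp add: mult closed add_eq zero_eq jacobi)
qed (rule vectorspace)

text \<open>Both \<open>exact_brackets\<close> and \<open>lie_derived\<close> use the span inside a
  record; this rewrites it as a span of representatives.\<close>

lemma span_image:
  assumes "T \<subseteq> S"
  shows "LinearCombinations.module.span class_ring L (c ` T) = c ` Real_Vector_Spaces.span T"
proof (rule equalityI)
  interpret V: vectorspace class_ring L by (rule vectorspace)
  have TS: "Real_Vector_Spaces.span T \<subseteq> S"
    using assms subspace by (rule real_vector.span_minimal)
  have cT: "c ` T \<subseteq> carrier L" using assms by (auto simp: carrier_eq)
  have "submodule class_ring (c ` Real_Vector_Spaces.span T) L"
  proof
    show "c ` Real_Vector_Spaces.span T \<subseteq> carrier L" using TS by (auto simp: carrier_eq)
  next
    fix v w assume "v \<in> c ` Real_Vector_Spaces.span T" "w \<in> c ` Real_Vector_Spaces.span T"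
    then show "v \<oplus>\<^bsub>L\<^esub> w \<in> c ` Real_Vector_Spaces.span T"
      using TS by (auto simp: add_eq subset_iff intro: real_vector.span_add)
  next
    show "\<zero>\<^bsub>L\<^esub> \<in> c ` Real_Vector_Spaces.span T"
      by (auto simp: zero_eq intro: real_vector.span_zero)
  next
    fix r :: real and v assume "v \<in> c ` Real_Vector_Spaces.span T"
    then show "r \<odot>\<^bsub>L\<^esub> v \<in> c ` Real_Vector_Spaces.span T"
      using TS by (auto simp: smult_eq subset_iff intro: real_vector.span_scale)
  qed
  then show "V.span (c ` T) \<subseteq> c ` Real_Vector_Spaces.span T"
    by (rule V.span_is_subset[rotated]) (auto intro: real_vector.span_base)
  interpret W: submodule class_ring "V.span (c ` T)" L
    by (rule V.span_is_submodule[OF cT])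
  \<comment> \<open>Membership in \<open>S\<close> is carried along because \<open>c\<close> is
    known to be additive only there.\<close>
  have "p \<in> S \<and> c p \<in> V.span (c ` T)" if "p \<in> Real_Vector_Spaces.span T" for p
    using that
  proof (induction rule: real_vector.span_induct_alt)
    case base
    then show ?case using W.zero_closed by (simp add: zero_eq)
  next
    case (step r x y)
    then have "x \<in> S" "y \<in> S" using assms by auto
    moreover have "c x \<in> V.span (c ` T)" using V.in_own_span[OF cT] step by auto
    ultimately show ?case
      using W.m_closed[OF W.smult_closed[of r "c x"], of "c y"] step(2)
      by (simp add: add_eq smult_eq)
  qed
  then show "c ` Real_Vector_Spaces.span T \<subseteq> V.span (c ` T)" by blast
qed

end

section \<open>Quotients of presented spaces\<close>

locale presented_quotient = presentation M S c
  for M :: "(real, 'a) module" and S :: "'b::real_vector set" and c +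
  fixes N
  assumes sub: "submodule class_ring N M"
begin

lemma abelian_subgroup: "abelian_subgroup N M"
proof (rule abelian_subgroupI3[OF _ abelian_group])
  interpret submodule class_ring N M by (rule sub)
  interpret abelian_group M by (rule abelian_group)
  have "\<ominus>\<^bsub>M\<^esub> x \<in> N" if "x \<in> N" for x
  proof -
    obtain p where "p \<in> S" "x = c p" using \<open>x \<in> N\<close> subset by (auto simp: carrier_eq)
    then show ?thesis using smult_closed[of "- 1" x] that by (simp add: smult_eq uminus_eq)
  qed
  then show "additive_subgroup N M"
    using subset by (intro additive_subgroupI subgroup.intro) (auto simp: a_inv_def)
qed

interpretation N: abelian_subgroup N M by (rule abelian_subgroup)

abbreviation coset :: "'b \<Rightarrow> 'a set" where
  "coset p \<equiv> N +>\<^bsub>M\<^esub> c p"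

lemma mem_coset: "p \<in> S \<Longrightarrow> q \<in> S \<Longrightarrow> c q \<in> coset p \<longleftrightarrow> c (q - p) \<in> N"
  using N.a_rcos_module[of "c p" "c q"] abelian_subgroup
  by (simp add: class_closed a_minus_def flip: minus_eq)

lemma coset_eq_iff: "p \<in> S \<Longrightarrow> q \<in> S \<Longrightarrow> coset p = coset q \<longleftrightarrow> c (p - q) \<in> N"
  using N.a_repr_independence[of "c p" N "c q"] N.a_rcos_self[of "c p"]
  by (metis abelian_subgroup abelian_subgroup.a_repr_independence' class_closed mem_coset
      N.a_rcos_self)

lemma coset_subset: "p \<in> S \<Longrightarrow> X \<in> coset p \<Longrightarrow> \<exists>q\<in>S. X = c q"
  using N.a_r_coset_subset_G[of N "c p"] N.a_subset class_closed carrier_eq by blast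

lemma presentation_quot: "presentation (quot_module M N) S coset"
proof
  fix p q r assume p: "p \<in> S"
  { assume q: "q \<in> S"
    show "coset p \<oplus>\<^bsub>quot_module M N\<^esub> coset q = coset (p + q)"
      using p q N.a_rcos_sum[of "c p" "c q"]
      by (simp add: quot_module_def ring.extend_def module.fields_def FactRing_def
          class_closed add_eq) }
  show "r \<odot>\<^bsub>quot_module M N\<^esub> coset p = coset (r *\<^sub>R p)"
  proof -
    have "N +>\<^bsub>M\<^esub> (r \<odot>\<^bsub>M\<^esub> x) = coset (r *\<^sub>R p)" if x: "x \<in> coset p" for x
    proof -
      obtain q where q: "q \<in> S" "x = c q" using coset_subset[OF p x] by auto
      then have "c (q - p) \<in> N" using mem_coset x p by simp
      then have "r \<odot>\<^bsub>M\<^esub> c (q - p) \<in> N" using submodule.smult_closed[OF sub] by auto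
      then show ?thesis using p q by (simp add: smult_eq coset_eq_iff scaleR_diff_right)
    qed
    then show ?thesis
      using N.a_rcos_self[of "c p"] p
      by (auto simp: quot_module_def ring.extend_def module.fields_def coset_map_def class_closed)
  qed
qed (use N.a_coset_add_zero[of N] N.a_subset in \<open>auto simp: quot_module_def ring.extend_def
    module.fields_def FactRing_def A_RCOSETS_def'
    carrier_eq subspace simp flip: zero_eq\<close>)

text \<open>Operations on quotients are written as unions over cosets. A nonempty union of equal
  sets is that set, so independence of the representative is all that has to be shown.\<close>

lemma coset_Union:
  assumes p: "p \<in> S" and f: "\<And>q. q \<in> S \<Longrightarrow> c (q - p) \<in> N \<Longrightarrow> f (c q) = Y"
  shows "(\<Union>x\<in>coset p. f x) = Y"
proof -
  have "f x = Y" if x: "x \<in> coset p" for x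
  proof -
    obtain q where "q \<in> S" "x = c q" using coset_subset[OF p x] by auto
    then show ?thesis using f mem_coset p x by simp
  qed
  then show ?thesis using N.a_rcos_self[of "c p"] p class_closed by blast
qed

lemma coset_map_coset:
  assumes p: "p \<in> S" and h: "\<And>q. q \<in> S \<Longrightarrow> h q \<in> S \<and> f (c q) = c (h q)"
    and lin: "lin h" and N: "\<And>q. q \<in> S \<Longrightarrow> c q \<in> N \<Longrightarrow> c (h q) \<in> N"
  shows "coset_map M N f (coset p) = coset (h p)"
  unfolding coset_map_def
proof (rule coset_Union[OF p])
  fix q assume "q \<in> S" "c (q - p) \<in> N"
  then show "N +>\<^bsub>M\<^esub> f (c q) = coset (h p)"
    using p h N[of "q - p"] by (simp add: coset_eq_iff linear_diff[OF lin])
qed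

end

section \<open>The free graded Lie algebra and its parts\<close>

abbreviation cls :: "nat \<Rightarrow> nalg \<Rightarrow> nalg set" where
  "cls \<equiv> gla_class"

interpretation nalg: presentation "free_nalg n" "carrier (free_nalg n)" "\<lambda>p. p" for n
  by standard (auto simp: free_nalg_def subspace_carrier[unfolded free_nalg_def, simplified])

lemma submodule_lie_ideal: "submodule class_ring (lie_ideal n) (free_nalg n)"
proof (rule submodule.intro)
  show "Module.module class_ring (free_nalg n)"
    using nalg.vectorspace by (simp add: vectorspace_def)
qed (auto simp: free_nalg_def zero_in_lie_ideal lie_ideal_add lie_ideal_scale
    dest: lie_ideal_carrier[unfolded free_nalg_def, simplified])

interpretation gla: presented_quotient "free_nalg n" "carrier (free_nalg n)" "\<lambda>p. p" "lie_ideal n"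
    for n
  by (intro presented_quotient.intro presented_quotient_axioms.intro nalg.presentation_axioms
    submodule_lie_ideal)

interpretation free_gla: presentation "free_gla n" "carrier (free_nalg n)" "cls n" for n
  unfolding free_gla_def gla_class_def by (rule gla.presentation_quot)

lemma cls_eq_iff:
  "p \<in> carrier (free_nalg n) \<Longrightarrow> q \<in> carrier (free_nalg n) \<Longrightarrow> cls n p = cls n q \<longleftrightarrow> p - q \<in> lie_ideal n"
  unfolding gla_class_def by (rule gla.coset_eq_iff)

lemma cls_eqI:
  "p \<in> carrier (free_nalg n) \<Longrightarrow> q \<in> carrier (free_nalg n) \<Longrightarrow> p - q \<in> lie_ideal n \<Longrightarrow> cls n p = cls n q"
  by (simp add: cls_eq_iff)

lemma cls_mult:
  assumes p: "p \<in> carrier (free_nalg n)" and q: "q \<in> carrier (free_nalg n)"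
  shows "cls n p \<otimes>\<^bsub>free_gla n\<^esub> cls n q = cls n (br p q)"
proof -
  have mult: "br p q - br p' q' \<in> lie_ideal n"
    if "p \<in> carrier (free_nalg n)" "q' \<in> carrier (free_nalg n)"
      "p - p' \<in> lie_ideal n" "q - q' \<in> lie_ideal n" for p q p' q'
    using lie_ideal_add[OF lie_ideal.br_left[OF that(1,4)] lie_ideal.br_right[OF that(3,2)]]
    by (simp add: br_simps)
  have "(\<Union>a\<in>cls n p. \<Union>b\<in>cls n q. lie_ideal n +>\<^bsub>free_nalg n\<^esub> br a b) = cls n (br p q)"
    unfolding gla_class_def
    by (intro gla.coset_Union p q) (simp add: gla.coset_eq_iff br_carrier p q mult)
  then show ?thesis
    by (simp add: free_gla_def quot_module_def ring.extend_def module.fields_def FactRing_def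
        rcoset_mult_def free_nalg_def)
qed

lemma gla_diff_cls: "p \<in> carrier (free_nalg n) \<Longrightarrow> gla_diff n (cls n p) = cls n (nalg_diff p)"
  unfolding gla_diff_def gla_class_def nalg_diff_def[symmetric]
  by (rule gla.coset_map_coset)
    (auto simp: nalg_diff_carrier linear_nalg_diff nalg_diff_lie_ideal)

lemma presentation_gla_part: "presentation ((free_gla n)\<lparr>carrier := gla_part n k\<rparr>)
    (homogeneous n k) (cls n)"
  by standard (auto simp: subspace_homogeneous gla_part_def free_gla.add_eq free_gla.smult_eq
      free_gla.zero_eq homogeneous_carrier)

section \<open>The Lie algebra \<open>g0\<close>\<close>

interpretation g0: presentation "g0 n" "homogeneous n 0" "cls n" for n
  unfolding g0_def by (rule presentation_gla_part)

interpretation f_minus1: presentation "f_minus1 n" "homogeneous n (- 1)" "cls n" for n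
  unfolding f_minus1_def by (rule presentation_gla_part)

lemma g0_mult: "p \<in> homogeneous n 0 \<Longrightarrow> q \<in> homogeneous n 0 \<Longrightarrow> cls n p \<otimes>\<^bsub>g0 n\<^esub> cls n q =
    cls n (br p q)"
  by (simp add: g0_def cls_mult homogeneous_carrier)

lemma br_closed_0 [simp]: "p \<in> homogeneous n 0 \<Longrightarrow> q \<in> homogeneous n k \<Longrightarrow> br p q \<in> homogeneous n k"
  and br_closed_0' [simp]: "p \<in> homogeneous n 0 \<Longrightarrow> q \<in> homogeneous n k \<Longrightarrow> br q p \<in> homogeneous n k"
  using br_homogeneous[of p n 0 q k] br_homogeneous[of q n k p 0] by simp_all

lemma zero_cls_iff: "p \<in> carrier (free_nalg n) \<Longrightarrow> cls n p = cls n 0 \<longleftrightarrow> p \<in> lie_ideal n"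
  using cls_eq_iff[of p n 0] by simp

text \<open>Antisymmetry gives 2 [p, p] = 0, and 2 is invertible.\<close>

lemma degree_0_alternating:
  assumes "p \<in> homogeneous n 0"
  shows "br p p \<in> lie_ideal n"
proof -
  have "br p p = (1/2) *\<^sub>R (br p p + br p p)" by (simp flip: scaleR_2)
  then show ?thesis
    using degree_0_hom_antisymmetry(1)[OF assms assms] lie_ideal_scale by metis
qed

lemma lie_algebra_g0: "lie_algebra (g0 n)"
proof (rule g0.lie_algebraI[where B = br])
  fix p q r assume *: "p \<in> homogeneous n 0" "q \<in> homogeneous n 0" "r \<in> homogeneous n 0"
  \<comment> \<open>The cyclic Jacobi sum is the derivation form of \<open>degree_0_jacobi\<close>
    plus two antisymmetry corrections.\<close>
  have "br p (br q r) + br q (br r p) + br r (br p q) =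
      (br p (br q r) - br (br p q) r - br q (br p r)) + br q (br p r + br r p)
        + (br (br p q) r + br r (br p q))"
    by (simp add: br_simps)
  also have "\<dots> \<in> lie_ideal n"
    using * by (intro lie_ideal_add degree_0_jacobi lie_ideal.br_left degree_0_hom_antisymmetry)
      (auto intro: homogeneous_carrier)
  finally show "cls n (br p (br q r) + br q (br r p) + br r (br p q)) = cls n 0"
    using * by (subst zero_cls_iff) (auto intro: lie_ideal_carrier)
qed (simp_all add: g0_mult zero_cls_iff homogeneous_carrier degree_0_alternating br_carrier
    linear_br_left linear_br_right)

section \<open>The Peiffer quotient\<close>

text \<open>An explicit spanning set for the relations of \<open>g1\<close>. In degree -1 it is the
  preimage of d[f^-1, f^-1], by \<open>cls_in_exact_brackets_iff\<close>; a linear map then descends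
  to \<open>g1\<close> once it respects these generators.\<close>

definition peiffer :: "nat \<Rightarrow> nalg set" where
  "peiffer n = Real_Vector_Spaces.span (lie_ideal n \<union>
     {br (nalg_diff x) y + br (nalg_diff y) x | x y. x \<in> homogeneous n (- 1) \<and>
         y \<in> homogeneous n (- 1)})"

lemma subspace_peiffer: "subsp (peiffer n)"
  by (simp add: peiffer_def)

lemmas peiffer_add = real_vector.subspace_add[OF subspace_peiffer]
  and peiffer_diff = real_vector.subspace_diff[OF subspace_peiffer]
  and peiffer_neg = real_vector.subspace_neg[OF subspace_peiffer]
  and peiffer_scale = real_vector.subspace_scale[OF subspace_peiffer]
  and zero_in_peiffer [simp] = real_vector.subspace_0[OF subspace_peiffer]

lemma lie_ideal_peiffer: "x \<in> lie_ideal n \<Longrightarrow> x \<in> peiffer n"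
  by (simp add: peiffer_def real_vector.span_base)

lemma peiffer_identity:
  "x \<in> homogeneous n (- 1) \<Longrightarrow> y \<in> homogeneous n (- 1) \<Longrightarrow>
    br (nalg_diff x) y + br (nalg_diff y) x \<in> peiffer n"
  unfolding peiffer_def by (rule real_vector.span_base) blast

lemma peiffer_image:
  assumes lin: "lin f" and sub: "subsp M"
    and "\<And>x. x \<in> lie_ideal n \<Longrightarrow> f x \<in> M"
    and "\<And>x y. x \<in> homogeneous n (- 1) \<Longrightarrow> y \<in> homogeneous n (- 1) \<Longrightarrow>
      f (br (nalg_diff x) y + br (nalg_diff y) x) \<in> M"
    and "p \<in> peiffer n"
  shows "f p \<in> M"
proof -
  have "peiffer n \<subseteq> f -` M"
    unfolding peiffer_def
    by (rule real_vector.span_minimal)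
      (use assms(3,4) linear_subspace_vimage[OF lin sub] in auto)
  with assms(5) show ?thesis by blast
qed

text \<open>Bracketing with g is a derivation that commutes with \<open>d\<close>. Up to Jacobi
  relations it sends the Peiffer relation of (x, y) to the sum of those of ([g, x], y) and ([g, y],
  x).\<close>

lemma peiffer_act:
  assumes g: "g \<in> homogeneous n 0" and "p \<in> peiffer n"
  shows "br g p \<in> peiffer n"
proof (rule peiffer_image[OF linear_br_right subspace_peiffer _ _ assms(2)])
  show "br g x \<in> peiffer n" if "x \<in> lie_ideal n" for x
    using that g by (intro lie_ideal_peiffer lie_ideal.br_left) (auto intro: homogeneous_carrier)
  fix x y assume x: "x \<in> homogeneous n (- 1)" and y: "y \<in> homogeneous n (- 1)"
  note D = nalg_diff_degree_m1 nalg_diff_br_0_m1[OF g]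
  have "br g (br (nalg_diff x) y + br (nalg_diff y) x) =
    (br g (br (nalg_diff x) y) - br (br g (nalg_diff x)) y - br (nalg_diff x) (br g y)) +
    (br g (br (nalg_diff y) x) - br (br g (nalg_diff y)) x - br (nalg_diff y) (br g x)) +
    (br (nalg_diff (br g x)) y + br (nalg_diff y) (br g x)) +
    (br (nalg_diff (br g y)) x + br (nalg_diff x) (br g y))"
    by (simp add: D(2)[OF x] D(2)[OF y] br_simps)
  also have "\<dots> \<in> peiffer n"
    using g x y D(1)
    by (intro peiffer_add lie_ideal_peiffer[OF degree_0_jacobi] peiffer_identity) auto
  finally show "br g (br (nalg_diff x) y + br (nalg_diff y) x) \<in> peiffer n" .
qed

text \<open>A Peiffer relation is sent to [dx, dy] + [dy, dx], an antisymmetry relation. This is why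
  \<open>tau\<close> is well defined.\<close>

lemma nalg_diff_peiffer:
  assumes "p \<in> peiffer n"
  shows "nalg_diff p \<in> lie_ideal n"
proof (rule peiffer_image[OF linear_nalg_diff subspace_lie_ideal _ _ assms])
  fix x y assume x: "x \<in> homogeneous n (- 1)" and y: "y \<in> homogeneous n (- 1)"
  then show "nalg_diff (br (nalg_diff x) y + br (nalg_diff y) x) \<in> lie_ideal n"
    using degree_0_hom_antisymmetry[of "nalg_diff x" n "nalg_diff y" 0]
      nalg_diff_br_0_m1[OF nalg_diff_degree_m1[OF x] y]
      nalg_diff_br_0_m1[OF nalg_diff_degree_m1[OF y] x]
    by (simp add: nalg_diff_simps nalg_diff_degree_m1)
qed (rule nalg_diff_lie_ideal)

section \<open>Exact brackets as Peiffer relations\<close>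

definition bracket_span :: "nat \<Rightarrow> nalg set" where
  "bracket_span n = Real_Vector_Spaces.span
     {br x y | x y. x \<in> homogeneous n (- 1) \<and> y \<in> homogeneous n (- 1)}"

lemma bracket_span_homogeneous: "bracket_span n \<subseteq> homogeneous n (- 2)"
  unfolding bracket_span_def
proof (rule real_vector.span_minimal[OF _ subspace_homogeneous])
  show "{br x y | x y. x \<in> homogeneous n (- 1) \<and> y \<in> homogeneous n (- 1)} \<subseteq> homogeneous n (- 2)"
    using br_homogeneous[of _ n "- 1" _ "- 1"] by auto
qed

lemma exact_brackets_eq: "exact_brackets n = cls n ` nalg_diff ` bracket_span n"
proof -
  let ?T = "{br x y | x y. x \<in> homogeneous n (- 1) \<and> y \<in> homogeneous n (- 1)}"
  have T: "?T \<subseteq> carrier (free_nalg n)" by (auto intro: br_carrier homogeneous_carrier)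
  have "{x \<otimes>\<^bsub>free_gla n\<^esub> y | x y. x \<in> gla_part n (- 1) \<and> y \<in> gla_part n (- 1)} = cls n ` ?T"
  proof (intro equalityI subsetI)
    fix X assume "X \<in> {x \<otimes>\<^bsub>free_gla n\<^esub> y | x y. x \<in> gla_part n (- 1) \<and> y \<in> gla_part n (- 1)}"
    then obtain p q where "p \<in> homogeneous n (- 1)" "q \<in> homogeneous n (- 1)"
      "X = cls n p \<otimes>\<^bsub>free_gla n\<^esub> cls n q" by (auto simp: gla_part_def)
    then show "X \<in> cls n ` ?T" by (auto simp: cls_mult homogeneous_carrier)
  next
    fix X assume "X \<in> cls n ` ?T"
    then obtain p q where "p \<in> homogeneous n (- 1)" "q \<in> homogeneous n (- 1)"
      "X = cls n p \<otimes>\<^bsub>free_gla n\<^esub> cls n q" by (auto simp: cls_mult homogeneous_carrier)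
    then show "X \<in> {x \<otimes>\<^bsub>free_gla n\<^esub> y | x y. x \<in> gla_part n (- 1) \<and> y \<in> gla_part n (- 1)}"
      unfolding gla_part_def by blast
  qed
  then have "exact_brackets n = gla_diff n ` cls n ` bracket_span n"
    by (simp add: exact_brackets_def bracket_span_def free_gla.span_image[OF T])
  also have "\<dots> = cls n ` nalg_diff ` bracket_span n"
    unfolding image_image
    using bracket_span_homogeneous
    by (intro image_cong gla_diff_cls) (auto intro: homogeneous_carrier)
  finally show ?thesis .
qed

lemma nalg_diff_bracket_span:
  assumes "q \<in> bracket_span n"
  shows "nalg_diff q \<in> homogeneous n (- 1) \<inter> peiffer n"
proof -
  have "bracket_span n \<subseteq> nalg_diff -` peiffer n"
    unfolding bracket_span_def
  proof (rule real_vector.span_minimal)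
    show "subsp (nalg_diff -` peiffer n)"
      by (rule linear_subspace_vimage[OF linear_nalg_diff subspace_peiffer])
    have "nalg_diff (br x y) \<in> peiffer n"
      if x: "x \<in> homogeneous n (- 1)" and y: "y \<in> homogeneous n (- 1)" for x y
    proof -
      \<comment> \<open>The Leibniz sign in degree -1 gives d[x, y] = [dx, y] - [x, dy]; moving dy
        to the left costs one antisymmetry relation.\<close>
      have "nalg_diff (br x y) = (br (nalg_diff x) y + br (nalg_diff y) x) -
          (br (nalg_diff y) x + br x (nalg_diff y))"
        by (simp add: nalg_diff_br_m1_m1[OF x y])
      also have "\<dots> \<in> peiffer n"
        using x y by (intro peiffer_diff peiffer_identity lie_ideal_peiffer
            degree_0_hom_antisymmetry nalg_diff_degree_m1)
      finally show ?thesis .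
    qed
    then show "{br x y | x y. x \<in> homogeneous n (- 1) \<and> y \<in> homogeneous n (- 1)} \<subseteq>
        nalg_diff -` peiffer n"
      by auto
  qed
  moreover have "nalg_diff q \<in> homogeneous n (- 1)"
    using nalg_diff_homogeneous[of q n "- 2"] bracket_span_homogeneous[of n] assms by auto
  ultimately show ?thesis using assms by auto
qed

text \<open>The converse of \<open>nalg_diff_bracket_span\<close>: a Peiffer relation has the
  witness \<open>br x y\<close>, and the elements that have a witness form a subspace.\<close>

lemma peiffer_bracket_span:
  assumes "p \<in> peiffer n"
  shows "\<exists>q\<in>bracket_span n. p - nalg_diff q \<in> lie_ideal n"
proof -
  let ?U = "{p. \<exists>q\<in>bracket_span n. p - nalg_diff q \<in> lie_ideal n}"
  have sub: "subsp (bracket_span n)" by (simp add: bracket_span_def)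
  have "peiffer n \<subseteq> ?U"
    unfolding peiffer_def
  proof (rule real_vector.span_minimal)
    show "subsp ?U"
    proof (rule real_vector.subspaceI)
      show "0 \<in> ?U"
        using real_vector.subspace_0[OF sub] linear_0[OF linear_nalg_diff] zero_in_lie_ideal
        by force
      fix p p' assume "p \<in> ?U" "p' \<in> ?U"
      then obtain q q' where "q \<in> bracket_span n" "p - nalg_diff q \<in> lie_ideal n"
        "q' \<in> bracket_span n" "p' - nalg_diff q' \<in> lie_ideal n" by auto
      then show "p + p' \<in> ?U"
        using lie_ideal_add[of "p - nalg_diff q" n "p' - nalg_diff q'"]
        by (auto intro!: bexI[of _ "q + q'"] real_vector.subspace_add[OF sub]
            simp: nalg_diff_simps algebra_simps)
    next
      fix r p assume "p \<in> ?U"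
      then obtain q where "q \<in> bracket_span n" "p - nalg_diff q \<in> lie_ideal n" by auto
      then show "r *\<^sub>R p \<in> ?U"
        using lie_ideal_scale[of "p - nalg_diff q" n r]
        by (auto intro!: bexI[of _ "r *\<^sub>R q"] real_vector.subspace_scale[OF sub]
            simp: nalg_diff_simps algebra_simps)
    qed
    have "br (nalg_diff x) y + br (nalg_diff y) x \<in> ?U"
      if x: "x \<in> homogeneous n (- 1)" and y: "y \<in> homogeneous n (- 1)" for x y
    proof -
      have "br (nalg_diff x) y + br (nalg_diff y) x - nalg_diff (br x y) \<in> lie_ideal n"
        using degree_0_hom_antisymmetry[OF nalg_diff_degree_m1[OF y] x]
        by (simp add: nalg_diff_br_m1_m1[OF x y])
      moreover have "br x y \<in> bracket_span n"
        unfolding bracket_span_def using x y by (intro real_vector.span_base) blast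
      ultimately show ?thesis by blast
    qed
    moreover have "x \<in> ?U" if "x \<in> lie_ideal n" for x
      using that real_vector.subspace_0[OF sub] linear_0[OF linear_nalg_diff]
      by (auto intro!: bexI[of _ 0])
    ultimately show "lie_ideal n \<union> {br (nalg_diff x) y + br (nalg_diff y) x | x y.
        x \<in> homogeneous n (- 1) \<and> y \<in> homogeneous n (- 1)} \<subseteq> ?U"
      by blast
  qed
  with assms show ?thesis by blast
qed

lemma cls_in_exact_brackets_iff:
  assumes p: "p \<in> homogeneous n (- 1)"
  shows "cls n p \<in> exact_brackets n \<longleftrightarrow> p \<in> peiffer n"
proof
  assume "cls n p \<in> exact_brackets n"
  then obtain q where q: "q \<in> bracket_span n" "cls n p = cls n (nalg_diff q)"
    by (auto simp: exact_brackets_eq)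
  then have "p - nalg_diff q \<in> lie_ideal n"
    using p nalg_diff_bracket_span[OF q(1)] cls_eq_iff[of p n "nalg_diff q"]
    by (auto dest: homogeneous_carrier)
  then show "p \<in> peiffer n"
    using nalg_diff_bracket_span[OF q(1)] peiffer_add[OF lie_ideal_peiffer, of "p - nalg_diff q"
        n "nalg_diff q"]
    by simp
next
  assume "p \<in> peiffer n"
  then obtain q where q: "q \<in> bracket_span n" "p - nalg_diff q \<in> lie_ideal n"
    using peiffer_bracket_span by blast
  then have "cls n p = cls n (nalg_diff q)"
    using p nalg_diff_bracket_span[OF q(1)] by (intro cls_eqI) (auto intro: homogeneous_carrier)
  with q show "cls n p \<in> exact_brackets n" by (auto simp: exact_brackets_eq)
qed

lemma exact_brackets_peiffer: "exact_brackets n = cls n ` (homogeneous n (- 1) \<inter> peiffer n)"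
proof (intro equalityI subsetI)
  fix X assume "X \<in> exact_brackets n"
  then show "X \<in> cls n ` (homogeneous n (- 1) \<inter> peiffer n)"
    unfolding exact_brackets_eq using nalg_diff_bracket_span by blast
qed (auto simp: cls_in_exact_brackets_iff)

lemma submodule_exact_brackets: "submodule class_ring (exact_brackets n) (f_minus1 n)"
proof (rule submodule.intro)
  show "Module.module class_ring (f_minus1 n)"
    using f_minus1.vectorspace by (simp add: vectorspace_def)
  have "cls n 0 \<in> exact_brackets n"
    by (simp add: cls_in_exact_brackets_iff homogeneous_zero)
  then show "\<zero>\<^bsub>f_minus1 n\<^esub> \<in> exact_brackets n"
    by (simp add: f_minus1.zero_eq)
qed (auto simp: exact_brackets_peiffer f_minus1.carrier_eq f_minus1.add_eq f_minus1.smult_eq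
    intro!: imageI peiffer_add peiffer_scale)

section \<open>The quotient \<open>g1\<close> and its structure maps\<close>

interpretation g1: presented_quotient "f_minus1 n" "homogeneous n (- 1)" "cls n" "exact_brackets n"
  for n
  by (intro presented_quotient.intro presented_quotient_axioms.intro submodule_exact_brackets
    f_minus1.presentation_axioms)

definition cls1 :: "nat \<Rightarrow> nalg \<Rightarrow> nalg set set" where
  "cls1 n p = g1_class n (cls n p)"

lemma cls1_coset: "cls1 n p = exact_brackets n +>\<^bsub>f_minus1 n\<^esub> cls n p"
  by (simp add: cls1_def g1_class_def)

interpretation G1: presentation "g1 n" "homogeneous n (- 1)" "cls1 n" for n
proof -
  interpret Q: presentation "quot_module (f_minus1 n) (exact_brackets n)" "homogeneous n (- 1)"
    "cls1 n"
    unfolding cls1_coset[abs_def] by (rule g1.presentation_quot)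
  show "presentation (g1 n) (homogeneous n (- 1)) (cls1 n)"
    by standard (auto simp: g1_def subspace_homogeneous Q.carrier_eq Q.add_eq Q.smult_eq Q.zero_eq)
qed

lemma cls1_eq_iff:
  "p \<in> homogeneous n (- 1) \<Longrightarrow> q \<in> homogeneous n (- 1) \<Longrightarrow> cls1 n p = cls1 n q \<longleftrightarrow> p - q \<in> peiffer n"
  by (simp add: cls1_coset g1.coset_eq_iff cls_in_exact_brackets_iff)

lemma zero_cls1_iff: "p \<in> homogeneous n (- 1) \<Longrightarrow> cls1 n p = cls1 n 0 \<longleftrightarrow> p \<in> peiffer n"
  using cls1_eq_iff[of p n 0] by simp

text \<open>The Peiffer relation of (p, q) trades [dp, q] for -[dq, p], and acting on
  \<open>p\<close> stays inside the relations.\<close>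

lemma peiffer_bracket_left:
  assumes "p \<in> homogeneous n (- 1)" "p \<in> peiffer n" "q \<in> homogeneous n (- 1)"
  shows "br (nalg_diff p) q \<in> peiffer n"
  using peiffer_diff[OF peiffer_identity[OF assms(1,3)]
    peiffer_act[OF nalg_diff_degree_m1[OF assms(3)] assms(2)]]
  by simp

lemma g1_mult:
  assumes p: "p \<in> homogeneous n (- 1)" and q: "q \<in> homogeneous n (- 1)"
  shows "cls1 n p \<otimes>\<^bsub>g1 n\<^esub> cls1 n q = cls1 n (br (nalg_diff p) q)"
proof -
  have "(\<Union>x\<in>cls1 n p. \<Union>y\<in>cls1 n q.
      exact_brackets n +>\<^bsub>f_minus1 n\<^esub> (gla_diff n x \<otimes>\<^bsub>free_gla n\<^esub> y)) =
      cls1 n (br (nalg_diff p) q)"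
    unfolding cls1_coset
  proof (intro g1.coset_Union p q)
    fix p' q'
    assume p': "p' \<in> homogeneous n (- 1)" "cls n (p' - p) \<in> exact_brackets n"
      and q': "q' \<in> homogeneous n (- 1)" "cls n (q' - q) \<in> exact_brackets n"
    have "br (nalg_diff p') q' - br (nalg_diff p) q =
        br (nalg_diff (p' - p)) q' + br (nalg_diff p) (q' - q)"
      by (simp add: nalg_diff_simps br_simps)
    also have "\<dots> \<in> peiffer n"
      using p q p' q'
      by (intro peiffer_add peiffer_bracket_left peiffer_act nalg_diff_degree_m1)
        (simp_all add: cls_in_exact_brackets_iff)
    finally show "exact_brackets n +>\<^bsub>f_minus1 n\<^esub> (gla_diff n (cls n p') \<otimes>\<^bsub>free_gla n\<^esub> cls n q') =
        exact_brackets n +>\<^bsub>f_minus1 n\<^esub> cls n (br (nalg_diff p) q)"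
      using p q p' q'
      by (simp add: gla_diff_cls cls_mult homogeneous_carrier nalg_diff_carrier g1.coset_eq_iff
          nalg_diff_degree_m1 cls_in_exact_brackets_iff)
  qed
  then show ?thesis by (simp add: g1_def)
qed

lemma tau_cls1:
  assumes p: "p \<in> homogeneous n (- 1)"
  shows "tau n (cls1 n p) = cls n (nalg_diff p)"
proof -
  \<comment> \<open>\<open>tau\<close> takes the only element of an image. Writing that image as a
    union of singletons brings it within reach of \<open>coset_Union\<close>.\<close>
  have "(\<Union>x\<in>cls1 n p. {gla_diff n x}) = {cls n (nalg_diff p)}"
    unfolding cls1_coset
  proof (intro g1.coset_Union p)
    fix q assume q: "q \<in> homogeneous n (- 1)" "cls n (q - p) \<in> exact_brackets n"
    then have "nalg_diff q - nalg_diff p \<in> lie_ideal n"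
      using nalg_diff_peiffer[of "q - p" n] p
      by (simp add: cls_in_exact_brackets_iff nalg_diff_simps)
    then show "{gla_diff n (cls n q)} = {cls n (nalg_diff p)}"
      using p q by (simp add: gla_diff_cls homogeneous_carrier cls_eq_iff nalg_diff_carrier)
  qed
  then have "gla_diff n ` cls1 n p = {cls n (nalg_diff p)}"
    by (simp only: UNION_singleton_eq_range)
  then show ?thesis by (simp add: tau_def)
qed

lemma act_cls:
  assumes g: "g \<in> homogeneous n 0" and p: "p \<in> homogeneous n (- 1)"
  shows "act n (cls n g) (cls1 n p) = cls1 n (br g p)"
  unfolding act_def cls1_coset
  by (rule g1.coset_map_coset)
    (use g p in \<open>simp_all add: cls_mult homogeneous_carrier linear_br_right
      cls_in_exact_brackets_iff peiffer_act\<close>)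

lemma lie_algebra_g1: "lie_algebra (g1 n)"
proof (rule G1.lie_algebraI[where B = "\<lambda>p q. br (nalg_diff p) q"])
  show "lin (\<lambda>p. br (nalg_diff p) q)" for q
    using linear_compose[OF linear_nalg_diff linear_br_left] by (simp add: o_def)
  fix p assume p: "p \<in> homogeneous n (- 1)"
  have "br (nalg_diff p) p = (1/2) *\<^sub>R (br (nalg_diff p) p + br (nalg_diff p) p)"
    by (simp flip: scaleR_2)
  then have "br (nalg_diff p) p \<in> peiffer n"
    using peiffer_identity[OF p p] peiffer_scale by metis
  then show "cls1 n (br (nalg_diff p) p) = cls1 n 0"
    using p by (simp add: zero_cls1_iff nalg_diff_degree_m1)
  fix q r assume q: "q \<in> homogeneous n (- 1)" and r: "r \<in> homogeneous n (- 1)"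
  let ?a = "nalg_diff p" and ?b = "nalg_diff q" and ?c = "nalg_diff r"
  note D = p q r nalg_diff_degree_m1[OF p] nalg_diff_degree_m1[OF q] nalg_diff_degree_m1[OF r]
  \<comment> \<open>The three groups are a degree-0 Jacobi relation applied to r, the Peiffer
    relation of (r, p) acted on by dq, and the Peiffer relation of (r, [dp, q]).\<close>
  have "br ?a (br ?b r) + br ?b (br ?c p) + br ?c (br ?a q) =
    (br ?a (br ?b r) - br (br ?a ?b) r - br ?b (br ?a r)) +
    br ?b (br ?c p + br ?a r) + (br ?c (br ?a q) + br (nalg_diff (br ?a q)) r)"
    by (simp add: br_simps nalg_diff_br_0_m1[OF D(4) q])
  also have "\<dots> \<in> peiffer n"
    using lie_ideal_peiffer[OF degree_0_jacobi[OF D(4,5,3)]]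
      peiffer_act[OF D(5) peiffer_identity[OF D(3,1)]]
      peiffer_identity[OF D(3) br_closed_0[OF D(4,2)]]
    by (metis peiffer_add)
  finally show "cls1 n (br ?a (br ?b r) + br ?b (br ?c p) + br ?c (br ?a q)) = cls1 n 0"
    using D by (subst zero_cls1_iff) simp_all
qed (simp_all add: g1_mult nalg_diff_degree_m1 linear_br_right)

text \<open>The identity for the action of \<open>tau n y\<close> is the definition of the derived
  bracket. Equivariance of \<open>tau\<close> and the derivation property of the action both use
  that \<open>d\<close> commutes with bracketing by degree-0 elements.\<close>

lemma crossed_module_g1: "crossed_module (g1 n) (g0 n) (tau n) (act n)"
  unfolding crossed_module_def
proof (intro conjI ballI lie_algebra_g1 lie_algebra_g0)
  note simps = G1.carrier_eq g0.carrier_eq act_cls tau_cls1 nalg_diff_degree_m1 g1_mult g0_mult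
    G1.add_eq g0.add_eq G1.smult_eq g0.smult_eq G1.minus_eq nalg_diff_simps br_simps
  have "nalg_diff (br (nalg_diff p) q) = br (nalg_diff p) (nalg_diff q)"
    if "p \<in> homogeneous n (- 1)" "q \<in> homogeneous n (- 1)" for p q
    using nalg_diff_br_0_m1[OF nalg_diff_degree_m1] that by blast
  then show "tau n \<in> lie_hom (g1 n) (g0 n)"
    by (auto simp: lie_hom_def LinearCombinations.module_hom_def simps)
  show "lie_action (g0 n) (g1 n) (act n)"
    unfolding lie_action_def
  proof (intro conjI ballI)
    fix x assume "x \<in> carrier (g0 n)"
    then obtain g where g: "g \<in> homogeneous n 0" "x = cls n g" by (auto simp: g0.carrier_eq)
    show "act n x \<in> lie_der (g1 n)"
      unfolding lie_der_def
    proof (intro CollectI conjI ballI)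
      show "act n x \<in> module_hom class_ring (g1 n) (g1 n)"
        using g by (auto simp: LinearCombinations.module_hom_def simps)
      fix y z assume "y \<in> carrier (g1 n)" "z \<in> carrier (g1 n)"
      then obtain p q where "p \<in> homogeneous n (- 1)" "y = cls1 n p" "q \<in> homogeneous n (- 1)"
        "z = cls1 n q" by (auto simp: G1.carrier_eq)
      with g show "act n x (y \<otimes>\<^bsub>g1 n\<^esub> z) = act n x y \<otimes>\<^bsub>g1 n\<^esub> z \<oplus>\<^bsub>g1 n\<^esub> y \<otimes>\<^bsub>g1 n\<^esub> act n x z"
        using lie_ideal_peiffer[OF degree_0_jacobi, of g n "nalg_diff p" 0 q "- 1"]
          nalg_diff_br_0_m1[of g n p "- 1"]
        by (simp add: simps cls1_eq_iff algebra_simps)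
    qed
    fix x' y assume "x' \<in> carrier (g0 n)" "y \<in> carrier (g1 n)"
    then obtain h p where "h \<in> homogeneous n 0" "x' = cls n h" "p \<in> homogeneous n (- 1)"
      "y = cls1 n p" by (auto simp: G1.carrier_eq g0.carrier_eq)
    with g show "act n (x \<otimes>\<^bsub>g0 n\<^esub> x') y = act n x (act n x' y) \<ominus>\<^bsub>g1 n\<^esub> act n x' (act n x y)"
      using peiffer_neg[OF lie_ideal_peiffer[OF degree_0_jacobi, of g n h 0 p "- 1"]]
      by (simp add: simps cls1_eq_iff algebra_simps)
  next
    fix y assume "y \<in> carrier (g1 n)"
    then show "(\<lambda>x. act n x y) \<in> module_hom class_ring (g0 n) (g1 n)"
      by (auto simp: LinearCombinations.module_hom_def simps)
  qed
  fix y y' assume "y \<in> carrier (g1 n)" "y' \<in> carrier (g1 n)"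
  then show "act n (tau n y) y' = y \<otimes>\<^bsub>g1 n\<^esub> y'"
    by (auto simp: simps)
next
  fix x y assume "x \<in> carrier (g0 n)" "y \<in> carrier (g1 n)"
  then show "tau n (act n x y) = x \<otimes>\<^bsub>g0 n\<^esub> tau n y"
    by (auto simp: G1.carrier_eq g0.carrier_eq act_cls tau_cls1 nalg_diff_degree_m1 g0_mult
        nalg_diff_br_0_m1)
qed

section \<open>Linear maps from formal combinations into module records\<close>

locale real_space =
  fixes L :: "(real, 'a) module" (structure)
  assumes vs: "vectorspace class_ring L"
begin

sublocale abelian_group L
  using vs by (simp add: vectorspace_def Module.module_def)

lemma smult_closed [simp, intro]: "x \<in> carrier L \<Longrightarrow> r \<odot> x \<in> carrier L"
  and smult_add: "x \<in> carrier L \<Longrightarrow> y \<in> carrier L \<Longrightarrow> r \<odot> (x \<oplus> y) = r \<odot> x \<oplus> r \<odot> y"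
  and add_smult: "x \<in> carrier L \<Longrightarrow> (r + s) \<odot> x = r \<odot> x \<oplus> s \<odot> x"
  and smult_smult: "x \<in> carrier L \<Longrightarrow> (r * s) \<odot> x = r \<odot> (s \<odot> x)"
  and one_smult [simp]: "x \<in> carrier L \<Longrightarrow> 1 \<odot> x = x"
  and smult_minus: "x \<in> carrier L \<Longrightarrow> r \<odot> (\<ominus> x) = \<ominus> (r \<odot> x)"
  and zero_smult [simp]: "x \<in> carrier L \<Longrightarrow> 0 \<odot> x = \<zero>"
  and smult_zero [simp]: "r \<odot> \<zero> = \<zero>"
proof -
  interpret vectorspace class_ring L by (rule vs)
  show "x \<in> carrier L \<Longrightarrow> r \<odot> x \<in> carrier L"
    "x \<in> carrier L \<Longrightarrow> y \<in> carrier L \<Longrightarrow> r \<odot> (x \<oplus> y) = r \<odot> x \<oplus> r \<odot> y"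
    "x \<in> carrier L \<Longrightarrow> (r + s) \<odot> x = r \<odot> x \<oplus> s \<odot> x"
    "x \<in> carrier L \<Longrightarrow> (r * s) \<odot> x = r \<odot> (s \<odot> x)"
    "x \<in> carrier L \<Longrightarrow> 1 \<odot> x = x" "x \<in> carrier L \<Longrightarrow> r \<odot> (\<ominus> x) = \<ominus> (r \<odot> x)"
    "x \<in> carrier L \<Longrightarrow> 0 \<odot> x = \<zero>" "r \<odot> \<zero> = \<zero>"
    using smult_r_distr[of r x y] smult_l_distr[of r s x] smult_assoc1[of r s x] smult_one[of x]
      smult_r_minus[of r x] smult_l_null[of x] smult_r_null[of r] smult_closed[of r x]
    by simp_all
qed

lemma diff_add_diff:
  "\<lbrakk>a \<in> carrier L; b \<in> carrier L; c \<in> carrier L; d \<in> carrier L\<rbrakk> \<Longrightarrow>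
    (a \<ominus> b) \<oplus> (c \<ominus> d) = (a \<oplus> c) \<ominus> (b \<oplus> d)"
  by (simp add: minus_eq minus_add a_ac)

lemma diff_diff_diff:
  "\<lbrakk>a \<in> carrier L; b \<in> carrier L; c \<in> carrier L; d \<in> carrier L\<rbrakk> \<Longrightarrow>
    (a \<ominus> b) \<ominus> (c \<ominus> d) = (a \<ominus> c) \<ominus> (b \<ominus> d)"
  by (simp add: minus_eq minus_add a_ac)

lemma diff_telescope:
  "\<lbrakk>a \<in> carrier L; b \<in> carrier L; c \<in> carrier L\<rbrakk> \<Longrightarrow> (a \<ominus> b) \<oplus> (b \<ominus> c) = a \<ominus> c"
  by (simp add: minus_eq a_assoc) (simp add: l_neg flip: a_assoc)

lemma minus_diff: "\<lbrakk>a \<in> carrier L; b \<in> carrier L\<rbrakk> \<Longrightarrow> \<ominus> (a \<ominus> b) = b \<ominus> a"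
  by (simp add: minus_eq minus_add a_comm)

lemma minus_one_smult: "x \<in> carrier L \<Longrightarrow> (- 1) \<odot> x = \<ominus> x"
  using add_smult[of x "- 1" 1] minus_equality[of "(- 1) \<odot> x" x] by simp

text \<open>The counterpart of \<open>lin\<close> for values in a record: test objects of the
  universal properties have arbitrary carriers, outside the type class of real vector spaces.
  \<open>rec_ext\<close> plays the part of \<open>linear_ext\<close>.\<close>

definition nalg_hom :: "(nalg \<Rightarrow> 'a) \<Rightarrow> bool" where
  "nalg_hom h \<longleftrightarrow> (\<forall>p. h p \<in> carrier L) \<and> (\<forall>p q. h (p + q) = h p \<oplus> h q) \<and>
     (\<forall>r p. h (r *\<^sub>R p) = r \<odot> h p)"

lemma nalg_homI:
  "(\<And>p. h p \<in> carrier L) \<Longrightarrow> (\<And>p q. h (p + q) = h p \<oplus> h q) \<Longrightarrow>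
    (\<And>r p. h (r *\<^sub>R p) = r \<odot> h p) \<Longrightarrow> nalg_hom h"
  by (simp add: nalg_hom_def)

lemma nalg_homD:
  assumes "nalg_hom h"
  shows "h p \<in> carrier L" "h (p + q) = h p \<oplus> h q" "h (r *\<^sub>R p) = r \<odot> h p"
  using assms by (simp_all add: nalg_hom_def)

lemma nalg_hom_zero: "nalg_hom h \<Longrightarrow> h 0 = \<zero>"
  using nalg_homD(3)[of h 0 0] nalg_homD(1)[of h 0] by simp

lemma nalg_hom_minus: "nalg_hom h \<Longrightarrow> h (- p) = \<ominus> h p"
  using nalg_homD(3)[of h "- 1" p] nalg_homD(1)[of h p] by (simp add: minus_one_smult)

lemma nalg_hom_diff: "nalg_hom h \<Longrightarrow> h (p - q) = h p \<ominus> h q"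
  using nalg_homD(2)[of h p "- q"] by (simp add: nalg_hom_minus minus_eq)

lemma nalg_hom_kernel: "nalg_hom h \<Longrightarrow> subsp {p. h p = \<zero>}"
  by (rule real_vector.subspaceI) (simp_all add: nalg_hom_zero nalg_homD(2,3))

lemma nalg_hom_compose:
  assumes "nalg_hom h" "lin f"
  shows "nalg_hom (\<lambda>p. h (f p))"
  using assms by (simp add: nalg_hom_def linear_add linear_scale)

lemma nalg_hom_sub:
  assumes "nalg_hom h" "nalg_hom k"
  shows "nalg_hom (\<lambda>p. h p \<ominus> k p)"
  using nalg_homD[OF assms(1)] nalg_homD[OF assms(2)]
  by (intro nalg_homI) (simp_all add: diff_add_diff, simp add: minus_eq smult_add smult_minus)

definition rec_ext :: "(nat set bword \<Rightarrow> 'a) \<Rightarrow> nalg \<Rightarrow> 'a" where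
  "rec_ext w p = (\<Oplus>t\<in>Poly_Mapping.keys p. Poly_Mapping.lookup p t \<odot> w t)"

context
  fixes w :: "nat set bword \<Rightarrow> 'a"
  assumes w: "\<And>t. w t \<in> carrier L"
begin

lemma rec_ext_superset:
  assumes "finite T" "Poly_Mapping.keys p \<subseteq> T"
  shows "rec_ext w p = (\<Oplus>t\<in>T. Poly_Mapping.lookup p t \<odot> w t)"
  unfolding rec_ext_def
  by (rule add.finprod_mono_neutral_cong_left) (use assms w in \<open>auto simp: in_keys_iff\<close>)

lemma rec_ext_word [simp]: "rec_ext w (word t) = w t"
  using w by (simp add: rec_ext_def word_def)

lemma nalg_hom_rec_ext: "nalg_hom (rec_ext w)"
proof (rule nalg_homI)
  fix p q :: nalg and r :: real
  let ?T = "Poly_Mapping.keys p \<union> Poly_Mapping.keys q"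
  show "rec_ext w p \<in> carrier L" unfolding rec_ext_def using w by (intro finsum_closed) auto
  show "rec_ext w (p + q) = rec_ext w p \<oplus> rec_ext w q"
    using w keys_add[of p q]
    by (subst (1 2 3) rec_ext_superset[of ?T])
      (auto simp: lookup_add add_smult Pi_def finsum_addf)
  have "rec_ext w (r *\<^sub>R p) = (\<Oplus>t\<in>Poly_Mapping.keys p. r \<odot> (Poly_Mapping.lookup p t \<odot> w t))"
    using w by (subst rec_ext_superset[of "Poly_Mapping.keys p"])
      (auto simp: in_keys_iff smult_smult)
  also have "\<dots> = r \<odot> rec_ext w p"
  proof -
    interpret vectorspace class_ring L by (rule vs)
    show ?thesis unfolding rec_ext_def using w by (subst finsum_smult_ldistr) auto
  qed
  finally show "rec_ext w (r *\<^sub>R p) = r \<odot> rec_ext w p" .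
qed

end

end

lemma words_space_induct [consumes 1, case_names zero step]:
  assumes "p \<in> words_space T" and "P 0"
    and "\<And>r t p. t \<in> T \<Longrightarrow> p \<in> words_space T \<Longrightarrow> P p \<Longrightarrow> P (r *\<^sub>R word t + p)"
  shows "P p"
proof -
  have "(\<Sum>t\<in>U. Poly_Mapping.lookup p t *\<^sub>R word t) \<in> words_space T \<and>
      P (\<Sum>t\<in>U. Poly_Mapping.lookup p t *\<^sub>R word t)" if "finite U" "U \<subseteq> T" for U
    using that
  proof (induction U)
    case (insert t U)
    then show ?case
      using assms(3)[of t] real_vector.subspace_add[OF subspace_words_space]
        real_vector.subspace_scale[OF subspace_words_space]
      by simp
  qed (simp add: assms(2) real_vector.subspace_0[OF subspace_words_space])
  from this[of "Poly_Mapping.keys p"] show ?thesis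
    using assms(1) by (simp add: words_space_def flip: poly_mapping_sum_words)
qed

context real_space
begin

lemma nalg_hom_eq_on:
  assumes "nalg_hom h" "nalg_hom k" "p \<in> words_space T"
    and "\<And>t. t \<in> T \<Longrightarrow> h (word t) = k (word t)"
  shows "h p = k p"
  using assms(3)
  by (induction rule: words_space_induct)
    (simp_all add: nalg_hom_zero[OF assms(1)] nalg_hom_zero[OF assms(2)] nalg_homD[OF assms(1)]
      nalg_homD[OF assms(2)] assms(4))

lemma nalg_hom_on_br:
  assumes h: "nalg_hom h" and "\<And>q. nalg_hom (\<lambda>p. C p q)" "\<And>p. nalg_hom (C p)"
    and "\<And>s t. h (word (Br s t)) = C (word s) (word t)"
  shows "h (br p q) = C p q"
proof -
  have U: "p \<in> words_space UNIV" for p by (simp add: words_space_def)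
  have "h (br (word s) q) = C (word s) q" for s
    by (rule nalg_hom_eq_on[OF nalg_hom_compose[OF h linear_br_right] assms(3) U])
      (simp add: assms(4))
  then show ?thesis
    by (rule nalg_hom_eq_on[OF nalg_hom_compose[OF h linear_br_left] assms(2) U])
qed

end

section \<open>Bracket identities in a Lie algebra with explicit carrier\<close>

locale lie_record =
  fixes L :: "(real, 'a) module" (structure)
  assumes lie: "lie_algebra L"
begin

sublocale real_space L
  by (rule real_space.intro) (use lie in \<open>simp add: lie_algebra_def\<close>)

lemma bracket_right: "x \<in> carrier L \<Longrightarrow> (\<lambda>y. x \<otimes> y) \<in> module_hom class_ring L L"
  and bracket_left: "y \<in> carrier L \<Longrightarrow> (\<lambda>x. x \<otimes> y) \<in> module_hom class_ring L L"
  and bracket_self [simp]: "x \<in> carrier L \<Longrightarrow> x \<otimes> x = \<zero>"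
  and bracket_jacobi: "x \<in> carrier L \<Longrightarrow> y \<in> carrier L \<Longrightarrow> z \<in> carrier L \<Longrightarrow>
    x \<otimes> (y \<otimes> z) \<oplus> y \<otimes> (z \<otimes> x) \<oplus> z \<otimes> (x \<otimes> y) = \<zero>"
  using lie by (auto simp: lie_algebra_def)

lemma bracket_closed [simp, intro]: "x \<in> carrier L \<Longrightarrow> y \<in> carrier L \<Longrightarrow> x \<otimes> y \<in> carrier L"
  and bracket_add_right: "x \<in> carrier L \<Longrightarrow> y \<in> carrier L \<Longrightarrow> z \<in> carrier L \<Longrightarrow>
    x \<otimes> (y \<oplus> z) = x \<otimes> y \<oplus> x \<otimes> z"
  and bracket_smult_right: "x \<in> carrier L \<Longrightarrow> y \<in> carrier L \<Longrightarrow> x \<otimes> (r \<odot> y) = r \<odot> (x \<otimes> y)"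
  using bracket_right[of x] by (auto simp: LinearCombinations.module_hom_def)

lemma bracket_add_left: "x \<in> carrier L \<Longrightarrow> y \<in> carrier L \<Longrightarrow> z \<in> carrier L \<Longrightarrow>
    (y \<oplus> z) \<otimes> x = y \<otimes> x \<oplus> z \<otimes> x"
  and bracket_smult_left: "x \<in> carrier L \<Longrightarrow> y \<in> carrier L \<Longrightarrow> (r \<odot> y) \<otimes> x = r \<odot> (y \<otimes> x)"
  using bracket_left[of x] by (auto simp: LinearCombinations.module_hom_def)

lemma bracket_antisym:
  assumes x: "x \<in> carrier L" and y: "y \<in> carrier L"
  shows "x \<otimes> y \<oplus> y \<otimes> x = \<zero>" "x \<otimes> y = \<ominus> (y \<otimes> x)"
proof -
  have "(x \<oplus> y) \<otimes> (x \<oplus> y) = x \<otimes> x \<oplus> (x \<otimes> y \<oplus> y \<otimes> x) \<oplus> y \<otimes> y"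
    using x y by (simp add: bracket_add_left bracket_add_right a_ac del: bracket_self)
  then show *: "x \<otimes> y \<oplus> y \<otimes> x = \<zero>" using x y by simp
  then show "x \<otimes> y = \<ominus> (y \<otimes> x)" using x y by (intro minus_equality[symmetric]) auto
qed

lemma bracket_minus_right: "x \<in> carrier L \<Longrightarrow> y \<in> carrier L \<Longrightarrow> x \<otimes> (\<ominus> y) = \<ominus> (x \<otimes> y)"
  using bracket_smult_right[of x y "- 1"] by (simp add: minus_one_smult)

lemma bracket_jacobi':
  assumes "x \<in> carrier L" "y \<in> carrier L" "z \<in> carrier L"
  shows "x \<otimes> (y \<otimes> z) = (x \<otimes> y) \<otimes> z \<oplus> y \<otimes> (x \<otimes> z)"
proof -
  have "y \<otimes> (z \<otimes> x) = \<ominus> (y \<otimes> (x \<otimes> z))" "z \<otimes> (x \<otimes> y) = \<ominus> ((x \<otimes> y) \<otimes> z)"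
    using assms bracket_antisym(2)[of z x] bracket_antisym(2)[of z "x \<otimes> y"]
    by (simp_all add: bracket_minus_right)
  with bracket_jacobi[OF assms] assms
  have "x \<otimes> (y \<otimes> z) \<oplus> \<ominus> ((x \<otimes> y) \<otimes> z \<oplus> y \<otimes> (x \<otimes> z)) = \<zero>"
    by (simp add: minus_add a_ac)
  then have "\<ominus> (\<ominus> ((x \<otimes> y) \<otimes> z \<oplus> y \<otimes> (x \<otimes> z))) = x \<otimes> (y \<otimes> z)"
    using assms by (intro minus_equality) auto
  with assms show ?thesis by simp
qed

lemma nalg_hom_bracket:
  assumes "nalg_hom h"
  shows "nalg_hom (\<lambda>p. h p \<otimes> h q)" "nalg_hom (\<lambda>q. h p \<otimes> h q)"
  using nalg_homD[OF assms]
  by (auto intro!: nalg_homI simp: bracket_add_left bracket_add_right bracket_smult_left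
      bracket_smult_right)

end

section \<open>Projections to degrees zero and minus one\<close>

text \<open>The projection to degree 0 is multiplicative, since a product of factors of nonpositive
  degree has degree 0 only if both factors have. Letters outside \<open>symbols n\<close> are
  dropped too, so the values lie in \<open>homogeneous n 0\<close> for every argument.\<close>

primrec deg0_word :: "nat \<Rightarrow> nat set bword \<Rightarrow> nalg" where
  "deg0_word n (Gen I) = (if I \<in> symbols n \<and> card I = 1 then word (Gen I) else 0)"
| "deg0_word n (Br s t) = br (deg0_word n s) (deg0_word n t)"

text \<open>Degree -1 arises as 0 + (-1) or as (-1) + 0, so this projection is a derivation over
  \<open>deg0_word\<close>.\<close>

primrec degm1_word :: "nat \<Rightarrow> nat set bword \<Rightarrow> nalg" where
  "degm1_word n (Gen I) = (if I \<in> symbols n \<and> card I = 2 then word (Gen I) else 0)"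
| "degm1_word n (Br s t) = br (deg0_word n s) (degm1_word n t) + br (degm1_word n s)
    (deg0_word n t)"

definition pr0 :: "nat \<Rightarrow> nalg \<Rightarrow> nalg" where "pr0 n = linear_ext (deg0_word n)"
definition prm1 :: "nat \<Rightarrow> nalg \<Rightarrow> nalg" where "prm1 n = linear_ext (degm1_word n)"

lemma linear_pr0: "lin (pr0 n)" and linear_prm1: "lin (prm1 n)"
  by (simp_all add: pr0_def prm1_def linear_linear_ext)

lemmas linear_br_compose_left = linear_compose[OF _ linear_br_left, unfolded o_def]
  and linear_br_compose_right = linear_compose[OF _ linear_br_right, unfolded o_def]

lemma pr0_br: "pr0 n (br p q) = br (pr0 n p) (pr0 n q)"
  by (rule linear_on_br[OF linear_pr0])
    ((intro linear_br_compose_left linear_br_compose_right linear_pr0)+, simp add: pr0_def)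

lemma prm1_br: "prm1 n (br p q) = br (pr0 n p) (prm1 n q) + br (prm1 n p) (pr0 n q)"
  by (rule linear_on_br[OF linear_prm1])
    ((intro linear_compose_add linear_br_compose_left linear_br_compose_right linear_pr0
        linear_prm1)+,
      simp add: pr0_def prm1_def)

lemma deg0_word_closed: "deg0_word n t \<in> homogeneous n 0"
proof (induction t)
  case (Gen I)
  then show ?case
    using word_homogeneous[of "Gen I" n] by (auto simp: homogeneous_zero)
qed simp

lemma degm1_word_closed: "degm1_word n t \<in> homogeneous n (- 1)"
proof (induction t)
  case (Gen I)
  then show ?case
    using word_homogeneous[of "Gen I" n] by (auto simp: homogeneous_zero)
qed (simp add: deg0_word_closed homogeneous_add)

lemma pr0_closed [simp]: "pr0 n p \<in> homogeneous n 0"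
  by (rule linear_in_subspace_on_words[OF linear_pr0 subspace_homogeneous])
    (simp add: pr0_def deg0_word_closed)

lemma prm1_closed [simp]: "prm1 n p \<in> homogeneous n (- 1)"
  by (rule linear_in_subspace_on_words[OF linear_prm1 subspace_homogeneous])
    (simp add: prm1_def degm1_word_closed)

lemma deg0_word_eq:
  "set_bword t \<subseteq> symbols n \<Longrightarrow> deg0_word n t = (if wdeg t = 0 then word t else 0)"
proof (induction t)
  case (Gen I)
  then show ?case using symbols_card[of I n] by auto
next
  case (Br s t)
  then show ?case using wdeg_nonpos[of s n] wdeg_nonpos[of t n] by auto
qed

lemma degm1_word_eq:
  "set_bword t \<subseteq> symbols n \<Longrightarrow> degm1_word n t = (if wdeg t = - 1 then word t else 0)"
proof (induction t)
  case (Gen I)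
  then show ?case using symbols_card[of I n] by auto
next
  case (Br s t)
  then show ?case using wdeg_nonpos[of s n] wdeg_nonpos[of t n] by (auto simp: deg0_word_eq)
qed

lemma pr0_homogeneous:
  assumes "x \<in> homogeneous n k"
  shows "pr0 n x = (if k = 0 then x else 0)"
proof -
  have "lin (\<lambda>x. pr0 n x - (if k = 0 then x else 0))"
    by (cases "k = 0") (simp_all add: linear_compose_sub linear_pr0 linear_id)
  then have "pr0 n x - (if k = 0 then x else 0) \<in> {0}"
    by (rule linear_homogeneous[OF _ _ _ assms]) (auto simp: pr0_def deg0_word_eq)
  then show ?thesis by simp
qed

lemma prm1_homogeneous:
  assumes "x \<in> homogeneous n k"
  shows "prm1 n x = (if k = - 1 then x else 0)"
proof -
  have "lin (\<lambda>x. prm1 n x - (if k = - 1 then x else 0))"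
    by (cases "k = - 1") (simp_all add: linear_compose_sub linear_prm1 linear_id)
  then have "prm1 n x - (if k = - 1 then x else 0) \<in> {0}"
    by (rule linear_homogeneous[OF _ _ _ assms]) (auto simp: prm1_def degm1_word_eq)
  then show ?thesis by simp
qed

lemma antisymmetry_homogeneous:
  assumes "x \<in> homogeneous n i" "y \<in> homogeneous n j"
  shows "br x y - ((-1) powi (i * j + 1)) *\<^sub>R br y x \<in> homogeneous n (i + j)"
  using br_homogeneous[OF assms] br_homogeneous[OF assms(2,1)]
  by (auto intro!: homogeneous_diff
      homogeneous_scale simp: add.commute)

lemma jacobi_homogeneous:
  assumes "x \<in> homogeneous n i" "y \<in> homogeneous n j" "z \<in> homogeneous n k"
  shows "br x (br y z) - (br (br x y) z + ((-1) powi (i * j)) *\<^sub>R br y (br x z))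
    \<in> homogeneous n (i + j + k)"
  using br_homogeneous[OF assms(1) br_homogeneous[OF assms(2,3)]]
    br_homogeneous[OF br_homogeneous[OF assms(1,2)] assms(3)]
    br_homogeneous[OF assms(2) br_homogeneous[OF assms(1,3)]]
  by (auto intro!: homogeneous_diff
      homogeneous_add
      homogeneous_scale simp: ac_simps)

text \<open>The generating relations are homogeneous, so the projection either fixes or kills each
  of them.\<close>

lemma pr0_lie_ideal:
  assumes "x \<in> lie_ideal n"
  shows "pr0 n x \<in> lie_ideal n"
proof (rule lie_ideal_image[OF linear_pr0 subspace_lie_ideal _ _ _ _ assms], goal_cases)
  case (1 x y i j)
  then show ?case
    using pr0_homogeneous[OF antisymmetry_homogeneous[OF 1]] lie_ideal_antisymmetry[OF 1]
    by (simp add: zero_in_lie_ideal)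
next
  case (2 x y z i j k)
  then show ?case
    using pr0_homogeneous[OF jacobi_homogeneous[OF 2]] lie_ideal_jacobi[OF 2]
    by (simp add: zero_in_lie_ideal)
qed (simp_all add: pr0_br lie_ideal.br_left lie_ideal.br_right homogeneous_carrier[OF pr0_closed])

lemma prm1_lie_ideal:
  assumes "x \<in> lie_ideal n"
  shows "prm1 n x \<in> lie_ideal n"
proof (rule lie_ideal_image[OF linear_prm1 subspace_lie_ideal _ _ _ _ assms], goal_cases)
  case (1 x y i j)
  then show ?case
    using prm1_homogeneous[OF antisymmetry_homogeneous[OF 1]] lie_ideal_antisymmetry[OF 1]
    by (simp add: zero_in_lie_ideal)
next
  case (2 x y z i j k)
  then show ?case
    using prm1_homogeneous[OF jacobi_homogeneous[OF 2]] lie_ideal_jacobi[OF 2]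
    by (simp add: zero_in_lie_ideal)
qed (simp_all add: prm1_br pr0_lie_ideal lie_ideal_add lie_ideal.br_left lie_ideal.br_right
    homogeneous_carrier[OF pr0_closed] homogeneous_carrier[OF prm1_closed])

section \<open>Universal properties\<close>

context presentation
begin

text \<open>Chooses a representative. The restriction to the carrier makes the induced map
  extensional, as the uniqueness clauses demand.\<close>

definition descend :: "('b \<Rightarrow> 'd) \<Rightarrow> 'a \<Rightarrow> 'd" where
  "descend h = (\<lambda>X\<in>carrier L. h (SOME p. p \<in> S \<and> X = c p))"

lemma descend_class:
  assumes "\<And>p q. p \<in> S \<Longrightarrow> q \<in> S \<Longrightarrow> c p = c q \<Longrightarrow> h p = h q" and p: "p \<in> S"
  shows "descend h (c p) = h p"
proof -
  let ?q = "SOME q. q \<in> S \<and> c p = c q"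
  have "?q \<in> S \<and> c p = c ?q" by (rule someI[of _ p]) (simp add: p)
  then have "h ?q = h p" using assms by metis
  then show ?thesis by (simp add: descend_def class_closed p)
qed

end

section \<open>Freeness of the Lie algebra \<open>g0\<close>\<close>

lemma (in lie_record) bracket_zero [simp]:
  "x \<in> carrier L \<Longrightarrow> x \<otimes> \<zero> = \<zero>" "x \<in> carrier L \<Longrightarrow> \<zero> \<otimes> x = \<zero>"
  using bracket_smult_right[of x \<zero> 0] bracket_smult_left[of x \<zero> 0] by simp_all

text \<open>Every letter other than Z_i with i < n goes to zero, so the evaluation is given on all
  words and vanishes in nonzero degrees.\<close>

primrec lie_word :: "(real, 'a) module \<Rightarrow> nat \<Rightarrow> (nat \<Rightarrow> 'a) \<Rightarrow> nat set bword \<Rightarrow> 'a" where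
  "lie_word L n a (Gen I) = (if \<exists>i<n. I = {i} then a (the_elem I) else \<zero>\<^bsub>L\<^esub>)"
| "lie_word L n a (Br s t) = lie_word L n a s \<otimes>\<^bsub>L\<^esub> lie_word L n a t"

context lie_record
begin

context
  fixes a :: "nat \<Rightarrow> 'a" and n :: nat
  assumes a: "\<And>i. i < n \<Longrightarrow> a i \<in> carrier L"
begin

definition lie_ev :: "nalg \<Rightarrow> 'a" where
  "lie_ev = rec_ext (lie_word L n a)"

lemma lie_word_closed: "lie_word L n a t \<in> carrier L"
  by (induction t) (auto simp: a)

lemma lie_ev_hom: "nalg_hom lie_ev"
  unfolding lie_ev_def by (rule nalg_hom_rec_ext[OF lie_word_closed])

lemma lie_ev_word: "lie_ev (word t) = lie_word L n a t"
  unfolding lie_ev_def by (rule rec_ext_word[OF lie_word_closed])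

lemma lie_ev_closed [simp]: "lie_ev p \<in> carrier L"
  by (rule nalg_homD(1)[OF lie_ev_hom])

lemma lie_ev_br: "lie_ev (br p q) = lie_ev p \<otimes> lie_ev q"
  by (rule nalg_hom_on_br[OF lie_ev_hom])
    ((rule nalg_hom_bracket lie_ev_hom)+, simp add: lie_ev_word)

lemma lie_word_zero: "set_bword t \<subseteq> symbols n \<Longrightarrow> wdeg t \<noteq> 0 \<Longrightarrow> lie_word L n a t = \<zero>"
proof (induction t)
  case (Br s t)
  then show ?case by (cases "wdeg s = 0") (auto simp: lie_word_closed)
qed auto

lemma lie_ev_zero:
  assumes "x \<in> homogeneous n k" "k \<noteq> 0"
  shows "lie_ev x = \<zero>"
  using linear_homogeneous[OF linear_id nalg_hom_kernel[OF lie_ev_hom] _ assms(1)] assms(2)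
  by (simp add: lie_ev_word lie_word_zero)

text \<open>If all entries have degree 0, the signs are those of an ordinary Lie algebra. Otherwise
  some entry evaluates to zero, and with it every term of the relation.\<close>

lemma lie_ev_lie_ideal:
  assumes "x \<in> lie_ideal n"
  shows "lie_ev x = \<zero>"
proof -
  note simps = nalg_hom_diff[OF lie_ev_hom] nalg_homD(2,3)[OF lie_ev_hom] lie_ev_br
  have "x \<in> {p. lie_ev p = \<zero>}"
  proof (rule lie_ideal_image[OF linear_id nalg_hom_kernel[OF lie_ev_hom] _ _ _ _ assms],
      goal_cases)
    case (1 x y i j)
    then consider "i = 0" "j = 0" | "lie_ev x = \<zero>" | "lie_ev y = \<zero>" using lie_ev_zero by metis
    then show ?case
      by cases (simp_all add: simps minus_eq minus_one_smult bracket_antisym(1))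
  next
    case (2 x y z i j k)
    then consider "i = 0" "j = 0" "k = 0" | "lie_ev x = \<zero>" | "lie_ev y = \<zero>" | "lie_ev z = \<zero>"
      using lie_ev_zero by metis
    then show ?case
    proof cases
      case 1
      then show ?thesis
        using bracket_jacobi'[of "lie_ev x" "lie_ev y" "lie_ev z"] by (simp add: simps)
    qed (simp_all add: simps)
  qed (simp_all add: simps)
  then show ?thesis by simp
qed

end

end

lemma lie_homD:
  assumes "f \<in> lie_hom L M" "x \<in> carrier L" "y \<in> carrier L"
  shows "f x \<in> carrier M" "f (x \<oplus>\<^bsub>L\<^esub> y) = f x \<oplus>\<^bsub>M\<^esub> f y" "f (r \<odot>\<^bsub>L\<^esub> x) = r \<odot>\<^bsub>M\<^esub> f x"
    "f (x \<otimes>\<^bsub>L\<^esub> y) = f x \<otimes>\<^bsub>M\<^esub> f y"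
  using assms by (auto simp: lie_hom_def LinearCombinations.module_hom_def)

lemma g0_incl_unit:
  assumes "i < n"
  shows "g0_incl n (unit_vec n i) = cls n (word (Gen {i}))"
proof -
  have "(\<Sum>k<n. scal (unit_vec n i $ k) (word (Gen {k}))) =
      (\<Sum>k<n. if k = i then word (Gen {k}) else 0)"
    using assms by (intro sum.cong) auto
  then show ?thesis using assms by (simp add: g0_incl_def)
qed

lemma linear_combination_degree_0: "(\<Sum>i<n. v i *\<^sub>R word (Gen {i})) \<in> homogeneous n 0"
  by (rule real_vector.subspace_sum[OF subspace_homogeneous],
      rule homogeneous_scale)
    (simp add: homogeneous_words)

lemma g0_incl_hom: "g0_incl n \<in> module_hom class_ring (module_vec TYPE(real) n) (g0 n)"
  unfolding LinearCombinations.module_hom_def g0_incl_def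
  by (auto simp: module_vec_def g0.carrier_eq g0.add_eq g0.smult_eq linear_combination_degree_0
      scaleR_add_left sum.distrib scaleR_sum_right)

lemma lie_hom_g0D:
  assumes "F \<in> lie_hom (g0 n) M" "p \<in> homogeneous n 0" "q \<in> homogeneous n 0"
  shows "F (cls n p) \<in> carrier M" "F (cls n (p + q)) = F (cls n p) \<oplus>\<^bsub>M\<^esub> F (cls n q)"
    "F (cls n (r *\<^sub>R p)) = r \<odot>\<^bsub>M\<^esub> F (cls n p)"
    "F (cls n (br p q)) = F (cls n p) \<otimes>\<^bsub>M\<^esub> F (cls n q)"
  using lie_homD[OF assms(1) g0.class_closed[OF assms(2)] g0.class_closed[OF assms(3)]] assms(2,3)
  by (simp_all add: g0.add_eq g0.smult_eq g0_mult)

lemma lie_hom_g0_eq: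
  assumes "lie_algebra M" and "F \<in> lie_hom (g0 n) M" "F' \<in> lie_hom (g0 n) M"
    and gen: "\<And>i. i < n \<Longrightarrow> F (cls n (word (Gen {i}))) = F' (cls n (word (Gen {i})))"
    and X: "X \<in> carrier (g0 n)"
  shows "F X = F' X"
proof -
  interpret M: lie_record M by (rule lie_record.intro) (rule assms(1))
  note F = lie_hom_g0D[OF assms(2)] and F' = lie_hom_g0D[OF assms(3)]
  have word: "F (cls n (word t)) = F' (cls n (word t))"
    if "set_bword t \<subseteq> symbols n" "wdeg t = 0" for t
    using that
  proof (induction rule: homogeneous_0_induct)
    case (br s t)
    then have "word s \<in> homogeneous n 0" "word t \<in> homogeneous n 0"
      by (simp_all add: homogeneous_words)
    then show ?case using br F(4)[of "word s" "word t"] F'(4)[of "word s" "word t"] by simp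
  qed (rule gen)
  have "p \<in> homogeneous n 0 \<Longrightarrow> F (cls n p) = F' (cls n p)" for p
    unfolding homogeneous_words
  proof (induction rule: words_space_induct)
    case zero
    show ?case using F(3)[of 0 0 0] F'(3)[of 0 0 0] F(1)[of 0 0] F'(1)[of 0 0] by simp
  next
    case (step r t p)
    then have "word t \<in> homogeneous n 0" "p \<in> homogeneous n 0" "r *\<^sub>R word t \<in> homogeneous n 0"
      by (simp_all add: homogeneous_words real_vector.subspace_scale[OF subspace_words_space])
    then show ?case
      using step word F(2)[of "r *\<^sub>R word t" p] F'(2)[of "r *\<^sub>R word t" p]
        F(3)[of "word t" p] F'(3)[of "word t" p]
      by simp
  qed
  then show ?thesis using X by (auto simp: g0.carrier_eq)
qed

lemma free_lie_algebra_g0: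
  "free_lie_algebra TYPE('l) (module_vec TYPE(real) n) (g0 n) (g0_incl n)"
  unfolding free_lie_algebra_def
proof (intro conjI allI impI vec_vs lie_algebra_g0 g0_incl_hom)
  fix M :: "(real, 'l) module" and f
  assume M: "lie_algebra M" and f: "f \<in> module_hom class_ring (module_vec TYPE(real) n) M"
  interpret M: lie_record M by (rule lie_record.intro) (rule M)
  have fD: "f v \<in> carrier M" "f (v + w) = f v \<oplus>\<^bsub>M\<^esub> f w" "f (r \<cdot>\<^sub>v v) = r \<odot>\<^bsub>M\<^esub> f v"
    if "v \<in> carrier_vec n" "w \<in> carrier_vec n" for v w r
    using f that by (auto simp: LinearCombinations.module_hom_def module_vec_def)
  define a where "a i = f (unit_vec n i)" for i
  have a: "a i \<in> carrier M" if "i < n" for i using fD(1)[of "unit_vec n i"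
      "unit_vec n i"] by (simp add: a_def)
  define h where "h = M.lie_ev a n"
  define F where "F = g0.descend n h"
  note hom = M.lie_ev_hom[of n a, OF a, folded h_def]
  have eq: "h p = h q" if "p \<in> homogeneous n 0" "q \<in> homogeneous n 0" "cls n p = cls n q" for p q
  proof -
    have "h (p - q) = \<zero>\<^bsub>M\<^esub>"
      using that M.lie_ev_lie_ideal[of n a "p - q", OF a]
      by (simp add: cls_eq_iff homogeneous_carrier h_def)
    then show ?thesis using M.nalg_homD(1)[OF hom] by (simp add: M.nalg_hom_diff[OF hom])
  qed
  have F: "F (cls n p) = h p" if "p \<in> homogeneous n 0" for p
    unfolding F_def by (rule g0.descend_class[OF eq that])
  have Fhom: "F \<in> lie_hom (g0 n) M"
    by (auto simp: lie_hom_def LinearCombinations.module_hom_def g0.carrier_eq g0.add_eq g0.smult_eq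
        g0_mult F M.nalg_homD[OF hom] M.lie_ev_br[of n a, OF a, folded h_def])
  \<comment> \<open>\<open>f\<close> is linear only with respect to the record operations, so its
    value at \<open>v\<close> is built up one coordinate at a time, along truncations of
    \<open>v\<close>.\<close>
  have "h (\<Sum>i<k. v $ i *\<^sub>R word (Gen {i})) = f (vec n (\<lambda>i. if i < k then v $ i else 0))"
    if v: "v \<in> carrier_vec n" and k: "k \<le> n" for v k
    using k
  proof (induction k)
    case 0
    have "(0::real) \<cdot>\<^sub>v 0\<^sub>v n = 0\<^sub>v n" by auto
    then have "f (0\<^sub>v n) = \<zero>\<^bsub>M\<^esub>" using fD(3)[of "0\<^sub>v n" "0\<^sub>v n" 0] fD(1)[of "0\<^sub>v n" "0\<^sub>v n"] by simp
    moreover have "vec n (\<lambda>i. if i < 0 then v $ i else 0) = 0\<^sub>v n" by auto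
    ultimately show ?case by (simp add: M.nalg_hom_zero[OF hom])
  next
    case (Suc k)
    have "vec n (\<lambda>i. if i < Suc k then v $ i else 0) =
        vec n (\<lambda>i. if i < k then v $ i else 0) + v $ k \<cdot>\<^sub>v unit_vec n k"
      using v Suc.prems by (intro eq_vecI) (auto simp: less_Suc_eq)
    moreover have "h (word (Gen {k})) = f (unit_vec n k)"
      using Suc.prems M.lie_ev_word[of n a, OF a] by (simp add: h_def a_def)
    ultimately show ?case
      using Suc fD(3)[of "unit_vec n k" "unit_vec n k" "v $ k"]
      by (simp add: M.nalg_homD[OF hom] fD(2))
  qed
  note partial = this
  have "h (\<Sum>i<n. v $ i *\<^sub>R word (Gen {i})) = f v" if "v \<in> carrier_vec n" for v
  proof -
    have "vec n (\<lambda>i. if i < n then v $ i else 0) = v" using that by auto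
    with partial[OF that, of n] show ?thesis by simp
  qed
  then have Feta: "F (g0_incl n v) = f v" if "v \<in> carrier_vec n" for v
    using that by (simp add: g0_incl_def F linear_combination_degree_0)
  show "\<exists>!F. F \<in> extensional (carrier (g0 n)) \<and> F \<in> lie_hom (g0 n) M \<and>
      (\<forall>v\<in>carrier (module_vec TYPE(real) n). F (g0_incl n v) = f v)"
  proof (rule ex1I[of _ F])
    show "F \<in> extensional (carrier (g0 n)) \<and> F \<in> lie_hom (g0 n) M \<and>
        (\<forall>v\<in>carrier (module_vec TYPE(real) n). F (g0_incl n v) = f v)"
      using Fhom Feta by (auto simp: F_def g0.descend_def module_vec_def)
    fix F' assume F': "F' \<in> extensional (carrier (g0 n)) \<and> F' \<in> lie_hom (g0 n) M \<and>
        (\<forall>v\<in>carrier (module_vec TYPE(real) n). F' (g0_incl n v) = f v)"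
    have "F' (cls n (word (Gen {i}))) = F (cls n (word (Gen {i})))" if "i < n" for i
      using F' Feta[of "unit_vec n i"] by (simp add: module_vec_def flip: g0_incl_unit[OF that])
    then have "F' X = F X" if "X \<in> carrier (g0 n)" for X
      using lie_hom_g0_eq[OF M _ Fhom _ that] F' by blast
    then show "F' = F"
      using F' by (intro extensionalityI[of _ "carrier (g0 n)"]) (auto simp: F_def g0.descend_def)
  qed
qed

section \<open>Freeness of the crossed module\<close>

lemma nalg_diff_pair:
  assumes "i < j"
  shows "nalg_diff (word (Gen {i, j})) = word (Br (Gen {i}) (Gen {j}))"
proof -
  have Min: "Min {i, j} = i" using assms by simp
  \<comment> \<open>The sum for the differential has a single term, with sign (-1)^2 times a shuffle
    sign without inversions.\<close>
  have "{J. J \<subset> {i, j} \<and> i \<in> J} = {{i}}" using assms by auto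
  moreover have "{i, j} - {i} = {j}" using assms by auto
  moreover have "{(a, b). a \<in> {i} \<and> b \<in> {j} \<and> b < a} = {}" using assms by auto
  then have "shuffle_sign {i} {j} = 1" by (simp only: shuffle_sign_def card.empty power_0)
  ultimately show ?thesis
    unfolding nalg_diff_def linear_ext_word diff_word.simps diff_symbol_def Min
    by simp
qed

lemma crossed_moduleD:
  assumes "crossed_module H G t m"
  shows "lie_algebra H" "lie_algebra G"
    and "y \<in> carrier H \<Longrightarrow> t y \<in> carrier G"
    and "x \<in> carrier G \<Longrightarrow> y \<in> carrier H \<Longrightarrow> m x y \<in> carrier H"
    and "x \<in> carrier G \<Longrightarrow> y \<in> carrier H \<Longrightarrow> y' \<in> carrier H \<Longrightarrow> m x (y \<oplus>\<^bsub>H\<^esub> y') = m x y \<oplus>\<^bsub>H\<^esub> m x y'"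
    and "x \<in> carrier G \<Longrightarrow> y \<in> carrier H \<Longrightarrow> m x (r \<odot>\<^bsub>H\<^esub> y) = r \<odot>\<^bsub>H\<^esub> m x y"
    and "x \<in> carrier G \<Longrightarrow> x' \<in> carrier G \<Longrightarrow> y \<in> carrier H \<Longrightarrow> m (x \<oplus>\<^bsub>G\<^esub> x') y = m x y \<oplus>\<^bsub>H\<^esub> m x' y"
    and "x \<in> carrier G \<Longrightarrow> y \<in> carrier H \<Longrightarrow> m (r \<odot>\<^bsub>G\<^esub> x) y = r \<odot>\<^bsub>H\<^esub> m x y"
    and "x \<in> carrier G \<Longrightarrow> x' \<in> carrier G \<Longrightarrow> y \<in> carrier H \<Longrightarrow>
      m (x \<otimes>\<^bsub>G\<^esub> x') y = m x (m x' y) \<ominus>\<^bsub>H\<^esub> m x' (m x y)"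
    and "x \<in> carrier G \<Longrightarrow> y \<in> carrier H \<Longrightarrow> t (m x y) = x \<otimes>\<^bsub>G\<^esub> t y"
    and "y \<in> carrier H \<Longrightarrow> y' \<in> carrier H \<Longrightarrow> m (t y) y' = y \<otimes>\<^bsub>H\<^esub> y'"
    and "t \<in> lie_hom H G"
  using assms
  by (auto simp: crossed_module_def lie_action_def lie_der_def lie_hom_def
      LinearCombinations.module_hom_def Pi_iff)

text \<open>The value forced by equivariance and antisymmetry. The symmetric form covers both orders
  of the factors: in the application \<open>a\<close> is zero on words of nonzero degree, so the
  wrong term drops out.\<close>

primrec crossed_word ::
    "(real, 'h) module \<Rightarrow> ('g \<Rightarrow> 'h \<Rightarrow> 'h) \<Rightarrow> (nat set bword \<Rightarrow> 'g) \<Rightarrow> (nat \<times> nat \<Rightarrow> 'h) \<Rightarrow> nat \<Rightarrow>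
     nat set bword \<Rightarrow> 'h" where
  "crossed_word H m a b n (Gen I) =
     (if \<exists>i j. i < j \<and> j < n \<and> I = {i, j} then b (Min I, Max I) else \<zero>\<^bsub>H\<^esub>)"
| "crossed_word H m a b n (Br s t) =
     m (a s) (crossed_word H m a b n t) \<ominus>\<^bsub>H\<^esub> m (a t) (crossed_word H m a b n s)"

locale crossed_target =
  fixes n :: nat and H' :: "(real, 'h) module" (structure) and G' :: "(real, 'g) module"
    and t' :: "'h \<Rightarrow> 'g" and m' :: "'g \<Rightarrow> 'h \<Rightarrow> 'h"
    and \<phi> :: "nalg set \<Rightarrow> 'g" and b :: "nat \<times> nat \<Rightarrow> 'h"
  assumes crossed: "crossed_module H' G' t' m'"
    and \<phi>: "\<phi> \<in> lie_hom (g0 n) G'"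
    and b: "i < j \<Longrightarrow> j < n \<Longrightarrow> b (i, j) \<in> carrier H'"
    and compat: "i < j \<Longrightarrow> j < n \<Longrightarrow> \<phi> (cls n (word (Br (Gen {i}) (Gen {j})))) = t' (b (i, j))"
begin

sublocale lie_record H'
  by (rule lie_record.intro) (rule crossed_moduleD[OF crossed])

sublocale G': lie_record G'
  by (rule lie_record.intro) (rule crossed_moduleD[OF crossed])

lemmas m' = crossed_moduleD(4-11)[OF crossed]

lemma minus_zero [simp]: "\<ominus> \<zero> = \<zero>"
  by (rule minus_equality) simp_all

lemma m'_zero [simp]: "x \<in> carrier G' \<Longrightarrow> m' x \<zero> = \<zero>" "y \<in> carrier H' \<Longrightarrow> m' \<zero>\<^bsub>G'\<^esub> y = \<zero>"
  using m'(3)[of x \<zero> 0] m'(5)[of "\<zero>\<^bsub>G'\<^esub>" y 0] m'(1)[of x \<zero>] m'(1)[of "\<zero>\<^bsub>G'\<^esub>" y] by simp_all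

lemma m'_minus: "x \<in> carrier G' \<Longrightarrow> y \<in> carrier H' \<Longrightarrow> m' x (\<ominus> y) = \<ominus> m' x y"
  using m'(3)[of x y "- 1"] m'(1)[of x y] by (simp add: minus_one_smult)

lemma m'_diff:
  "x \<in> carrier G' \<Longrightarrow> y \<in> carrier H' \<Longrightarrow> z \<in> carrier H' \<Longrightarrow> m' x (y \<ominus> z) = m' x y \<ominus> m' x z"
  by (simp add: minus_eq m'(2) m'_minus)

text \<open>The extension of \<open>\<phi>\<close> by zero to all degrees; it respects brackets
  because \<open>pr0\<close> does.\<close>

definition base :: "nalg \<Rightarrow> 'g" where
  "base p = \<phi> (cls n (pr0 n p))"

lemmas \<phi>D = lie_hom_g0D[OF \<phi> pr0_closed pr0_closed]

lemma base_hom: "G'.nalg_hom base"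
  unfolding base_def
  by (rule G'.nalg_homI)
    (simp_all add: \<phi>D linear_add[OF linear_pr0] linear_scale[OF linear_pr0])

lemma base_closed [simp]: "base p \<in> carrier G'"
  by (rule G'.nalg_homD(1)[OF base_hom])

lemma base_br: "base (br p q) = base p \<otimes>\<^bsub>G'\<^esub> base q"
  by (simp add: base_def pr0_br \<phi>D)

lemma base_degree_0: "p \<in> homogeneous n 0 \<Longrightarrow> base p = \<phi> (cls n p)"
  by (simp add: base_def pr0_homogeneous)

lemma base_degree_nonzero: "p \<in> homogeneous n k \<Longrightarrow> k \<noteq> 0 \<Longrightarrow> base p = \<zero>\<^bsub>G'\<^esub>"
  using G'.nalg_hom_zero[OF base_hom] by (simp add: base_def pr0_homogeneous linear_0[OF
      linear_pr0])

lemma base_lie_ideal: "p \<in> lie_ideal n \<Longrightarrow> base p = \<zero>\<^bsub>G'\<^esub>"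
  using G'.nalg_hom_zero[OF base_hom] pr0_lie_ideal[of p n] cls_eqI[of "pr0 n p" n 0]
  by (simp add: base_def linear_0[OF linear_pr0] lie_ideal_carrier)

definition ev :: "nalg \<Rightarrow> 'h" where
  "ev = rec_ext (crossed_word H' m' (\<lambda>s. base (word s)) b n)"

lemma crossed_word_closed: "crossed_word H' m' (\<lambda>s. base (word s)) b n t \<in> carrier H'"
proof (induction t)
  case (Gen I)
  have "b (Min {i, j}, Max {i, j}) \<in> carrier H'" if "i < j" "j < n" for i j
    using b[OF that] that by simp
  then show ?case by auto
qed (auto simp: m'(1))

lemma ev_hom: "nalg_hom ev"
  unfolding ev_def by (rule nalg_hom_rec_ext[OF crossed_word_closed])

lemma ev_word: "ev (word t) = crossed_word H' m' (\<lambda>s. base (word s)) b n t"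
  unfolding ev_def by (rule rec_ext_word[OF crossed_word_closed])

lemma ev_closed [simp]: "ev p \<in> carrier H'"
  by (rule nalg_homD(1)[OF ev_hom])

lemma ev_pair: "i < j \<Longrightarrow> j < n \<Longrightarrow> ev (word (Gen {i, j})) = b (i, j)"
  by (subst ev_word) auto

lemma ev_br: "ev (br p q) = m' (base p) (ev q) \<ominus> m' (base q) (ev p)"
proof (rule nalg_hom_on_br[OF ev_hom])
  note simps = nalg_homD[OF ev_hom] G'.nalg_homD[OF base_hom] m'
  show "nalg_hom (\<lambda>p. m' (base p) (ev q) \<ominus> m' (base q) (ev p))" for q
    by (intro nalg_hom_sub nalg_homI) (simp_all add: simps)
  show "nalg_hom (\<lambda>q. m' (base p) (ev q) \<ominus> m' (base q) (ev p))" for p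
    by (intro nalg_hom_sub nalg_homI) (simp_all add: simps)
qed (simp add: ev_word)

lemma ev_br_swap: "ev (br q p) = \<ominus> ev (br p q)"
  by (simp add: ev_br minus_diff m'(1))

text \<open>The pair (\<open>base\<close>, \<open>ev\<close>) takes values in the semidirect product
  of \<open>G'\<close> with \<open>H'\<close> as a \<open>G'\<close>-module with zero bracket. This
  is the Jacobi identity there, so it holds without signs for all arguments.\<close>

lemma ev_jacobi: "ev (br x (br y z)) = ev (br (br x y) z) \<oplus> ev (br y (br x z))"
proof -
  note simps = ev_br base_br m'(1) m'(6) m'_diff
  let ?A = "m' (base x) (m' (base y) (ev z))" and ?B = "m' (base x) (m' (base z) (ev y))"
    and ?C = "m' (base y) (m' (base z) (ev x))" and ?D = "m' (base z) (m' (base y) (ev x))"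
    and ?E = "m' (base y) (m' (base x) (ev z))" and ?F = "m' (base z) (m' (base x) (ev y))"
  \<comment> \<open>Of the six double actions, \<open>?E\<close> and \<open>?F\<close> occur twice
    with opposite signs and cancel.\<close>
  have "ev (br (br x y) z) \<oplus> ev (br y (br x z)) =
      ((?A \<ominus> ?E) \<ominus> (?F \<ominus> ?D)) \<oplus> ((?E \<ominus> ?C) \<ominus> (?B \<ominus> ?F))"
    by (simp add: simps)
  also have "\<dots> = ((?A \<ominus> ?E) \<oplus> (?E \<ominus> ?C)) \<ominus> ((?B \<ominus> ?F) \<oplus> (?F \<ominus> ?D))"
    by (simp add: diff_add_diff m'(1) a_comm)
  also have "\<dots> = (?A \<ominus> ?C) \<ominus> (?B \<ominus> ?D)"
    by (simp add: diff_telescope m'(1))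
  also have "\<dots> = (?A \<ominus> ?B) \<ominus> (?C \<ominus> ?D)"
    by (rule diff_diff_diff) (simp_all add: m'(1))
  also have "\<dots> = ev (br x (br y z))"
    by (simp add: simps)
  finally show ?thesis ..
qed

lemma ev_triple_zero:
  assumes "x \<in> homogeneous n i" "y \<in> homogeneous n j" "i \<noteq> 0" "j \<noteq> 0"
  shows "ev (br x y) = \<zero>" "base (br x y) = \<zero>\<^bsub>G'\<^esub>"
  using base_degree_nonzero[OF assms(1,3)] base_degree_nonzero[OF assms(2,4)]
  by (simp_all add: ev_br base_br minus_eq)

text \<open>For i * j = 0 the graded signs agree with the ungraded ones, and
  \<open>ev_br_swap\<close> and \<open>ev_jacobi\<close> apply. If i and j are both nonzero,
  \<open>base\<close> vanishes on x and on y and each term is zero, whatever the sign.\<close>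

lemma ev_lie_ideal:
  assumes "x \<in> lie_ideal n"
  shows "ev x = \<zero>"
proof -
  note simps = nalg_hom_diff[OF ev_hom] nalg_homD(2,3)[OF ev_hom]
  have "x \<in> {p. ev p = \<zero>}"
  proof (rule lie_ideal_image[OF linear_id nalg_hom_kernel[OF ev_hom] _ _ _ _ assms],
      goal_cases)
    case (1 x y i j)
    then consider "i * j = 0" | "ev (br x y) = \<zero>" using ev_triple_zero by fastforce
    then show ?case
      by cases (auto simp: simps ev_br_swap[of y x] minus_one_smult)
  next
    case (2 x y z i j k)
    then consider "i * j = 0" | "i \<noteq> 0" "j \<noteq> 0" by fastforce
    then show ?case
    proof cases
      case 1
      then show ?thesis
        using ev_jacobi[of x y z] by (auto simp: simps)
    next
      case 3: 2
      note xy = ev_triple_zero[OF 2(1,2) 3]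
      have "ev (br y (br x z)) = ev (br x (br y z))" "ev (br x (br y z)) = \<zero>"
        using xy base_degree_nonzero[OF 2(1) 3(1)] base_degree_nonzero[OF 2(2) 3(2)]
        by (simp_all add: ev_br[of _ "br _ _"] base_br minus_eq m'(1))
      then show ?thesis using xy by (simp add: simps ev_br[of "br x y"] minus_eq)
    qed
  qed (simp_all add: ev_br base_lie_ideal minus_eq)
  then show ?thesis by simp
qed

text \<open>Both sides are equivariant for degree-0 factors, and on the letters Z_ij the equation is
  the compatibility hypothesis of the universal property.\<close>

lemma base_nalg_diff:
  assumes "x \<in> homogeneous n (- 1)"
  shows "base (nalg_diff x) = t' (ev x)"
proof -
  note tD = lie_homD[OF crossed_moduleD(12)[OF crossed] ev_closed ev_closed]
  note t_closed = crossed_moduleD(3)[OF crossed ev_closed]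
  have hom: "G'.nalg_hom (\<lambda>x. t' (ev x))"
    by (rule G'.nalg_homI) (simp_all add: nalg_homD(2,3)[OF ev_hom] tD(2,3) t_closed)
  have word: "base (nalg_diff (word w)) = t' (ev (word w))"
    if "set_bword w \<subseteq> symbols n" "wdeg w = - 1" for w
    using that
  proof (induction rule: homogeneous_1_induct)
    case (gen i j)
    then have "word (Br (Gen {i}) (Gen {j})) \<in> homogeneous n 0" by (simp add: homogeneous_words)
    with gen show ?case by (simp add: nalg_diff_pair base_degree_0 compat ev_pair)
  next
    case (left s t)
    then have s: "word s \<in> homogeneous n 0" and t: "word t \<in> homogeneous n (- 1)"
      by (simp_all add: homogeneous_words)
    then have "ev (word (Br s t)) = m' (base (word s)) (ev (word t))"
      using ev_br[of "word s" "word t"] base_degree_nonzero[OF t] by (simp add: minus_eq m'(1))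
    moreover have "nalg_diff (word (Br s t)) = br (word s) (nalg_diff (word t))"
      using nalg_diff_br_0_m1[OF s t] by simp
    ultimately show ?case using left by (simp add: base_br m'(7))
  next
    case (right s t)
    then have s: "word s \<in> homogeneous n 0" and t: "word t \<in> homogeneous n (- 1)"
      by (simp_all add: homogeneous_words)
    then have "ev (word (Br t s)) = \<ominus> m' (base (word s)) (ev (word t))"
      using ev_br[of "word t" "word s"] base_degree_nonzero[OF t] by (simp add: minus_eq m'(1))
    \<comment> \<open>The sign moves inside \<open>ev\<close>, which leaves an action term to which
      the equivariance of \<open>t'\<close> applies.\<close>
    also have "\<dots> = m' (base (word s)) (ev (- word t))"
      by (simp add: nalg_hom_minus[OF ev_hom] m'_minus)
    finally have "t' (ev (word (Br t s))) = base (word s) \<otimes>\<^bsub>G'\<^esub> t' (ev (- word t))"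
      by (simp add: m'(7))
    also have "\<dots> = t' (ev (word t)) \<otimes>\<^bsub>G'\<^esub> base (word s)"
      using t_closed G'.bracket_antisym(2)[of "t' (ev (word t))" "base (word s)"]
      by (simp add: G'.nalg_hom_minus[OF hom] G'.bracket_minus_right)
    moreover have "nalg_diff (word (Br t s)) = br (nalg_diff (word t)) (word s)"
      using nalg_diff_br_m1_0[OF s t] by simp
    ultimately show ?case using right by (simp add: base_br)
  qed
  show ?thesis
    by (rule G'.nalg_hom_eq_on[OF G'.nalg_hom_compose[OF base_hom linear_nalg_diff] hom
          assms[unfolded homogeneous_words]]) (use word in auto)
qed

lemma ev_derived_bracket:
  assumes "x \<in> homogeneous n (- 1)" "y \<in> homogeneous n (- 1)"
  shows "ev (br (nalg_diff x) y) = ev x \<otimes> ev y"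
  using assms base_degree_nonzero[OF assms(2)]
  by (simp add: ev_br base_nalg_diff m'(8) minus_eq)

text \<open>Peiffer's identity in the target turns a Peiffer relation into a bracket plus its
  reverse in \<open>H'\<close>.\<close>

lemma ev_peiffer:
  assumes "x \<in> peiffer n"
  shows "ev x = \<zero>"
proof -
  have "x \<in> {p. ev p = \<zero>}"
    by (rule peiffer_image[OF linear_id nalg_hom_kernel[OF ev_hom] _ _ assms])
      (simp_all add: ev_lie_ideal nalg_homD(2)[OF ev_hom] ev_derived_bracket bracket_antisym(1))
  then show ?thesis by simp
qed

definition induced :: "nalg set set \<Rightarrow> 'h" where
  "induced = G1.descend n ev"

lemma induced_cls1: "p \<in> homogeneous n (- 1) \<Longrightarrow> induced (cls1 n p) = ev p"
  unfolding induced_def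
proof (rule G1.descend_class)
  fix p q assume "p \<in> homogeneous n (- 1)" "q \<in> homogeneous n (- 1)" "cls1 n p = cls1 n q"
  then have "ev (p - q) = \<zero>" by (simp add: cls1_eq_iff ev_peiffer)
  then show "ev p = ev q" by (simp add: nalg_hom_diff[OF ev_hom])
qed

lemma induced_hom: "crossed_module_hom (g1 n) (g0 n) (tau n) (act n) H' G' t' m' induced \<phi>"
  unfolding crossed_module_hom_def
proof (intro conjI ballI \<phi>)
  show "induced \<in> lie_hom (g1 n) H'"
    by (auto simp: lie_hom_def LinearCombinations.module_hom_def G1.carrier_eq G1.add_eq G1.smult_eq
        g1_mult induced_cls1 nalg_homD[OF ev_hom] ev_derived_bracket nalg_diff_degree_m1)
  fix y assume "y \<in> carrier (g1 n)"
  then obtain p where p: "p \<in> homogeneous n (- 1)" "y = cls1 n p" by (auto simp: G1.carrier_eq)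
  then show "\<phi> (tau n y) = t' (induced y)"
    by (simp add: tau_cls1 induced_cls1 nalg_diff_degree_m1 flip: base_nalg_diff base_degree_0)
  fix x assume "x \<in> carrier (g0 n)"
  then obtain g where "g \<in> homogeneous n 0" "x = cls n g" by (auto simp: g0.carrier_eq)
  with p show "induced (act n x y) = m' (\<phi> x) (induced y)"
    using base_degree_nonzero[OF p(1)]
    by (simp add: act_cls induced_cls1 ev_br minus_eq m'(1) flip: base_degree_0)
qed

lemma induced_unique:
  assumes "crossed_module_hom (g1 n) (g0 n) (tau n) (act n) H' G' t' m' \<psi> \<phi>"
    and gen: "\<And>i j. i < j \<Longrightarrow> j < n \<Longrightarrow> \<psi> (cls1 n (word (Gen {i, j}))) = b (i, j)"
    and "p \<in> homogeneous n (- 1)"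
  shows "\<psi> (cls1 n p) = ev p"
proof -
  have \<psi>: "\<psi> \<in> lie_hom (g1 n) H'"
    and act: "x \<in> carrier (g0 n) \<Longrightarrow> y \<in> carrier (g1 n) \<Longrightarrow> \<psi> (act n x y) = m' (\<phi> x) (\<psi> y)" for x y
    using assms(1) by (auto simp: crossed_module_hom_def)
  have \<psi>D: "\<psi> (cls1 n p) \<in> carrier H'" "\<psi> (cls1 n (p + q)) = \<psi> (cls1 n p) \<oplus> \<psi> (cls1 n q)"
    "\<psi> (cls1 n (r *\<^sub>R p)) = r \<odot> \<psi> (cls1 n p)"
    if "p \<in> homogeneous n (- 1)" "q \<in> homogeneous n (- 1)" for p q r
    using lie_homD[OF \<psi> G1.class_closed[OF that(1)] G1.class_closed[OF that(2)]] that
    by (simp_all add: G1.add_eq G1.smult_eq)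
  \<comment> \<open>\<open>\<psi>\<close> is controlled only on classes of degree -1; composing with
    \<open>prm1\<close> gives a map that is linear on all formal combinations.\<close>
  have hom: "nalg_hom (\<lambda>p. \<psi> (cls1 n (prm1 n p)))"
    by (rule nalg_homI)
      (simp_all add: \<psi>D(1)[OF prm1_closed prm1_closed] \<psi>D(2) \<psi>D(3)[OF prm1_closed prm1_closed]
        linear_add[OF linear_prm1] linear_scale[OF linear_prm1])
  have word: "\<psi> (cls1 n (word w)) = ev (word w)"
    if "set_bword w \<subseteq> symbols n" "wdeg w = - 1" for w
    using that
  proof (induction rule: homogeneous_1_induct)
    case (gen i j)
    then show ?case using assms(2) by (simp add: ev_pair)
  next
    case (left s t)
    then have s: "word s \<in> homogeneous n 0" and t: "word t \<in> homogeneous n (- 1)"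
      by (simp_all add: homogeneous_words)
    have "\<psi> (cls1 n (word (Br s t))) = m' (base (word s)) (ev (word t))"
      using act[of "cls n (word s)" "cls1 n (word t)"] s t left
      by (simp add: act_cls g0.class_closed G1.class_closed base_degree_0)
    then show ?case
      using ev_br[of "word s" "word t"] base_degree_nonzero[OF t] by (simp add: minus_eq m'(1))
  next
    case (right s t)
    then have s: "word s \<in> homogeneous n 0" and t: "word t \<in> homogeneous n (- 1)"
      by (simp_all add: homogeneous_words)
    \<comment> \<open>Equivariance of \<open>\<psi>\<close> covers words with the degree-0 factor on
      the left, so the factors are first exchanged modulo the ideal.\<close>
    have "br (word t) (word s) - (- 1) *\<^sub>R br (word s) (word t) \<in> peiffer n"
      using lie_ideal_peiffer[OF degree_0_hom_antisymmetry(2)[OF s t]] by simp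
    then have "cls1 n (br (word t) (word s)) = cls1 n ((- 1) *\<^sub>R br (word s) (word t))"
      using s t by (subst cls1_eq_iff) (auto simp del: br_word_word scaleR_minus_left
          intro!: homogeneous_scale)
    moreover have "\<psi> (cls1 n (br (word s) (word t))) = m' (base (word s)) (ev (word t))"
      using act[of "cls n (word s)" "cls1 n (word t)"] s t right
      by (simp add: act_cls g0.class_closed G1.class_closed base_degree_0 del: br_word_word)
    ultimately have "\<psi> (cls1 n (br (word t) (word s))) = \<ominus> m' (base (word s)) (ev (word t))"
      using \<psi>D(3)[of "br (word s) (word t)" 0 "- 1"] s t
      by (simp add: minus_one_smult m'(1) homogeneous_zero
          del: br_word_word scaleR_minus_left)
    then show ?case
      using ev_br[of "word t" "word s"] base_degree_nonzero[OF t] by (simp add: minus_eq m'(1))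
  qed
  have "\<psi> (cls1 n (prm1 n p)) = ev p"
    by (rule nalg_hom_eq_on[OF hom ev_hom assms(3)[unfolded homogeneous_words]])
      (use word prm1_homogeneous[OF word_homogeneous] in auto)
  then show ?thesis by (simp add: prm1_homogeneous[OF assms(3)])
qed

end

section \<open>Independence of the generators\<close>

lemma linear_lookup: "lin (\<lambda>p. Poly_Mapping.lookup p t :: real)"
  by (rule linearI) (simp_all add: lookup_add)

lemma lookup_br_Gen: "Poly_Mapping.lookup (br p q) (Gen I) = 0"
  by (rule linear_on_br[OF linear_lookup]) (auto simp: word_def lookup_single linear_zero)

text \<open>All relations are combinations of proper brackets, so letters remain linearly
  independent in the quotients. This yields the injectivity of the generators and makes linear parts
  well defined.\<close>

lemma lookup_lie_ideal_Gen:
  assumes "x \<in> lie_ideal n"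
  shows "Poly_Mapping.lookup x (Gen I) = 0"
proof -
  have "Poly_Mapping.lookup x (Gen I) \<in> {0}"
    by (rule lie_ideal_image[OF linear_lookup real_vector.subspace_single_0 _ _ _ _ assms])
      (simp_all add: lookup_br_Gen lookup_minus lookup_add)
  then show ?thesis by simp
qed

lemma lookup_peiffer_Gen:
  assumes "x \<in> peiffer n"
  shows "Poly_Mapping.lookup x (Gen I) = 0"
proof -
  have "Poly_Mapping.lookup x (Gen I) \<in> {0}"
    by (rule peiffer_image[OF linear_lookup real_vector.subspace_single_0 _ _ assms])
      (simp_all add: lookup_br_Gen lookup_lie_ideal_Gen lookup_add)
  then show ?thesis by simp
qed

lemma pair_homogeneous: "i < j \<Longrightarrow> j < n \<Longrightarrow> word (Gen {i, j}) \<in> homogeneous n (- 1)"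
  by (simp add: homogeneous_words)

lemma inj_generators: "inj_on (\<lambda>(i, j). g1_class n (Z n {i, j})) {(i, j). i < j \<and> j < n}"
proof (rule inj_onI, clarify)
  fix i j k l :: nat
  assume *: "i < j" "j < n" "k < l" "l < n" "g1_class n (Z n {i, j}) = g1_class n (Z n {k, l})"
  then have "word (Gen {i, j}) - word (Gen {k, l}) \<in> peiffer n"
    using cls1_eq_iff[OF pair_homogeneous pair_homogeneous] by (simp add: cls1_def Z_def)
  from lookup_peiffer_Gen[OF this, of "{i, j}"] have "{i, j} = {k, l}"
    by (auto simp: lookup_minus word_def lookup_single when_def split: if_splits)
  then show "i = k \<and> j = l" using * by (auto simp: doubleton_eq_iff)
qed

lemma free_crossed_module_g1:
  "free_crossed_module TYPE('h) TYPE('g) (g1 n) (g0 n) (tau n) (act n)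
     {(i, j). i < j \<and> j < n}
     (\<lambda>(i, j). g1_class n (Z n {i, j}))
     (\<lambda>(i, j). Z n {i} \<otimes>\<^bsub>g0 n\<^esub> Z n {j})"
  unfolding free_crossed_module_def
proof (intro conjI allI impI crossed_module_g1 inj_generators)
  have gen: "g1_class n (Z n {i, j}) = cls1 n (word (Gen {i, j}))" for i j
    by (simp add: cls1_def Z_def)
  have bracket: "Z n {i} \<otimes>\<^bsub>g0 n\<^esub> Z n {j} = cls n (word (Br (Gen {i}) (Gen {j})))"
    "cls n (word (Br (Gen {i}) (Gen {j}))) \<in> carrier (g0 n)"
    if "i < j" "j < n" for i j
  proof -
    have "word (Gen {i}) \<in> homogeneous n 0" "word (Gen {j}) \<in> homogeneous n 0"
      using that by (simp_all add: homogeneous_words)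
    then show "Z n {i} \<otimes>\<^bsub>g0 n\<^esub> Z n {j} = cls n (word (Br (Gen {i}) (Gen {j})))"
      by (simp add: Z_def g0_mult)
    show "cls n (word (Br (Gen {i}) (Gen {j}))) \<in> carrier (g0 n)"
      using that by (intro g0.class_closed) (simp add: homogeneous_words)
  qed
  show "(\<lambda>(i, j). g1_class n (Z n {i, j})) \<in> {(i, j). i < j \<and> j < n} \<rightarrow> carrier (g1 n)"
    by (auto simp: gen intro!: G1.class_closed pair_homogeneous)
  show "(\<lambda>(i, j). Z n {i} \<otimes>\<^bsub>g0 n\<^esub> Z n {j}) \<in> {(i, j). i < j \<and> j < n} \<rightarrow> carrier (g0 n)"
    by (auto simp: bracket)
  show "\<forall>e\<in>{(i, j). i < j \<and> j < n}.
      tau n (case e of (i, j) \<Rightarrow> g1_class n (Z n {i, j})) = (case e of (i,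
          j) \<Rightarrow> Z n {i} \<otimes>\<^bsub>g0 n\<^esub> Z n {j})"
    by (auto simp: gen bracket tau_cls1 pair_homogeneous nalg_diff_pair)
  fix H' :: "(real, 'h) module" and G' :: "(real, 'g) module" and t' m' \<phi> \<psi>0
  assume "crossed_module H' G' t' m'" "\<phi> \<in> lie_hom (g0 n) G'"
    "\<psi>0 \<in> {(i, j). i < j \<and> j < n} \<rightarrow> carrier H'"
    "\<forall>e\<in>{(i, j). i < j \<and> j < n}. \<phi> (case e of (i, j) \<Rightarrow> Z n {i} \<otimes>\<^bsub>g0 n\<^esub> Z n {j}) = t' (\<psi>0 e)"
  then interpret crossed_target n H' G' t' m' \<phi> \<psi>0
    by unfold_locales (auto simp: bracket)
  show "\<exists>!\<psi>. \<psi> \<in> extensional (carrier (g1 n)) \<and>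
      (\<forall>e\<in>{(i, j). i < j \<and> j < n}. \<psi> (case e of (i, j) \<Rightarrow> g1_class n (Z n {i, j})) = \<psi>0 e) \<and>
      crossed_module_hom (g1 n) (g0 n) (tau n) (act n) H' G' t' m' \<psi> \<phi>"
  proof (rule ex1I[of _ induced])
    show "induced \<in> extensional (carrier (g1 n)) \<and>
      (\<forall>e\<in>{(i, j). i < j \<and> j < n}. induced (case e of (i, j) \<Rightarrow> g1_class n (Z n {i, j})) = \<psi>0 e) \<and>
      crossed_module_hom (g1 n) (g0 n) (tau n) (act n) H' G' t' m' induced \<phi>"
      using induced_hom
      by (auto simp: gen induced_cls1 pair_homogeneous ev_pair)
          (simp add: induced_def G1.descend_def)
    fix \<psi>
    assume \<psi>: "\<psi> \<in> extensional (carrier (g1 n)) \<and>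
      (\<forall>e\<in>{(i, j). i < j \<and> j < n}. \<psi> (case e of (i, j) \<Rightarrow> g1_class n (Z n {i, j})) = \<psi>0 e) \<and>
      crossed_module_hom (g1 n) (g0 n) (tau n) (act n) H' G' t' m' \<psi> \<phi>"
    then have "\<psi> (cls1 n p) = ev p" if "p \<in> homogeneous n (- 1)" for p
      using that by (intro induced_unique) (auto simp flip: gen)
    then have "\<psi> X = induced X" if "X \<in> carrier (g1 n)" for X
      using that by (auto simp: G1.carrier_eq induced_cls1)
    then show "\<psi> = induced"
      using \<psi> by (intro extensionalityI[of _ "carrier (g1 n)"])
        (auto simp: induced_def G1.descend_def)
  qed
qed

section \<open>An equivariant retraction onto the kernel\<close>

lemma linear_functional_scale: "lin f \<Longrightarrow> lin (\<lambda>p. f p *\<^sub>R w)"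
  by (rule linearI) (simp_all add: linear_add linear_scale scaleR_left_distrib)

lemma linear_functional_scale_left: "lin f \<Longrightarrow> lin (\<lambda>p. (c * f p) *\<^sub>R w)"
  and linear_functional_scale_right: "lin f \<Longrightarrow> lin (\<lambda>p. (f p * c) *\<^sub>R w)"
  by (rule linearI; simp add: linear_add linear_scale algebra_simps)+

text \<open>A coordinate of the linear part. On degree 0 it factors through the abelianization of
  \<open>g0\<close>, as it vanishes on brackets and on the ideal.\<close>

definition coef :: "nalg \<Rightarrow> nat \<Rightarrow> real" where
  "coef p i = Poly_Mapping.lookup p (Gen {i})"

lemma linear_coef: "lin (\<lambda>p. coef p i)"
  unfolding coef_def by (rule linear_lookup)

lemma coef_br [simp]: "coef (br p q) i = 0"
  by (simp add: coef_def lookup_br_Gen)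

lemma coef_gen [simp]: "coef (word (Gen {j})) i = (if i = j then 1 else 0)"
  by (auto simp: coef_def word_def lookup_single when_def)

lemma coef_lie_ideal: "x \<in> lie_ideal n \<Longrightarrow> coef x i = 0"
  by (simp add: coef_def lookup_lie_ideal_Gen)

definition pairs :: "nat \<Rightarrow> (nat \<times> nat) set" where
  "pairs n = {(i, j). i < j \<and> j < n}"

lemma finite_pairs [simp]: "finite (pairs n)"
  by (rule finite_subset[of _ "{..<n} \<times> {..<n}"]) (auto simp: pairs_def)

definition lin1 :: "nat \<Rightarrow> nalg \<Rightarrow> nalg" where
  "lin1 n p = (\<Sum>i<n. coef p i *\<^sub>R word (Gen {i}))"

definition wedge :: "nat \<Rightarrow> nalg \<Rightarrow> nalg \<Rightarrow> nalg" where
  "wedge n p q = (\<Sum>(i, j)\<in>pairs n. (coef p i * coef q j - coef p j * coef q i) *\<^sub>R word (Gen {i,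
      j}))"

lemma linear_lin1: "lin (lin1 n)"
  unfolding lin1_def by (intro linear_compose_sum ballI linear_functional_scale linear_coef)

lemma linear_wedge_left: "lin (\<lambda>p. wedge n p q)" and linear_wedge_right: "lin (wedge n p)"
  unfolding wedge_def case_prod_beta scaleR_diff_left
  by (intro linear_compose_sum ballI linear_compose_sub linear_functional_scale_left
      linear_functional_scale_right linear_coef)+

lemma lin1_closed: "lin1 n p \<in> homogeneous n 0"
  unfolding lin1_def by (rule linear_combination_degree_0)

lemma wedge_closed: "wedge n p q \<in> homogeneous n (- 1)"
  unfolding wedge_def
  by (rule real_vector.subspace_sum[OF subspace_homogeneous])
    (auto simp: pairs_def intro!: homogeneous_scale pair_homogeneous)

lemma lin1_gen: "i < n \<Longrightarrow> lin1 n (word (Gen {i})) = word (Gen {i})"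
  by (simp add: lin1_def if_distrib[of "\<lambda>c. c *\<^sub>R _"] cong: if_cong)

lemma wedge_zero: "(\<And>i. coef p i = 0) \<Longrightarrow> wedge n p q = 0" "(\<And>i. coef q i = 0) \<Longrightarrow> wedge n p q = 0"
  by (simp_all add: wedge_def)

lemma wedge_anti: "wedge n q p = - wedge n p q"
  unfolding wedge_def sum_negf[symmetric] by (rule sum.cong) (auto simp: algebra_simps)

lemma wedge_gen:
  assumes "i < j" "j < n"
  shows "wedge n (word (Gen {i})) (word (Gen {j})) = word (Gen {i, j})"
proof -
  have "wedge n (word (Gen {i})) (word (Gen {j})) =
      (\<Sum>x\<in>pairs n. if x = (i, j) then word (Gen {i, j}) else 0)"
    unfolding wedge_def by (rule sum.cong) (use assms in \<open>auto simp: pairs_def split: if_splits\<close>)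
  moreover have "(i, j) \<in> pairs n" using assms by (simp add: pairs_def)
  ultimately show ?thesis by simp
qed

text \<open>The diagonal terms lie in \<open>N\<close> because 2 is invertible, and the terms with i
  > j fold onto those with i < j. The subspace is \<open>lie_ideal n\<close> for brackets of letters
  and zero for wedge products.\<close>

lemma alternating_sum:
  fixes \<beta> :: "nat \<Rightarrow> nat \<Rightarrow> 'b::real_vector"
  assumes N: "subsp N" and alt: "\<And>i j. i < n \<Longrightarrow> j < n \<Longrightarrow> \<beta> i j + \<beta> j i \<in> N"
  shows "(\<Sum>i<n. \<Sum>j<n. (a i * b j) *\<^sub>R \<beta> i j) -
      (\<Sum>(i, j)\<in>pairs n. (a i * b j - a j * b i) *\<^sub>R \<beta> i j) \<in> N"
proof -
  let ?f = "\<lambda>(i, j). (a i * b j) *\<^sub>R \<beta> i j"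
  let ?op = "(\<lambda>(i, j). (j, i)) ` pairs n" and ?d = "(\<lambda>i. (i, i)) ` {..<n}"
  have diag: "\<beta> i i \<in> N" if "i < n" for i
    using real_vector.subspace_scale[OF N alt[OF that that], of "1/2"] by (simp flip: scaleR_2)
  have "{..<n} \<times> {..<n} = pairs n \<union> (?op \<union> ?d)"
    by (auto simp: pairs_def image_iff)
  moreover have "pairs n \<inter> (?op \<union> ?d) = {}" "?op \<inter> ?d = {}" by (auto simp: pairs_def)
  ultimately have "(\<Sum>i<n. \<Sum>j<n. (a i * b j) *\<^sub>R \<beta> i j) = sum ?f (pairs n) + (sum ?f ?op +
      sum ?f ?d)"
    by (simp add: sum.cartesian_product sum.union_disjoint)
  also have "sum ?f ?op = (\<Sum>(i, j)\<in>pairs n. (a j * b i) *\<^sub>R \<beta> j i)"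
    by (subst sum.reindex) (auto simp: inj_on_def intro!: sum.cong)
  also have "sum ?f ?d = (\<Sum>i<n. (a i * b i) *\<^sub>R \<beta> i i)"
    by (subst sum.reindex) (auto simp: inj_on_def)
  finally have "(\<Sum>i<n. \<Sum>j<n. (a i * b j) *\<^sub>R \<beta> i j) -
      (\<Sum>(i, j)\<in>pairs n. (a i * b j - a j * b i) *\<^sub>R \<beta> i j) =
      (\<Sum>(i, j)\<in>pairs n. (a j * b i) *\<^sub>R (\<beta> i j + \<beta> j i)) + (\<Sum>i<n. (a i * b i) *\<^sub>R \<beta> i i)"
    by (simp add: case_prod_beta scaleR_diff_left sum_subtractf scaleR_add_right sum.distrib)
  also have "\<dots> \<in> N"
    by (intro real_vector.subspace_add[OF N] real_vector.subspace_sum[OF N])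
      (auto simp: pairs_def intro!: real_vector.subspace_scale[OF N] alt diag)
  finally show ?thesis .
qed

text \<open>The bilinear extension of d Z_ij = [Z_i, Z_j]. Only pairs i < j occur in
  \<open>wedge\<close>, so the other terms of the bracket have to be rewritten by antisymmetry
  modulo the ideal.\<close>

lemma nalg_diff_wedge:
  "br (lin1 n p) (lin1 n q) - nalg_diff (wedge n p q) \<in> lie_ideal n"
proof -
  have "nalg_diff (wedge n p q) = (\<Sum>(i, j)\<in>pairs n. (coef p i * coef q j - coef p j * coef q i) *\<^sub>R
      br (word (Gen {i})) (word (Gen {j})))"
    unfolding wedge_def linear_sum[OF linear_nalg_diff]
    by (rule sum.cong) (auto simp: pairs_def nalg_diff_simps nalg_diff_pair)
  moreover have "br (lin1 n p) (lin1 n q) =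
      (\<Sum>i<n. \<Sum>j<n. (coef p i * coef q j) *\<^sub>R br (word (Gen {i})) (word (Gen {j})))"
    by (simp add: lin1_def br_sum_left br_sum_right br_simps scaleR_sum_right)
       (subst sum.swap, simp add: mult.commute)
  ultimately show ?thesis
    using alternating_sum[OF subspace_lie_ideal, of n "\<lambda>i j. br (word (Gen {i})) (word (Gen {j}))"]
      degree_0_hom_antisymmetry(1)[of "word (Gen {_})" n "word (Gen {_})" 0]
    by (simp add: homogeneous_words del: br_word_word)
qed

text \<open>The common shape of the Leibniz rules of \<open>wedge_der\<close>, \<open>euler_lift\<close> and \<open>kernel_map\<close>; the
  correction term \<open>K\<close> depends only on the linear part of its first argument.\<close>

lemma twisted_derivation_lie_ideal:
  fixes f :: "nalg \<Rightarrow> nalg" and K :: "nalg \<Rightarrow> nalg \<Rightarrow> nalg" and n :: nat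
  defines "T \<equiv> \<lambda>p q. br (pr0 n p) (f q) + K (pr0 n p) q"
  assumes f: "lin f" "\<And>p. f p \<in> homogeneous n (- 1)" and N: "subsp N" "lie_ideal n \<subseteq> N"
    and N_act: "\<And>g x. g \<in> homogeneous n 0 \<Longrightarrow> x \<in> N \<Longrightarrow> br g x \<in> N"
    and f_br: "\<And>p q. f (br p q) = T p q - T q p"
    and K_zero: "\<And>v q. (\<And>i. coef v i = 0) \<Longrightarrow> K v q = 0"
    and K_br: "\<And>v y z. v \<in> homogeneous n 0 \<Longrightarrow>
      K v (br y z) - (br (pr0 n y) (K v z) - br (pr0 n z) (K v y)) \<in> N"
    and K_ideal: "\<And>v x. v \<in> homogeneous n 0 \<Longrightarrow> x \<in> lie_ideal n \<Longrightarrow> K v x \<in> N"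
    and x: "x \<in> lie_ideal n"
  shows "f x \<in> N"
proof (rule lie_ideal_image[OF f(1) N(1) _ _ _ _ x])
  note simps = linear_diff[OF f(1)] linear_add[OF f(1)] linear_scale[OF f(1)]
  note N_add = real_vector.subspace_add[OF N(1)] and N_diff = real_vector.subspace_diff[OF N(1)]
    and N_neg = real_vector.subspace_neg[OF N(1)] and N_0 = real_vector.subspace_0[OF N(1)]
    and N_scale = real_vector.subspace_scale[OF N(1)]
  have T_zero: "T p q = 0" if "pr0 n p = 0" for p q
    using that K_zero[of 0] by (simp add: T_def linear_0[OF linear_coef])
  have swap: "f (br q p) = - f (br p q)" for p q by (simp add: f_br)
  have br_zero: "f (br p q) = 0" if "pr0 n p = 0" "pr0 n q = 0" for p q
    by (simp add: f_br T_zero that)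
  fix x y i j assume xy: "x \<in> homogeneous n i" "y \<in> homogeneous n j"
  have pr0_0: "pr0 n x = 0" "pr0 n y = 0" if "i \<noteq> 0" "j \<noteq> 0"
    using that pr0_homogeneous xy by simp_all
  consider "i * j = 0" | "i \<noteq> 0" "j \<noteq> 0" by fastforce
  then show "f (br x y - ((-1) powi (i * j + 1)) *\<^sub>R br y x) \<in> N"
  proof cases
    case 2
    then show ?thesis using N_0 by (simp add: simps br_zero pr0_0)
  qed (use N_0 in \<open>auto simp: simps swap[of y x]\<close>)
  fix z k assume "z \<in> homogeneous n k"
  have jacobi: "f (br x (br y z)) - f (br (br x y) z) - f (br y (br x z)) \<in> N"
  proof -
    define k where "k v p q = K v (br p q) - (br (pr0 n p) (K v q) - br (pr0 n q) (K v p))"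
      for v p q
    define a where "a p q w = br (pr0 n p) (br (pr0 n q) (f w)) - br (br (pr0 n p) (pr0 n q)) (f w)
      - br (pr0 n q) (br (pr0 n p) (f w))" for p q w
    \<comment> \<open>The double actions group into three Jacobi relations \<open>a\<close> and the
      correction terms into three defects \<open>k\<close>. Corrections along a bracket are absent,
      because a bracket has no linear part.\<close>
    have "f (br x (br y z)) - f (br (br x y) z) - f (br y (br x z)) =
        a x y z - a x z y + a y z x + k (pr0 n x) y z + k (pr0 n z) x y - k (pr0 n y) x z"
      by (simp add: a_def k_def f_br T_def pr0_br K_zero br_simps)
    moreover have "a p q w \<in> N" for p q w
      unfolding a_def using degree_0_jacobi[OF pr0_closed pr0_closed f(2)] N(2) by blast
    moreover have "k (pr0 n p) q w \<in> N" for p q w unfolding k_def by (rule K_br) simp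
    ultimately show ?thesis by (simp add: N_add N_diff)
  qed
  consider "i * j = 0" | "i \<noteq> 0" "j \<noteq> 0" by fastforce
  then show "f (br x (br y z) - (br (br x y) z + ((-1) powi (i * j)) *\<^sub>R br y (br x z))) \<in> N"
  proof cases
    case 1
    then show ?thesis using jacobi by (auto simp: simps algebra_simps)
  next
    case 2
    \<comment> \<open>With x and y of nonzero degree the sign of the relation is not controlled, but
      the first and third terms vanish outright. The remaining one is in \<open>N\<close> by
      \<open>K_br\<close>, whose comparison terms are zero here.\<close>
    have "f (br (br x y) z) = - T z (br x y)"
      using 2 by (simp add: f_br T_zero pr0_br pr0_0)
    moreover have "T z (br x y) \<in> N"
      using K_br[OF pr0_closed, of z x y] 2 by (simp add: T_def br_zero pr0_0)
    ultimately show ?thesis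
      using 2 by (simp add: simps br_zero pr0_0 pr0_br N_neg N_diff N_0)
  qed
next
  fix a x assume x: "x \<in> lie_ideal n" "f x \<in> N"
  have "br (pr0 n x) (f a) \<in> N"
    using pr0_lie_ideal[OF x(1)] f(2) N(2) by (meson homogeneous_carrier lie_ideal.br_right subsetD)
  moreover have "K (pr0 n x) a = 0"
    using pr0_lie_ideal[OF x(1)] by (intro K_zero) (rule coef_lie_ideal)
  ultimately have "T a x \<in> N" "T x a \<in> N"
    using x by (simp_all add: T_def real_vector.subspace_add[OF N(1)] N_act K_ideal)
  then show "f (br a x) \<in> N" "f (br x a) \<in> N"
    by (simp_all add: f_br real_vector.subspace_diff[OF N(1)])
qed

subsection \<open>Derivations on degree zero\<close>

primrec wedge_der_word :: "nat \<Rightarrow> nalg \<Rightarrow> nat set bword \<Rightarrow> nalg" where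
  "wedge_der_word n v (Gen I) = wedge n v (word (Gen I))"
| "wedge_der_word n v (Br s t) = br (deg0_word n s) (wedge_der_word n v t) - br (deg0_word n t)
    (wedge_der_word n v s)"

definition wedge_der :: "nat \<Rightarrow> nalg \<Rightarrow> nalg \<Rightarrow> nalg" where
  "wedge_der n v = linear_ext (wedge_der_word n v)"

lemma linear_wedge_der: "lin (wedge_der n v)"
  by (simp add: wedge_der_def linear_linear_ext)

lemma wedge_der_br: "wedge_der n v (br p q) = br (pr0 n p) (wedge_der n v q) - br (pr0 n q)
    (wedge_der n v p)"
  by (rule linear_on_br[OF linear_wedge_der])
    ((intro linear_compose_sub linear_br_compose_left linear_br_compose_right linear_pr0
        linear_wedge_der)+,
      simp add: wedge_der_def pr0_def)

lemma linear_br_both: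
  assumes "lin f" "lin g"
  shows "lin (\<lambda>p. f p + g p)" "lin (\<lambda>p. f p - g p)" "lin (\<lambda>p. br q (f p))" "lin (\<lambda>p. br (f p) q)"
  using assms linear_compose[OF assms(1) linear_br_left] linear_compose[OF assms(1) linear_br_right]
  by (simp_all add: linear_compose_add linear_compose_sub o_def)

lemma linear_wedge_der_word: "lin (\<lambda>v. wedge_der_word n v t)"
  by (induction t) (simp_all add: linear_wedge_left linear_br_both)

lemma linear_wedge_der_left: "lin (\<lambda>v. wedge_der n v p)"
  unfolding wedge_der_def linear_ext_def scal_eq_scaleR
  by (intro linear_compose_sum ballI linear_compose_scale_right linear_wedge_der_word)

lemma wedge_der_gen: "wedge_der n v (word (Gen I)) = wedge n v (word (Gen I))"
  by (simp add: wedge_der_def)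

lemma wedge_der_closed [simp]: "wedge_der n v p \<in> homogeneous n (- 1)"
proof (rule linear_in_subspace_on_words[OF linear_wedge_der subspace_homogeneous])
  show "wedge_der n v (word t) \<in> homogeneous n (- 1)" for t
    by (induction t) (simp_all add: wedge_der_def wedge_closed deg0_word_closed
        homogeneous_diff)
qed

lemma wedge_der_zero: "(\<And>i. coef v i = 0) \<Longrightarrow> wedge_der n v p = 0"
proof -
  assume v: "\<And>i. coef v i = 0"
  have "wedge_der_word n v t = 0" for t by (induction t) (simp_all add: wedge_zero(1) v)
  then show ?thesis by (simp add: wedge_der_def linear_ext_def)
qed

lemma wedge_der_lie_ideal:
  assumes "x \<in> lie_ideal n"
  shows "wedge_der n v x \<in> lie_ideal n"
  by (rule twisted_derivation_lie_ideal[where f = "wedge_der n v" and K = "\<lambda>_ _. 0",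
      OF linear_wedge_der _
        subspace_lie_ideal order_refl _ _ _ _ _ assms])
    (simp_all add: wedge_der_br linear_zero zero_in_lie_ideal lie_ideal.br_left homogeneous_carrier)

text \<open>Modulo the ideal, bracketing with v and the composite of \<open>d\<close> with
  \<open>wedge_der\<close> are derivations of degree 0, and they agree on letters by
  \<open>nalg_diff_wedge\<close>.\<close>

lemma nalg_diff_wedge_der:
  assumes "g \<in> homogeneous n 0"
  shows "br (lin1 n v) g - nalg_diff (wedge_der n v g) \<in> lie_ideal n"
proof (rule linear_homogeneous[OF _ subspace_lie_ideal _ assms])
  show "lin (\<lambda>g. br (lin1 n v) g - nalg_diff (wedge_der n v g))"
    by (intro linear_compose_sub linear_br_right linear_compose[OF linear_wedge_der
        linear_nalg_diff, unfolded o_def])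
  fix t assume "set_bword t \<subseteq> symbols n" "wdeg t = 0"
  then show "br (lin1 n v) (word t) - nalg_diff (wedge_der n v (word t)) \<in> lie_ideal n"
  proof (induction rule: homogeneous_0_induct)
    case (gen i)
    then show ?case using nalg_diff_wedge[of n v "word (Gen {i})"] by (simp add: wedge_der_gen
        lin1_gen)
  next
    case (br s t)
    then have s: "word s \<in> homogeneous n 0" and t: "word t \<in> homogeneous n 0"
      by (simp_all add: homogeneous_words)
    let ?s = "word s" and ?t = "word t" and ?v = "lin1 n v"
    have "br ?v (br ?s ?t) - nalg_diff (wedge_der n v (br ?s ?t)) =
        (br ?v (br ?s ?t) - br (br ?v ?s) ?t - br ?s (br ?v ?t)) +
        br ?s (br ?v ?t - nalg_diff (wedge_der n v ?t)) - br ?t (br ?v ?s - nalg_diff (wedge_der n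
            v ?s)) +
        (br (br ?v ?s) ?t + br ?t (br ?v ?s))"
      using nalg_diff_br_0_m1[OF s wedge_der_closed] nalg_diff_br_0_m1[OF t wedge_der_closed]
      by (simp add: wedge_der_br pr0_homogeneous[OF s] pr0_homogeneous[OF t] nalg_diff_simps
          br_simps
          del: br_word_word)
    also have "\<dots> \<in> lie_ideal n"
      using degree_0_jacobi[OF lin1_closed s t]
        degree_0_hom_antisymmetry(2)[OF t br_closed_0[OF lin1_closed s]]
        lie_ideal.br_left[OF homogeneous_carrier[OF s] br.IH(2)]
        lie_ideal.br_left[OF homogeneous_carrier[OF t] br.IH(1)]
      by (simp only: lie_ideal_add lie_ideal_diff)
    finally show ?case by simp
  qed
qed

section \<open>The lift R from degree zero to degree minus one\<close>

primrec euler_lift_word :: "nat \<Rightarrow> nat set bword \<Rightarrow> nalg" where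
  "euler_lift_word n (Gen I) = 0"
| "euler_lift_word n (Br s t) = br (deg0_word n s) (euler_lift_word n t) +
    wedge_der n (deg0_word n s) (word t) -
     (br (deg0_word n t) (euler_lift_word n s) + wedge_der n (deg0_word n t) (word s))"

definition euler_lift :: "nat \<Rightarrow> nalg \<Rightarrow> nalg" where
  "euler_lift n = linear_ext (euler_lift_word n)"

lemma linear_euler_lift: "lin (euler_lift n)"
  by (simp add: euler_lift_def linear_linear_ext)

lemma linear_wedge_der_compose_left: "lin f \<Longrightarrow> lin (\<lambda>p. wedge_der n (f p) q)"
  and linear_wedge_der_compose_right: "lin f \<Longrightarrow> lin (\<lambda>p. wedge_der n v (f p))"
  using linear_compose[OF _ linear_wedge_der_left] linear_compose[OF _ linear_wedge_der] by
      (simp_all add: o_def)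

lemma euler_lift_br: "euler_lift n (br p q) = br (pr0 n p) (euler_lift n q) +
    wedge_der n (pr0 n p) q - (br (pr0 n q) (euler_lift n p) + wedge_der n (pr0 n q) p)"
  by (rule linear_on_br[OF linear_euler_lift])
    ((intro linear_compose_sub linear_compose_add linear_br_compose_left linear_br_compose_right
      linear_wedge_der_compose_left linear_wedge_der_compose_right linear_wedge_der linear_pr0
          linear_euler_lift)+,
      simp add: euler_lift_def pr0_def)

lemma euler_lift_closed [simp]: "euler_lift n p \<in> homogeneous n (- 1)"
proof (rule linear_in_subspace_on_words[OF linear_euler_lift subspace_homogeneous])
  show "euler_lift n (word t) \<in> homogeneous n (- 1)" for t
    by (induction t) (simp_all add: euler_lift_def deg0_word_closed homogeneous_zero
        homogeneous_diff homogeneous_add)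
qed

lemma euler_lift_lie_ideal:
  assumes "x \<in> lie_ideal n"
  shows "euler_lift n x \<in> lie_ideal n"
  by (rule twisted_derivation_lie_ideal[where f = "euler_lift n" and K = "wedge_der n",
      OF linear_euler_lift _
        subspace_lie_ideal order_refl _ _ _ _ _ assms])
    (simp_all add: euler_lift_br linear_wedge_der wedge_der_zero wedge_der_br wedge_der_lie_ideal
        zero_in_lie_ideal lie_ideal.br_left
      homogeneous_carrier)

subsection \<open>Maps into the kernel\<close>

definition koszul :: "nat \<Rightarrow> nalg \<Rightarrow> nalg \<Rightarrow> nalg" where
  "koszul n v t = br (lin1 n v) (prm1 n t) - wedge_der n v (nalg_diff (prm1 n t))"

lemma linear_koszul: "lin (koszul n v)" and linear_koszul_left: "lin (\<lambda>v. koszul n v t)"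
  unfolding koszul_def
  by (intro linear_compose_sub linear_br_compose_left linear_br_compose_right
      linear_wedge_der_compose_right linear_wedge_der_left linear_lin1 linear_prm1
      linear_compose[OF linear_prm1 linear_nalg_diff, unfolded o_def])+

lemma koszul_closed [simp]: "koszul n v t \<in> homogeneous n (- 1)"
  by (simp add: koszul_def lin1_closed homogeneous_diff)

lemma koszul_zero: "(\<And>i. coef v i = 0) \<Longrightarrow> koszul n v t = 0"
  by (simp add: koszul_def wedge_der_zero lin1_def)

lemma koszul_peiffer:
  assumes "t \<in> peiffer n" "t \<in> homogeneous n (- 1)"
  shows "koszul n v t \<in> peiffer n"
  using assms prm1_homogeneous[OF assms(2)]
  by (simp add: koszul_def peiffer_diff peiffer_act lin1_closed lie_ideal_peiffer
      wedge_der_lie_ideal nalg_diff_peiffer)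

text \<open>Both summands of \<open>koszul\<close> have differential [v, dt] up to sign: the first
  because \<open>d\<close> commutes with degree-0 brackets, the second by
  \<open>nalg_diff_wedge_der\<close>.\<close>

lemma nalg_diff_koszul: "nalg_diff (koszul n v t) \<in> lie_ideal n"
  using nalg_diff_wedge_der[OF nalg_diff_degree_m1[OF prm1_closed], of n v t]
    nalg_diff_br_0_m1[OF lin1_closed prm1_closed, of n v t]
  by (simp add: koszul_def nalg_diff_simps)

text \<open>Up to Jacobi the defect is [[v, g], t] + [dt, W_v(g)]. Replacing [v, g] by dW_v(g) turns
  it into the Peiffer relation of (W_v(g), t).\<close>

lemma koszul_act:
  assumes g: "g \<in> homogeneous n 0" and t: "t \<in> homogeneous n (- 1)"
  shows "koszul n v (br g t) - br g (koszul n v t) \<in> peiffer n"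
proof -
  let ?v = "lin1 n v" and ?w = "wedge_der n v g"
  have "koszul n v (br g t) - br g (koszul n v t) =
      (br ?v (br g t) - br (br ?v g) t - br g (br ?v t)) +
      br (br ?v g - nalg_diff ?w) t + (br (nalg_diff ?w) t + br (nalg_diff t) ?w)"
    using prm1_homogeneous[OF t] prm1_homogeneous[OF br_closed_0[OF g t]] nalg_diff_br_0_m1[OF g t]
      pr0_homogeneous[OF g] pr0_homogeneous[OF nalg_diff_degree_m1[OF t]]
    by (simp add: koszul_def wedge_der_br br_simps)
  also have "\<dots> \<in> peiffer n"
    using g t lin1_closed[of n v] nalg_diff_wedge_der[OF g, of v]
    by (intro peiffer_add peiffer_identity lie_ideal_peiffer[OF degree_0_jacobi]
        lie_ideal_peiffer[OF lie_ideal.br_right]) (auto intro: homogeneous_carrier)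
  finally show ?thesis .
qed

text \<open>The hypothesis \<open>K_br\<close> of \<open>twisted_derivation_lie_ideal\<close>. The
  degree -1 part of a bracket has two terms; after exchanging the factors of one of them,
  \<open>koszul_act\<close> applies to both.\<close>

lemma koszul_br:
  "koszul n v (br y z) - (br (pr0 n y) (koszul n v z) - br (pr0 n z) (koszul n v y)) \<in> peiffer n"
proof -
  let ?Y = "pr0 n y" and ?Z = "pr0 n z" and ?y = "prm1 n y" and ?z = "prm1 n z"
  have koszul_pr: "koszul n v t = koszul n v (prm1 n t)" for t
    using prm1_homogeneous[OF prm1_closed, of n t] by (simp add: koszul_def)
  have sum: "prm1 n (br y z) = br ?Y ?z - br ?Z ?y + (br ?Z ?y + br ?y ?Z)"
    by (simp add: prm1_br)
  have "br ?Z ?y + br ?y ?Z \<in> peiffer n"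
    by (rule lie_ideal_peiffer[OF degree_0_hom_antisymmetry(1)[OF pr0_closed prm1_closed]])
  then have 1: "koszul n v (br ?Z ?y + br ?y ?Z) \<in> peiffer n"
    by (rule koszul_peiffer) (simp add: homogeneous_add)
  have "koszul n v (br y z) - (br ?Y (koszul n v z) - br ?Z (koszul n v y)) =
      (koszul n v (br ?Y ?z) - br ?Y (koszul n v ?z)) - (koszul n v (br ?Z ?y) - br ?Z (koszul n v
          ?y)) +
      koszul n v (br ?Z ?y + br ?y ?Z)"
    unfolding koszul_pr[of "br y z"] koszul_pr[of y] koszul_pr[of z] sum
    by (simp add: linear_add[OF linear_koszul] linear_diff[OF linear_koszul])
  also have "\<dots> \<in> peiffer n"
    using 1 by (intro peiffer_add peiffer_diff koszul_act) simp_all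
  finally show ?thesis .
qed

section \<open>The map H into the kernel\<close>

primrec kernel_map_word :: "nat \<Rightarrow> nat set bword \<Rightarrow> nalg" where
  "kernel_map_word n (Gen I) = 0"
| "kernel_map_word n (Br s t) = br (deg0_word n s) (kernel_map_word n t) +
    koszul n (deg0_word n s) (word t) -
     (br (deg0_word n t) (kernel_map_word n s) + koszul n (deg0_word n t) (word s))"

definition kernel_map :: "nat \<Rightarrow> nalg \<Rightarrow> nalg" where
  "kernel_map n = linear_ext (kernel_map_word n)"

lemma linear_kernel_map: "lin (kernel_map n)"
  by (simp add: kernel_map_def linear_linear_ext)

lemma linear_koszul_compose_left: "lin f \<Longrightarrow> lin (\<lambda>p. koszul n (f p) q)"
  using linear_compose[OF _ linear_koszul_left] by (simp add: o_def)

lemma kernel_map_br: "kernel_map n (br p q) = br (pr0 n p) (kernel_map n q) +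
    koszul n (pr0 n p) q - (br (pr0 n q) (kernel_map n p) + koszul n (pr0 n q) p)"
  by (rule linear_on_br[OF linear_kernel_map])
    ((intro linear_compose_sub linear_compose_add linear_br_compose_left linear_br_compose_right
      linear_koszul_compose_left linear_koszul linear_pr0 linear_kernel_map)+,
      simp add: kernel_map_def pr0_def)

lemma kernel_map_closed [simp]: "kernel_map n p \<in> homogeneous n (- 1)"
proof (rule linear_in_subspace_on_words[OF linear_kernel_map subspace_homogeneous])
  show "kernel_map n (word t) \<in> homogeneous n (- 1)" for t
    by (induction t) (simp_all add: kernel_map_def deg0_word_closed homogeneous_zero
        homogeneous_diff homogeneous_add)
qed

lemma kernel_map_lie_ideal:
  assumes "x \<in> lie_ideal n"
  shows "kernel_map n x \<in> peiffer n"
proof (rule twisted_derivation_lie_ideal[where f = "kernel_map n" and K = "koszul n",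
    OF linear_kernel_map _
      subspace_peiffer _ _ _ _ _ _ assms])
  fix v x assume "x \<in> lie_ideal n"
  then have "prm1 n x \<in> peiffer n" by (intro lie_ideal_peiffer prm1_lie_ideal)
  then have "koszul n v (prm1 n x) \<in> peiffer n" by (rule koszul_peiffer) simp
  then show "koszul n v x \<in> peiffer n"
    using prm1_homogeneous[OF prm1_closed, of n x] by (simp add: koszul_def)
qed (simp_all add: kernel_map_br linear_koszul koszul_zero koszul_br peiffer_act lie_ideal_peiffer
    subsetI)

text \<open>Each term of the recursion is a cycle modulo the ideal: the corrections by
  \<open>nalg_diff_koszul\<close>, the others as brackets of degree-0 elements with cycles.\<close>

lemma nalg_diff_kernel_map: "nalg_diff (kernel_map n p) \<in> lie_ideal n"
proof (rule linear_in_subspace_on_words[OF linear_compose[OF linear_kernel_map linear_nalg_diff,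
    unfolded o_def]
      subspace_lie_ideal])
  show "nalg_diff (kernel_map n (word t)) \<in> lie_ideal n" for t
  proof (induction t)
    case (Gen I)
    show ?case by (simp add: kernel_map_def linear_0[OF linear_nalg_diff] zero_in_lie_ideal)
  next
    case (Br s t)
    have *: "nalg_diff (br (pr0 n p) (kernel_map n q)) \<in> lie_ideal n"
        if "nalg_diff (kernel_map n q) \<in> lie_ideal n" for p q
      using that nalg_diff_br_0_m1[OF pr0_closed kernel_map_closed, of n p q]
      by (simp add: lie_ideal.br_left homogeneous_carrier[OF pr0_closed])
    have "nalg_diff (kernel_map n (br (word s) (word t))) \<in> lie_ideal n"
      unfolding kernel_map_br nalg_diff_simps
      by (intro lie_ideal_diff lie_ideal_add nalg_diff_koszul * Br)
    then show ?case by simp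
  qed
qed

text \<open>The symmetric recursion reduces to the one-sided rule for H, because \<open>pr0\<close>
  kills \<open>t\<close>.\<close>

lemma kernel_map_act:
  assumes "g \<in> homogeneous n 0" "t \<in> homogeneous n (- 1)"
  shows "kernel_map n (br g t) = br g (kernel_map n t) + koszul n g t"
  using assms pr0_homogeneous[OF assms(1)] pr0_homogeneous[OF assms(2)]
  by (simp add: kernel_map_br koszul_zero linear_0[OF linear_coef])

text \<open>Already on letters \<open>d\<close> produces brackets. Hence the correction terms along
  an element of the image of \<open>d\<close> disappear.\<close>

lemma coef_nalg_diff: "coef (nalg_diff x) i = 0"
proof (rule linear_eq_on_words[where f = "\<lambda>x. coef (nalg_diff x) i" and g = "\<lambda>_. 0"])
  show "lin (\<lambda>x. coef (nalg_diff x) i)"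
    using linear_compose[OF linear_nalg_diff linear_coef] by (simp add: o_def)
  show "coef (nalg_diff (word t)) i = 0" for t
  proof (cases t)
    case (Gen I)
    have "coef (word (Br a b)) i = 0" for a b by (simp add: coef_def word_def lookup_single)
    then show ?thesis
      unfolding Gen by (simp add: nalg_diff_def diff_symbol_def linear_sum[OF linear_coef]
          linear_scale[OF linear_coef] linear_neg[OF linear_coef])
  next
    case (Br s t)
    show ?thesis
      unfolding Br by (simp add: nalg_diff_def linear_add[OF linear_coef] linear_scale[OF
          linear_coef])
  qed
qed (rule linear_zero)

lemma kernel_map_derived_bracket:
  assumes x: "x \<in> homogeneous n (- 1)" and y: "y \<in> homogeneous n (- 1)"
  shows "kernel_map n (br (nalg_diff x) y) \<in> peiffer n"
proof -
  have "coef (nalg_diff x) i = 0" for i by (rule coef_nalg_diff)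
  then have "kernel_map n (br (nalg_diff x) y) = br (nalg_diff x) (kernel_map n y)"
    using kernel_map_act[OF nalg_diff_degree_m1[OF x] y] by (simp add: koszul_zero)
  \<comment> \<open>The kernel is central: Peiffer's identity exchanges the roles of x and
    \<open>kernel_map n y\<close>, whose differential is zero modulo the ideal.\<close>
  also have "\<dots> = (br (nalg_diff x) (kernel_map n y) +
      br (nalg_diff (kernel_map n y)) x) - br (nalg_diff (kernel_map n y)) x"
    by simp
  also have "\<dots> \<in> peiffer n"
    using x by (intro peiffer_diff peiffer_identity lie_ideal_peiffer[OF lie_ideal.br_right]
        nalg_diff_kernel_map)
      (auto intro: homogeneous_carrier)
  finally show ?thesis .
qed

lemma kernel_map_peiffer:
  assumes "x \<in> peiffer n"
  shows "kernel_map n x \<in> peiffer n"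
  by (rule peiffer_image[OF linear_kernel_map subspace_peiffer kernel_map_lie_ideal _ assms])
    (simp_all add: linear_add[OF linear_kernel_map] peiffer_add kernel_map_derived_bracket)

subsection \<open>Invertibility on the kernel\<close>

definition euler :: "nat \<Rightarrow> nalg \<Rightarrow> nalg" where
  "euler n p = kernel_map n p + euler_lift n (nalg_diff p)"

lemma linear_euler: "lin (euler n)"
  unfolding euler_def
  by (intro linear_compose_add linear_kernel_map linear_compose[OF linear_nalg_diff
      linear_euler_lift, unfolded o_def])

lemmas euler_simps = linear_add[OF linear_euler] linear_diff[OF linear_euler] linear_scale[OF
    linear_euler]

lemma euler_closed [simp]: "euler n p \<in> homogeneous n (- 1)"
  by (simp add: euler_def homogeneous_add)

lemma euler_peiffer: "p \<in> peiffer n \<Longrightarrow> euler n p \<in> peiffer n"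
  by (simp add: euler_def peiffer_add kernel_map_peiffer lie_ideal_peiffer euler_lift_lie_ideal
      nalg_diff_peiffer)

lemma generator_homogeneous: "i < n \<Longrightarrow> word (Gen {i}) \<in> homogeneous n 0"
  by (simp add: homogeneous_words)

text \<open>The factor 2 comes from R([Z_i, Z_j]) = Z_i \<and> Z_j - Z_j \<and> Z_i, to which H adds
  nothing on a letter.\<close>

lemma euler_gen:
  assumes "i < j" "j < n"
  shows "euler n (word (Gen {i, j})) = 2 *\<^sub>R word (Gen {i, j})"
proof -
  have "pr0 n (word (Gen {i})) = word (Gen {i})" "pr0 n (word (Gen {j})) = word (Gen {j})"
    using pr0_homogeneous[OF generator_homogeneous] assms by simp_all
  then have "euler_lift n (br (word (Gen {i})) (word (Gen {j}))) = word (Gen {i, j}) +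
      word (Gen {i, j})"
    using assms wedge_anti[of n "word (Gen {j})" "word (Gen {i})"]
    unfolding euler_lift_br by (simp add: wedge_der_gen wedge_gen) (simp add: euler_lift_def)
  then show ?thesis
    using assms by (simp add: euler_def nalg_diff_pair scaleR_2) (simp add: kernel_map_def)
qed

text \<open>The term W_x(dt) enters \<open>koszul\<close> with a minus sign and
  \<open>euler_lift\<close> with a plus sign. After cancellation [x, t] remains once: a further
  letter adds 1 to the length.\<close>

lemma euler_act:
  assumes i: "i < n" and t: "t \<in> homogeneous n (- 1)"
  shows "euler n (br (word (Gen {i})) t) = br (word (Gen {i})) (euler n t) + br (word (Gen {i})) t"
proof -
  let ?x = "word (Gen {i})"
  have x: "?x \<in> homogeneous n 0" by (rule generator_homogeneous[OF i])
  have "euler_lift n (br ?x (nalg_diff t)) = br ?x (euler_lift n (nalg_diff t)) +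
      wedge_der n ?x (nalg_diff t)"
    using pr0_homogeneous[OF x] pr0_homogeneous[OF nalg_diff_degree_m1[OF t]]
    unfolding euler_lift_br by (simp add: wedge_der_zero coef_nalg_diff) (simp add: euler_lift_def)
  then show ?thesis
    using prm1_homogeneous[OF t]
    by (simp add: euler_def kernel_map_act[OF x t] nalg_diff_br_0_m1[OF x t] koszul_def
        lin1_gen[OF i] br_simps)
qed

text \<open>A polynomial in \<open>euler\<close>, given by the list of its roots.\<close>

primrec euler_shift :: "nat \<Rightarrow> real list \<Rightarrow> nalg \<Rightarrow> nalg" where
  "euler_shift n [] t = t"
| "euler_shift n (l # ls) t = euler_shift n ls (euler n t - l *\<^sub>R t)"

lemma linear_iter: "lin (euler_shift n ls)"
proof (induction ls)
  case (Cons l ls)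
  have "lin (\<lambda>t. euler_shift n ls (euler n t - l *\<^sub>R t))"
    by (rule linear_compose[OF _ Cons, unfolded o_def])
      (intro linear_compose_sub linear_euler linear_compose_scale_right linear_id)
  then show ?case by simp
qed (simp add: linear_id)

lemma euler_shift_peiffer: "t \<in> peiffer n \<Longrightarrow> euler_shift n ls t \<in> peiffer n"
  by (induction ls arbitrary: t) (simp_all add: euler_peiffer peiffer_diff peiffer_scale)

lemma euler_shift_append: "euler_shift n (ls @ ms) t = euler_shift n ms (euler_shift n ls t)"
  by (induction ls arbitrary: t) simp_all

lemma euler_shift_euler: "euler_shift n ls (euler n t) = euler n (euler_shift n ls t)"
  by (induction ls arbitrary: t) (simp_all flip: euler_simps(2,3))

lemma euler_shift_commute: "euler_shift n ls (euler_shift n ms t) =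
    euler_shift n ms (euler_shift n ls t)"
  by (induction ms arbitrary: t)
    (simp_all add: linear_diff[OF linear_iter] linear_scale[OF linear_iter] euler_shift_euler)

text \<open>By \<open>euler_act\<close>, bracketing with a letter intertwines
  \<open>euler - l\<close> with \<open>euler - (l + 1)\<close>, so every root moves up by
  one.\<close>

lemma euler_shift_act:
  assumes "i < n" "t \<in> homogeneous n (- 1)"
  shows "euler_shift n (map (\<lambda>l. l + 1) ls) (br (word (Gen {i})) t) = br (word (Gen {i}))
      (euler_shift n ls t)"
  using assms(2)
proof (induction ls arbitrary: t)
  case (Cons l ls)
  have "euler n (br (word (Gen {i})) t) - (l + 1) *\<^sub>R br (word (Gen {i})) t =
      br (word (Gen {i})) (euler n t - l *\<^sub>R t)"
    by (simp add: euler_act[OF assms(1) Cons.prems] br_simps scaleR_add_left)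
  with Cons show ?case
    by (simp add: homogeneous_diff
      homogeneous_scale)
qed simp

text \<open>The quotient is not known to be graded by the length of words, so an element need not be a sum
  of eigenvectors of \<open>euler\<close> a priori. It suffices that a product of factors \<open>euler - l\<close> with
  \<open>l > 0\<close> annihilates it.\<close>

definition diagonal :: "nat \<Rightarrow> nalg set" where
  "diagonal n = {t. \<exists>ls. (\<forall>l\<in>set ls. l > 0) \<and> euler_shift n ls t \<in> peiffer n}"

lemma peiffer_diagonal: "t \<in> peiffer n \<Longrightarrow> t \<in> diagonal n"
  unfolding diagonal_def by (auto intro: exI[of _ "[]"])

lemma subspace_diagonal: "subsp (diagonal n)"
proof (rule real_vector.subspaceI)
  show "0 \<in> diagonal n" by (simp add: peiffer_diagonal)
next
  fix p q assume "p \<in> diagonal n" "q \<in> diagonal n"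
  then obtain ls ms where *: "\<forall>l\<in>set ls. l > 0" "euler_shift n ls p \<in> peiffer n"
    "\<forall>l\<in>set ms. l > 0" "euler_shift n ms q \<in> peiffer n"
    by (auto simp: diagonal_def)
  then have "euler_shift n ms (euler_shift n ls p) +
      euler_shift n ls (euler_shift n ms q) \<in> peiffer n"
    using peiffer_add[OF euler_shift_peiffer euler_shift_peiffer] by blast
  \<comment> \<open>Polynomials in one operator commute, so the concatenated roots annihilate both
    summands.\<close>
  then have "euler_shift n (ls @ ms) (p + q) \<in> peiffer n"
    by (simp only: euler_shift_append linear_add[OF linear_iter] euler_shift_commute[of n ms ls q])
  then show "p + q \<in> diagonal n"
    using * unfolding diagonal_def by (intro CollectI exI[of _ "ls @ ms"]) auto
next
  fix c p assume "p \<in> diagonal n"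
  then show "c *\<^sub>R p \<in> diagonal n"
    by (auto simp: diagonal_def linear_scale[OF linear_iter] peiffer_scale)
qed

text \<open>A letter shifts the roots up and keeps them positive. A bracket [s, r] acts as a
  commutator modulo Jacobi, which applies the induction hypotheses in succession; therefore
  \<open>t\<close> is generalized.\<close>

lemma diagonal_act:
  assumes "g \<in> homogeneous n 0" "t \<in> diagonal n" "t \<in> homogeneous n (- 1)"
  shows "br g t \<in> diagonal n"
proof (rule linear_homogeneous[OF linear_br_left subspace_diagonal _ assms(1)])
  fix s assume "set_bword s \<subseteq> symbols n" "wdeg s = 0"
  then show "br (word s) t \<in> diagonal n"
    using assms(2,3)
  proof (induction arbitrary: t rule: homogeneous_0_induct)
    case (gen i)
    then obtain ls where "\<forall>l\<in>set ls. l > 0" "euler_shift n ls t \<in> peiffer n"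
      by (auto simp: diagonal_def)
    then show ?case
      using gen euler_shift_act[of i n t ls] peiffer_act[OF generator_homogeneous]
      unfolding diagonal_def by (intro CollectI exI[of _ "map (\<lambda>l. l + 1) ls"]) fastforce
  next
    case (br s r)
    then have s: "word s \<in> homogeneous n 0" and r: "word r \<in> homogeneous n 0"
      by (simp_all add: homogeneous_words)
    have "br (br (word s) (word r)) t = br (word s) (br (word r) t) - br (word r) (br (word s) t) -
        (br (word s) (br (word r) t) - br (br (word s) (word r)) t - br (word r) (br (word s) t))"
      by simp
    also have "\<dots> \<in> diagonal n"
      using br.prems br.IH(1)[OF br.IH(2) br_closed_0[OF r]]
        br.IH(2)[OF br.IH(1) br_closed_0[OF s]]
        peiffer_diagonal[OF lie_ideal_peiffer[OF degree_0_jacobi[OF s r br.prems(2)]]]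
      by (simp only: real_vector.subspace_diff[OF subspace_diagonal])
    finally show ?case by simp
  qed
qed

lemma homogeneous_diagonal:
  assumes "t \<in> homogeneous n (- 1)"
  shows "t \<in> diagonal n"
proof (rule linear_homogeneous[OF linear_id subspace_diagonal _ assms])
  fix t assume "set_bword t \<subseteq> symbols n" "wdeg t = - 1"
  then show "word t \<in> diagonal n"
  proof (induction rule: homogeneous_1_induct)
    case (gen i j)
    then show ?case
      \<comment> \<open>The root is the eigenvalue from \<open>euler_gen\<close>.\<close>
      unfolding diagonal_def by (intro CollectI exI[of _ "[2]"]) (simp add: euler_gen)
  next
    case (left s t)
    then show ?case
      using diagonal_act[of "word s" n "word t"] by (simp add: homogeneous_words)
  next
    case (right s t)
    then have s: "word s \<in> homogeneous n 0" and t: "word t \<in> homogeneous n (- 1)"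
      by (simp_all add: homogeneous_words)
    have "br (word t) (word s) = (br (word t) (word s) + br (word s) (word t)) - br (word s)
        (word t)"
      by simp
    also have "\<dots> \<in> diagonal n"
      by (intro real_vector.subspace_diff[OF subspace_diagonal] peiffer_diagonal lie_ideal_peiffer
        degree_0_hom_antisymmetry(2)[OF s t] diagonal_act[OF s right(5) t])
    finally show ?case by simp
  qed
qed

text \<open>Modulo \<open>peiffer n\<close>, if \<open>euler\<close> kills t then
  \<open>euler - l\<close> acts on t as -l, which is invertible. So each factor of the annihilating
  polynomial can be cancelled.\<close>

lemma euler_injective:
  assumes "euler_shift n ls t \<in> peiffer n" "\<forall>l\<in>set ls. l > 0" "euler n t \<in> peiffer n"
  shows "t \<in> peiffer n"
  using assms
proof (induction ls arbitrary: t)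
  case (Cons l ls)
  then have "euler n (euler n t - l *\<^sub>R t) \<in> peiffer n"
    using peiffer_diff[OF euler_peiffer peiffer_scale] by (simp only: euler_simps)
  with Cons have "euler n t - l *\<^sub>R t \<in> peiffer n" by auto
  from peiffer_diff[OF Cons.prems(3) this]
  have "l *\<^sub>R t \<in> peiffer n" by simp
  then have "(1 / l) *\<^sub>R (l *\<^sub>R t) \<in> peiffer n" by (rule peiffer_scale)
  with Cons.prems show ?case by simp
qed simp

lemma nalg_diff_euler:
  assumes "nalg_diff t \<in> lie_ideal n"
  shows "nalg_diff (euler n t) \<in> lie_ideal n"
  using nalg_diff_kernel_map euler_lift_lie_ideal[OF assms] assms
  by (simp add: euler_def nalg_diff_simps lie_ideal_add nalg_diff_lie_ideal)

text \<open>Modulo \<open>peiffer n\<close>, a preimage u of \<open>euler t - l t\<close> gives l t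
  = \<open>euler (t - u)\<close>, hence the preimage (t - u) / l of t. With no roots left t is
  itself zero in the quotient.\<close>

lemma euler_surjective:
  assumes "euler_shift n ls t \<in> peiffer n" "\<forall>l\<in>set ls. l > 0" "t \<in> homogeneous n (- 1)"
    "nalg_diff t \<in> lie_ideal n"
  shows "\<exists>u\<in>homogeneous n (- 1). nalg_diff u \<in> lie_ideal n \<and> euler n u - t \<in> peiffer n"
  using assms
proof (induction ls arbitrary: t)
  case Nil
  then show ?case
    by (intro bexI[of _ 0]) (auto simp: linear_0[OF linear_nalg_diff] linear_0[OF linear_euler]
      zero_in_lie_ideal peiffer_neg homogeneous_zero)
next
  case (Cons l ls)
  let ?t = "euler n t - l *\<^sub>R t"
  have "?t \<in> homogeneous n (- 1)" "nalg_diff ?t \<in> lie_ideal n"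
    using Cons.prems
    by (simp_all add: nalg_diff_simps lie_ideal_diff lie_ideal_scale nalg_diff_euler
      homogeneous_diff homogeneous_scale)
  then have "\<exists>u\<in>homogeneous n (- 1). nalg_diff u \<in> lie_ideal n \<and> euler n u - ?t \<in> peiffer n"
    using Cons.IH[of ?t] Cons.prems by simp
  then obtain u where u: "u \<in> homogeneous n (- 1)" "nalg_diff u \<in> lie_ideal n"
    "euler n u - ?t \<in> peiffer n"
    by blast
  have "l \<noteq> 0" using Cons.prems by auto
  then have "euler n ((1 / l) *\<^sub>R (t - u)) - t = - ((1 / l) *\<^sub>R (euler n u - ?t))"
    by (simp add: euler_simps scaleR_diff_right)
  moreover have "- ((1 / l) *\<^sub>R (euler n u - ?t)) \<in> peiffer n"
    using u by (intro peiffer_neg peiffer_scale)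
  ultimately show ?case
    using u Cons.prems
    by (intro bexI[of _ "(1 / l) *\<^sub>R (t - u)"])
      (simp_all add: nalg_diff_simps lie_ideal_diff lie_ideal_scale
      homogeneous_diff homogeneous_scale)
qed

section \<open>Bijectivity of \<open>kernel_map\<close> on the kernel\<close>

lemma euler_kernel: "nalg_diff t \<in> lie_ideal n \<Longrightarrow> euler n t - kernel_map n t \<in> peiffer n"
  by (simp add: euler_def lie_ideal_peiffer euler_lift_lie_ideal)

lemma kernel_map_injective:
  assumes "t \<in> homogeneous n (- 1)" "nalg_diff t \<in> lie_ideal n" "kernel_map n t \<in> peiffer n"
  shows "t \<in> peiffer n"
proof -
  have "euler n t \<in> peiffer n" using peiffer_add[OF euler_kernel[OF assms(2)] assms(3)] by simp
  then show ?thesis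
    using homogeneous_diagonal[OF assms(1)] euler_injective unfolding diagonal_def by blast
qed

lemma kernel_map_surjective:
  assumes "t \<in> homogeneous n (- 1)" "nalg_diff t \<in> lie_ideal n"
  shows "\<exists>u\<in>homogeneous n (- 1). nalg_diff u \<in> lie_ideal n \<and> kernel_map n u - t \<in> peiffer n"
proof -
  obtain ls where "\<forall>l\<in>set ls. l > 0" "euler_shift n ls t \<in> peiffer n"
    using homogeneous_diagonal[OF assms(1)] by (auto simp: diagonal_def)
  then obtain u where u: "u \<in> homogeneous n (- 1)" "nalg_diff u \<in> lie_ideal n"
      "euler n u - t \<in> peiffer n"
    using euler_surjective[OF _ _ assms] by blast
  then have "kernel_map n u - t \<in> peiffer n" using peiffer_diff[OF u(3) euler_kernel[OF u(2)]] by
      simp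
  with u show ?thesis by blast
qed

section \<open>The action of the general linear group\<close>

lemma det_2:
  assumes "M \<in> carrier_mat 2 2"
  shows "Determinant.det M = M $$ (0, 0) * M $$ (1, 1) - M $$ (0, 1) * M $$ (1, 0)"
proof -
  have "Determinant.det (mat_delete M 0 j) = mat_delete M 0 j $$ (0, 0)" if "j < 2" for j
    using assms by (intro det_single) (auto simp: mat_delete_def)
  then show ?thesis
    using laplace_expansion_row[OF assms, of 0] assms
    by (simp add: numeral_2_eq_2 cofactor_def mat_delete_def)
qed

lemma submatrix_1:
  assumes "A \<in> carrier_mat n n" "k < n" "i < n"
  shows "Determinant.det (submatrix A {k} {i}) = (A $$ (k, i) :: real)"
proof -
  have c: "card {a. a < n \<and> a \<in> {k}} = 1" if "k < n" for k
  proof -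
    have "{a. a < n \<and> a \<in> {k}} = {k}" using that by blast
    then show ?thesis by simp
  qed
  have "submatrix A {k} {i} \<in> carrier_mat 1 1"
    using assms c[of k] c[of i] by (intro carrier_matI) (simp_all only: dim_submatrix carrier_matD)
  moreover have "submatrix A {k} {i} $$ (0, 0) = A $$ (k, i)"
  proof -
    have "{a \<in> {k}. a < k} = {}" for k :: nat by blast
    then show ?thesis
      using submatrix_index_card[of k A i "{k}" "{i}"] assms
      by (simp only: carrier_matD card.empty insert_iff simp_thms)
  qed
  ultimately show ?thesis by (simp only: det_single)
qed

lemma submatrix_2:
  assumes "A \<in> carrier_mat n n" "k < l" "l < n" "i < j" "j < n"
  shows "Determinant.det (submatrix A {k, l} {i, j}) =
    (A $$ (k, i) * A $$ (l, j) - A $$ (k, j) * A $$ (l, i) :: real)"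
proof -
  have c: "card {a. a < n \<and> a \<in> {k, l}} = 2" if "k < l" "l < n" for k l
  proof -
    have "{a. a < n \<and> a \<in> {k, l}} = {k, l}" using that by auto
    then show ?thesis using that by simp
  qed
  have "submatrix A {k, l} {i, j} \<in> carrier_mat 2 2"
    using assms c[of k l] c[of i j]
    by (intro carrier_matI) (simp_all only: dim_submatrix carrier_matD)
  \<comment> \<open>\<open>submatrix_index_card\<close> locates an entry by the number of selected
    indices below it: none for the smaller index, one for the larger.\<close>
  moreover have e: "card {a \<in> {k, l}. a < k} = 0" "card {a \<in> {k, l}. a < l} = 1" if "k < l"
      for k l :: nat
  proof -
    have "{a \<in> {k, l}. a < k} = {}" "{a \<in> {k, l}. a < l} = {k}" using that by auto
    then show "card {a \<in> {k, l}. a < k} = 0" "card {a \<in> {k, l}. a < l} = 1" by simp_all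
  qed
  have "k < n" "i < n" using assms by simp_all
  then have "submatrix A {k, l} {i, j} $$ (0, 0) = A $$ (k, i)"
    "submatrix A {k, l} {i, j} $$ (0, 1) = A $$ (k, j)"
    "submatrix A {k, l} {i, j} $$ (1, 0) = A $$ (l, i)"
    "submatrix A {k, l} {i, j} $$ (1, 1) = A $$ (l, j)"
    using submatrix_index_card[of k A i "{k, l}" "{i, j}"] submatrix_index_card[of k A j "{k, l}"
        "{i, j}"]
      submatrix_index_card[of l A i "{k, l}" "{i, j}"] submatrix_index_card[of l A j "{k, l}" "{i,
          j}"]
      assms e[of k l] e[of i j]
    by (simp_all only: carrier_matD insert_iff simp_thms)
  ultimately show ?thesis by (simp only: det_2)
qed

section \<open>The action on formal combinations and its equivariance properties\<close>

definition nalg_gl :: "real mat \<Rightarrow> nalg \<Rightarrow> nalg" where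
  "nalg_gl A = linear_ext (gl_word A)"

lemma linear_nalg_gl: "lin (nalg_gl A)"
  by (simp add: nalg_gl_def linear_linear_ext)

lemmas nalg_gl_simps = linear_add[OF linear_nalg_gl] linear_diff[OF linear_nalg_gl]
  linear_scale[OF linear_nalg_gl] linear_neg[OF linear_nalg_gl]

lemma nalg_gl_br: "nalg_gl A (br p q) = br (nalg_gl A p) (nalg_gl A q)"
  by (rule linear_on_br[OF linear_nalg_gl])
    ((intro linear_br_compose_left linear_br_compose_right linear_nalg_gl)+, simp add: nalg_gl_def)

lemma nalg_gl_gen:
  assumes A: "A \<in> carrier_mat n n" and "i < n"
  shows "nalg_gl A (word (Gen {i})) = (\<Sum>k<n. A $$ (k, i) *\<^sub>R word (Gen {k}))"
proof -
  have "{K. K \<subseteq> {..<n} \<and> card K = 1} = (\<lambda>k. {k}) ` {..<n}"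
    by (auto simp: card_1_singleton_iff)
  then have "nalg_gl A (word (Gen {i})) =
      (\<Sum>K\<in>(\<lambda>k. {k}) ` {..<n}. Determinant.det (submatrix A K {i}) *\<^sub>R word (Gen K))"
    using A by (simp add: nalg_gl_def)
  also have "\<dots> = (\<Sum>k<n. A $$ (k, i) *\<^sub>R word (Gen {k}))"
    using assms by (subst sum.reindex) (auto simp: submatrix_1)
  finally show ?thesis .
qed

lemma coef_nalg_gl_gen:
  assumes "A \<in> carrier_mat n n" "i < n" "k < n"
  shows "coef (nalg_gl A (word (Gen {i}))) k = A $$ (k, i)"
  using assms
  by (simp add: nalg_gl_gen linear_sum[OF linear_coef] linear_scale[OF linear_coef]
      if_distrib[of "\<lambda>c. _ * c"] cong: if_cong)

text \<open>The 2 x 2 minors are the coordinates of a wedge of two columns. From here on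
  determinants no longer appear, and the action on Z_ij is governed by that on Z_i.\<close>

lemma nalg_gl_pair:
  assumes A: "A \<in> carrier_mat n n" and "i < j" "j < n"
  shows "nalg_gl A (word (Gen {i, j})) =
    wedge n (nalg_gl A (word (Gen {i}))) (nalg_gl A (word (Gen {j})))"
proof -
  have 2: "{K. K \<subseteq> {..<n} \<and> card K = 2} = (\<lambda>(k, l). {k, l}) ` pairs n"
  proof (intro equalityI subsetI)
    fix K assume "K \<in> {K. K \<subseteq> {..<n} \<and> card K = 2}"
    then have "K \<in> symbols n" "card K = 2" by (auto simp: symbols_def)
    then show "K \<in> (\<lambda>(k, l). {k, l}) ` pairs n"
      using symbol_card_2[of K n] by (auto simp: pairs_def)
  qed (auto simp: pairs_def)
  have "inj_on (\<lambda>(k, l). {k, l}) (pairs n)"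
    by (auto simp: inj_on_def pairs_def doubleton_eq_iff)
  moreover have "nalg_gl A (word (Gen {i, j})) =
      (\<Sum>K\<in>(\<lambda>(k, l). {k, l}) ` pairs n. Determinant.det (submatrix A K {i, j}) *\<^sub>R word (Gen K))"
    using A assms 2[unfolded numeral_2_eq_2] by (simp add: nalg_gl_def)
  ultimately show ?thesis
    using assms unfolding wedge_def
    by (subst (asm) sum.reindex)
      (auto intro!: sum.cong simp: pairs_def submatrix_2 coef_nalg_gl_gen)
qed

lemma nalg_gl_homogeneous:
  assumes A: "A \<in> carrier_mat n n" and "x \<in> homogeneous n k"
  shows "nalg_gl A x \<in> homogeneous n k"
proof (rule linear_homogeneous[OF linear_nalg_gl subspace_homogeneous _ assms(2)])
  have "nalg_gl A (word t) \<in> homogeneous n (wdeg t)" if "set_bword t \<subseteq> symbols n" for t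
    using that
  proof (induction t)
    case (Gen I)
    then have I: "card I \<ge> 1" using symbols_card by auto
    have "word (Gen K) \<in> homogeneous n (1 - int (card I))" if "K \<subseteq> {..<n}" "card K = card I" for K
    proof -
      have "K \<noteq> {}" using that I by auto
      then show ?thesis using that by (simp add: homogeneous_words symbols_def)
    qed
    then show ?case
      using A by (auto simp: nalg_gl_def intro!: real_vector.subspace_sum[OF subspace_homogeneous]
          homogeneous_scale)
  next
    case (Br s t)
    then show ?case
      using br_homogeneous nalg_gl_br[of A "word s" "word t"] by simp
  qed
  then show "nalg_gl A (word t) \<in> homogeneous n k" if "set_bword t \<subseteq> symbols n" "wdeg t = k" for t
    using that by blast
qed

lemma nalg_gl_carrier:
  assumes "A \<in> carrier_mat n n" "x \<in> carrier (free_nalg n)"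
  shows "nalg_gl A x \<in> carrier (free_nalg n)"
  by (rule linear_carrier[OF linear_nalg_gl subspace_carrier _ assms(2)])
    (blast intro: homogeneous_carrier nalg_gl_homogeneous[OF assms(1)] word_homogeneous)

lemma nalg_gl_lie_ideal:
  assumes "A \<in> carrier_mat n n" "x \<in> lie_ideal n"
  shows "nalg_gl A x \<in> lie_ideal n"
  by (rule lie_ideal_hom[OF linear_nalg_gl nalg_gl_br _ _ assms(2)])
    (simp_all add: nalg_gl_homogeneous nalg_gl_carrier assms(1))

lemma coef_lin1: "i < n \<Longrightarrow> coef (lin1 n p) i = coef p i"
  by (simp add: lin1_def linear_sum[OF linear_coef] linear_scale[OF linear_coef]
      if_distrib[of "\<lambda>c. _ * c"] cong: if_cong)

lemma wedge_lin1: "wedge n (lin1 n p) q = wedge n p q" "wedge n p (lin1 n q) = wedge n p q"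
  unfolding wedge_def by (rule sum.cong; auto simp: pairs_def coef_lin1)+

lemma lin1_br [simp]: "lin1 n (br p q) = 0"
  by (simp add: lin1_def)

text \<open>The action sends letters Z_i to combinations of letters and brackets to brackets, so it
  preserves the splitting into linear part and rest.\<close>

lemma nalg_gl_lin1:
  assumes A: "A \<in> carrier_mat n n" and g: "g \<in> homogeneous n 0"
  shows "lin1 n (nalg_gl A g) = nalg_gl A (lin1 n g)"
proof -
  have lin: "lin (\<lambda>g. lin1 n (nalg_gl A g) - nalg_gl A (lin1 n g))"
    by (intro linear_compose_sub linear_compose[OF linear_nalg_gl linear_lin1, unfolded o_def]
      linear_compose[OF linear_lin1 linear_nalg_gl, unfolded o_def])
  have "lin1 n (nalg_gl A g) - nalg_gl A (lin1 n g) \<in> {0}"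
  proof (rule linear_homogeneous[OF lin real_vector.subspace_single_0 _ g])
    fix t assume "set_bword t \<subseteq> symbols n" "wdeg t = 0"
    then show "lin1 n (nalg_gl A (word t)) - nalg_gl A (lin1 n (word t)) \<in> {0}"
    proof (induction rule: homogeneous_0_induct)
      case (gen i)
      then show ?case
        using A by (simp add: lin1_gen nalg_gl_gen linear_sum[OF linear_lin1] linear_scale[OF
            linear_lin1])
    next
      case (br s t)
      show ?case
        using nalg_gl_br[of A "word s" "word t"] lin1_br[of n "word s" "word t"]
        by (simp add: linear_0[OF linear_nalg_gl])
    qed
  qed
  then show ?thesis by simp
qed

lemma nalg_gl_wedge:
  assumes A: "A \<in> carrier_mat n n" and p: "p \<in> homogeneous n 0" and q: "q \<in> homogeneous n 0"
  shows "nalg_gl A (wedge n p q) = wedge n (nalg_gl A p) (nalg_gl A q)"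
proof -
  let ?z = "\<lambda>i. nalg_gl A (word (Gen {i}))"
  have "wedge n (nalg_gl A p) (nalg_gl A q) = wedge n (nalg_gl A (lin1 n p)) (nalg_gl A (lin1 n q))"
    by (simp add: wedge_lin1 flip: nalg_gl_lin1[OF A p] nalg_gl_lin1[OF A q])
  also have "\<dots> = (\<Sum>i<n. \<Sum>j<n. (coef p i * coef q j) *\<^sub>R wedge n (?z i) (?z j))"
    unfolding lin1_def linear_sum[OF linear_nalg_gl] nalg_gl_simps
      linear_sum[OF linear_wedge_left] linear_sum[OF linear_wedge_right]
      linear_scale[OF linear_wedge_left] linear_scale[OF linear_wedge_right]
    by (subst sum.swap) (simp add: scaleR_sum_right mult.commute)
  also have "\<dots> = (\<Sum>(i, j)\<in>pairs n. (coef p i * coef q j - coef p j * coef q i) *\<^sub>R wedge n (?z i)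
      (?z j))"
  proof -
    have "wedge n (?z i) (?z j) + wedge n (?z j) (?z i) \<in> {0}" for i j
      using wedge_anti[of n "?z j" "?z i"] by simp
    from alternating_sum[OF real_vector.subspace_single_0 this, where n = n and a = "coef p"
        and b = "coef q"]
    show ?thesis by simp
  qed
  also have "\<dots> = nalg_gl A (wedge n p q)"
    unfolding wedge_def[of n p q] linear_sum[OF linear_nalg_gl]
    by (rule sum.cong) (auto simp: pairs_def nalg_gl_simps nalg_gl_pair[OF A])
  finally show ?thesis ..
qed

lemma nalg_gl_wedge_der:
  assumes A: "A \<in> carrier_mat n n" and v: "v \<in> homogeneous n 0" and g: "g \<in> homogeneous n 0"
  shows "nalg_gl A (wedge_der n v g) = wedge_der n (nalg_gl A v) (nalg_gl A g)"
proof -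
  have lin: "lin (\<lambda>g. nalg_gl A (wedge_der n v g) - wedge_der n (nalg_gl A v) (nalg_gl A g))"
    by (intro linear_compose_sub linear_compose[OF linear_nalg_gl linear_wedge_der, unfolded o_def]
      linear_compose[OF linear_wedge_der linear_nalg_gl, unfolded o_def])
  have "nalg_gl A (wedge_der n v g) - wedge_der n (nalg_gl A v) (nalg_gl A g) \<in> {0}"
  proof (rule linear_homogeneous[OF lin real_vector.subspace_single_0 _ g])
    fix t assume "set_bword t \<subseteq> symbols n" "wdeg t = 0"
    then show "nalg_gl A (wedge_der n v (word t)) - wedge_der n (nalg_gl A v)
        (nalg_gl A (word t)) \<in> {0}"
    proof (induction rule: homogeneous_0_induct)
      case (gen i)
      have "wedge_der n u (nalg_gl A (word (Gen {i}))) = wedge n u (nalg_gl A (word (Gen {i})))"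
          for u
        using gen A by (simp add: nalg_gl_gen linear_sum[OF linear_wedge_der] linear_scale[OF
            linear_wedge_der]
            linear_sum[OF linear_wedge_right] linear_scale[OF linear_wedge_right] wedge_der_gen)
      then show ?case
        using nalg_gl_wedge[OF A v generator_homogeneous[OF gen]] by (simp add: wedge_der_gen)
    next
      case (br s t)
      then have s: "word s \<in> homogeneous n 0" and t: "word t \<in> homogeneous n 0"
        by (simp_all add: homogeneous_words)
      have "nalg_gl A (wedge_der n v (br (word s) (word t))) =
          wedge_der n (nalg_gl A v) (nalg_gl A (br (word s) (word t)))"
        using br pr0_homogeneous[OF s] pr0_homogeneous[OF t]
          pr0_homogeneous[OF nalg_gl_homogeneous[OF A s]] pr0_homogeneous[OF
              nalg_gl_homogeneous[OF A t]]
        by (simp add: wedge_der_br nalg_gl_simps nalg_gl_br del: br_word_word)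
      then show ?case by simp
    qed
  qed
  then show ?thesis by simp
qed

text \<open>On Z_ij the differential of AZ_i \<and> AZ_j is [AZ_i, AZ_j] only modulo the ideal, by
  \<open>nalg_diff_wedge\<close>. Degree-0 factors then pass through both maps.\<close>

lemma nalg_gl_diff:
  assumes A: "A \<in> carrier_mat n n" and t: "t \<in> homogeneous n (- 1)"
  shows "nalg_gl A (nalg_diff t) - nalg_diff (nalg_gl A t) \<in> lie_ideal n"
proof -
  have lin: "lin (\<lambda>t. nalg_gl A (nalg_diff t) - nalg_diff (nalg_gl A t))"
    by (intro linear_compose_sub linear_compose[OF linear_nalg_gl linear_nalg_diff, unfolded o_def]
      linear_compose[OF linear_nalg_diff linear_nalg_gl, unfolded o_def])
  show ?thesis
  proof (rule linear_homogeneous[OF lin subspace_lie_ideal _ t])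
    fix t assume "set_bword t \<subseteq> symbols n" "wdeg t = - 1"
    then show "nalg_gl A (nalg_diff (word t)) - nalg_diff (nalg_gl A (word t)) \<in> lie_ideal n"
    proof (induction rule: homogeneous_1_induct)
      case (gen i j)
      then have "nalg_gl A (nalg_diff (word (Gen {i, j}))) =
          br (nalg_gl A (word (Gen {i}))) (nalg_gl A (word (Gen {j})))"
        using nalg_gl_br[of A "word (Gen {i})" "word (Gen {j})"] by (simp add: nalg_diff_pair)
      moreover have "lin1 n (nalg_gl A (word (Gen {i}))) = nalg_gl A (word (Gen {i}))" if "i < n"
          for i
        using nalg_gl_lin1[OF A generator_homogeneous[OF that]] that by (simp add: lin1_gen)
      ultimately show ?case
        using gen nalg_diff_wedge[of n "nalg_gl A (word (Gen {i}))" "nalg_gl A (word (Gen {j}))"]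
        by (simp add: nalg_gl_pair[OF A])
    next
      case (left s t)
      then have s: "word s \<in> homogeneous n 0" and t: "word t \<in> homogeneous n (- 1)"
        by (simp_all add: homogeneous_words)
      note As = nalg_gl_homogeneous[OF A s] and At = nalg_gl_homogeneous[OF A t]
      have "nalg_gl A (nalg_diff (br (word s) (word t))) - nalg_diff (nalg_gl A (br (word s)
          (word t))) =
          br (nalg_gl A (word s)) (nalg_gl A (nalg_diff (word t)) - nalg_diff (nalg_gl A (word t)))"
        by (simp only: nalg_diff_br_0_m1[OF s t] nalg_gl_br nalg_diff_br_0_m1[OF As At] br_simps)
      then show ?case
        using lie_ideal.br_left[OF homogeneous_carrier[OF As] left(5)] by simp
    next
      case (right s t)
      then have s: "word s \<in> homogeneous n 0" and t: "word t \<in> homogeneous n (- 1)"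
        by (simp_all add: homogeneous_words)
      note As = nalg_gl_homogeneous[OF A s] and At = nalg_gl_homogeneous[OF A t]
      have "nalg_gl A (nalg_diff (br (word t) (word s))) - nalg_diff (nalg_gl A (br (word t)
          (word s))) =
          br (nalg_gl A (nalg_diff (word t)) - nalg_diff (nalg_gl A (word t))) (nalg_gl A (word s))"
        by (simp only: nalg_diff_br_m1_0[OF s t] nalg_gl_br nalg_diff_br_m1_0[OF As At] br_simps)
      then show ?case
        using lie_ideal.br_right[OF right(5) homogeneous_carrier[OF As]] by simp
    qed
  qed
qed

lemma nalg_gl_koszul:
  assumes A: "A \<in> carrier_mat n n" and v: "v \<in> homogeneous n 0" and t: "t \<in> homogeneous n (- 1)"
  shows "nalg_gl A (koszul n v t) - koszul n (nalg_gl A v) (nalg_gl A t) \<in> lie_ideal n"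
proof -
  have "nalg_gl A (koszul n v t) - koszul n (nalg_gl A v) (nalg_gl A t) =
      - wedge_der n (nalg_gl A v) (nalg_gl A (nalg_diff t) - nalg_diff (nalg_gl A t))"
    using prm1_homogeneous[OF t] prm1_homogeneous[OF nalg_gl_homogeneous[OF A t]]
    by (simp add: koszul_def nalg_gl_simps nalg_gl_br nalg_gl_lin1[OF A v]
        nalg_gl_wedge_der[OF A v nalg_diff_degree_m1[OF t]] linear_diff[OF linear_wedge_der])
  then show ?thesis by (simp add: lie_ideal_neg wedge_der_lie_ideal nalg_gl_diff[OF A t])
qed

lemma nalg_gl_peiffer:
  assumes A: "A \<in> carrier_mat n n" and "x \<in> peiffer n"
  shows "nalg_gl A x \<in> peiffer n"
proof (rule peiffer_image[OF linear_nalg_gl subspace_peiffer _ _ assms(2)])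
  fix x y assume x: "x \<in> homogeneous n (- 1)" and y: "y \<in> homogeneous n (- 1)"
  note Ax = nalg_gl_homogeneous[OF A x] and Ay = nalg_gl_homogeneous[OF A y]
  have "nalg_gl A (br (nalg_diff x) y + br (nalg_diff y) x) =
    (br (nalg_diff (nalg_gl A x)) (nalg_gl A y) + br (nalg_diff (nalg_gl A y)) (nalg_gl A x)) +
    br (nalg_gl A (nalg_diff x) - nalg_diff (nalg_gl A x)) (nalg_gl A y) +
    br (nalg_gl A (nalg_diff y) - nalg_diff (nalg_gl A y)) (nalg_gl A x)"
    by (simp add: nalg_gl_simps nalg_gl_br br_simps)
  also have "\<dots> \<in> peiffer n"
    using peiffer_identity[OF Ax Ay]
      lie_ideal_peiffer[OF lie_ideal.br_right[OF nalg_gl_diff[OF A x] homogeneous_carrier[OF Ay]]]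
      lie_ideal_peiffer[OF lie_ideal.br_right[OF nalg_gl_diff[OF A y] homogeneous_carrier[OF Ax]]]
    by (simp only: peiffer_add)
  finally show "nalg_gl A (br (nalg_diff x) y + br (nalg_diff y) x) \<in> peiffer n" .
qed (simp add: lie_ideal_peiffer nalg_gl_lie_ideal[OF A])

text \<open>The action is compatible with the rule of \<open>kernel_map_act\<close>, because
  \<open>koszul\<close> is equivariant. On letters both sides vanish, since a Z_ij is sent to a
  combination of such letters.\<close>

lemma nalg_gl_kernel_map:
  assumes A: "A \<in> carrier_mat n n" and t: "t \<in> homogeneous n (- 1)"
  shows "nalg_gl A (kernel_map n t) - kernel_map n (nalg_gl A t) \<in> peiffer n"
proof -
  have lin: "lin (\<lambda>t. nalg_gl A (kernel_map n t) - kernel_map n (nalg_gl A t))"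
    by (intro linear_compose_sub linear_compose[OF linear_nalg_gl linear_kernel_map, unfolded o_def]
      linear_compose[OF linear_kernel_map linear_nalg_gl, unfolded o_def])
  have step: "nalg_gl A (kernel_map n (br s t)) - kernel_map n (nalg_gl A (br s t)) \<in> peiffer n"
    if s: "s \<in> homogeneous n 0" and t: "t \<in> homogeneous n (- 1)"
      and IH: "nalg_gl A (kernel_map n t) - kernel_map n (nalg_gl A t) \<in> peiffer n" for s t
  proof -
    note As = nalg_gl_homogeneous[OF A s] and At = nalg_gl_homogeneous[OF A t]
    have "nalg_gl A (kernel_map n (br s t)) - kernel_map n (nalg_gl A (br s t)) =
        br (nalg_gl A s) (nalg_gl A (kernel_map n t) - kernel_map n (nalg_gl A t)) +
        (nalg_gl A (koszul n s t) - koszul n (nalg_gl A s) (nalg_gl A t))"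
      by (simp add: kernel_map_act[OF s t] nalg_gl_br kernel_map_act[OF As At] nalg_gl_simps
          br_simps)
    then show ?thesis
      using peiffer_add[OF peiffer_act[OF As IH] lie_ideal_peiffer[OF nalg_gl_koszul[OF A s t]]]
          by simp
  qed
  show ?thesis
  proof (rule linear_homogeneous[OF lin subspace_peiffer _ t])
    fix t assume "set_bword t \<subseteq> symbols n" "wdeg t = - 1"
    then show "nalg_gl A (kernel_map n (word t)) - kernel_map n (nalg_gl A (word t)) \<in> peiffer n"
    proof (induction rule: homogeneous_1_induct)
      case (gen i j)
      have kernel_map_Gen: "kernel_map n (word (Gen I)) = 0" for I by (simp add: kernel_map_def)
      then have "kernel_map n (wedge n p q) = 0" for p q
        by (simp add: wedge_def linear_sum[OF linear_kernel_map] linear_scale[OF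
            linear_kernel_map] case_prod_beta)
      then show ?case
        using gen by (simp add: kernel_map_Gen nalg_gl_pair[OF A] linear_0[OF linear_nalg_gl])
    next
      case (left s t)
      then show ?case using step[of "word s" "word t"] by (simp add: homogeneous_words)
    next
      case (right s t)
      then have "nalg_gl A (kernel_map n (br (word s)
          (word t))) - kernel_map n (nalg_gl A (br (word s) (word t))) \<in> peiffer n"
        by (intro step) (simp_all add: homogeneous_words)
      then have "- (nalg_gl A (kernel_map n (br (word s)
          (word t))) - kernel_map n (nalg_gl A (br (word s) (word t)))) \<in> peiffer n"
        by (rule peiffer_neg)
      moreover have swap: "kernel_map n (br p q) = - kernel_map n (br q p)"
          for p q by (simp add: kernel_map_br)
      have "- (nalg_gl A (kernel_map n (br (word s)
          (word t))) - kernel_map n (nalg_gl A (br (word s) (word t)))) =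
          nalg_gl A (kernel_map n (br (word t) (word s))) - kernel_map n (nalg_gl A (br (word t)
              (word s)))"
        unfolding nalg_gl_br swap[of "word t" "word s"] swap[of "nalg_gl A (word t)"]
        by (simp only: nalg_gl_simps) simp
      ultimately have "nalg_gl A (kernel_map n (br (word t)
          (word s))) - kernel_map n (nalg_gl A (br (word t) (word s))) \<in> peiffer n"
        by (simp only:)
      then show ?case by simp
    qed
  qed
qed

section \<open>Action laws in degrees zero and minus one\<close>

lemma hom_eq_degree_0:
  assumes "lin h" "lin k" "\<And>p q. h (br p q) = br (h p) (h q)" "\<And>p q. k (br p q) = br (k p) (k q)"
    and "\<And>i. i < n \<Longrightarrow> h (word (Gen {i})) = k (word (Gen {i}))" and "x \<in> homogeneous n 0"
  shows "h x = k x"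
proof -
  have "h x - k x \<in> {0}"
  proof (rule linear_homogeneous[OF linear_compose_sub[OF assms(1,2)]
      real_vector.subspace_single_0 _ assms(6)])
    fix t assume "set_bword t \<subseteq> symbols n" "wdeg t = 0"
    then show "h (word t) - k (word t) \<in> {0}"
    proof (induction rule: homogeneous_0_induct)
      case (br s t)
      then show ?case using assms(3,4)[of "word s" "word t"] by simp
    qed (simp add: assms(5))
  qed
  then show ?thesis by simp
qed

lemma hom_eq_degree_m1:
  assumes "lin h" "lin k" "\<And>p q. h (br p q) = br (h p) (h q)" "\<And>p q. k (br p q) = br (k p) (k q)"
    and "\<And>i. i < n \<Longrightarrow> h (word (Gen {i})) = k (word (Gen {i}))"
    and "\<And>i j. i < j \<Longrightarrow> j < n \<Longrightarrow> h (word (Gen {i, j})) = k (word (Gen {i, j}))"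
    and "x \<in> homogeneous n (- 1)"
  shows "h x = k x"
proof -
  have *: "h (word s) = k (word s)" if "set_bword s \<subseteq> symbols n" "wdeg s = 0" for s
    using hom_eq_degree_0[OF assms(1-5), of n "word s"] that by (simp add: homogeneous_words)
  have "h x - k x \<in> {0}"
  proof (rule linear_homogeneous[OF linear_compose_sub[OF assms(1,2)]
      real_vector.subspace_single_0 _ assms(7)])
    fix t assume "set_bword t \<subseteq> symbols n" "wdeg t = - 1"
    then show "h (word t) - k (word t) \<in> {0}"
    proof (induction rule: homogeneous_1_induct)
      case (left s t)
      then show ?case using assms(3,4)[of "word s" "word t"] by (simp add: *)
    next
      case (right s t)
      then show ?case using assms(3,4)[of "word t" "word s"] by (simp add: *)
    qed (simp add: assms(6))
  qed
  then show ?thesis by simp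
qed

lemma nalg_gl_one_gen: "i < n \<Longrightarrow> nalg_gl (1\<^sub>m n) (word (Gen {i})) = word (Gen {i})"
proof -
  assume i: "i < n"
  have "nalg_gl (1\<^sub>m n) (word (Gen {i})) = (\<Sum>k<n. if k = i then word (Gen {k}) else 0)"
    unfolding nalg_gl_gen[OF one_carrier_mat i] by (rule sum.cong) (use i in auto)
  then show ?thesis using i by simp
qed

lemma nalg_gl_one:
  "x \<in> homogeneous n 0 \<Longrightarrow> nalg_gl (1\<^sub>m n) x = x"
  "x \<in> homogeneous n (- 1) \<Longrightarrow> nalg_gl (1\<^sub>m n) x = x"
proof -
  note rules = hom_eq_degree_0[where h = "nalg_gl (1\<^sub>m n)" and k = "\<lambda>x. x" and n = n]
    hom_eq_degree_m1[where h = "nalg_gl (1\<^sub>m n)" and k = "\<lambda>x. x" and n = n]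
  show "nalg_gl (1\<^sub>m n) x = x" if "x \<in> homogeneous n 0"
    by (rule rules(1)) (simp_all add: linear_nalg_gl linear_id nalg_gl_br nalg_gl_one_gen that)
  show "nalg_gl (1\<^sub>m n) x = x" if "x \<in> homogeneous n (- 1)"
    by (rule rules(2)) (simp_all add: linear_nalg_gl linear_id nalg_gl_br nalg_gl_one_gen
      nalg_gl_pair[OF one_carrier_mat] wedge_gen that)
qed

lemma nalg_gl_mult_gen:
  assumes A: "A \<in> carrier_mat n n" and B: "B \<in> carrier_mat n n" and i: "i < n"
  shows "nalg_gl (A * B) (word (Gen {i})) = nalg_gl A (nalg_gl B (word (Gen {i})))"
proof -
  have "nalg_gl (A * B) (word (Gen {i})) =
      (\<Sum>l<n. \<Sum>k<n. (A $$ (l, k) * B $$ (k, i)) *\<^sub>R word (Gen {l}))"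
    using A B i
    by (subst nalg_gl_gen[of _ n])
      (auto intro!: sum.cong simp: scalar_prod_def scaleR_sum_left atLeast0LessThan)
  also have "\<dots> = nalg_gl A (nalg_gl B (word (Gen {i})))"
    using A B i
    by (simp add: nalg_gl_gen linear_sum[OF linear_nalg_gl] nalg_gl_simps scaleR_sum_right)
      (subst sum.swap, simp add: mult.commute)
  finally show ?thesis .
qed

text \<open>On Z_ij this is functoriality of the wedge, through \<open>nalg_gl_pair\<close> and
  \<open>nalg_gl_wedge\<close>; it takes the place of the Cauchy-Binet formula for 2 x 2
  minors.\<close>

lemma nalg_gl_mult:
  assumes A: "A \<in> carrier_mat n n" and B: "B \<in> carrier_mat n n"
  shows "x \<in> homogeneous n 0 \<Longrightarrow> nalg_gl (A * B) x = nalg_gl A (nalg_gl B x)"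
    "x \<in> homogeneous n (- 1) \<Longrightarrow> nalg_gl (A * B) x = nalg_gl A (nalg_gl B x)"
proof -
  have lin: "lin (\<lambda>x. nalg_gl A (nalg_gl B x))"
    using linear_compose[OF linear_nalg_gl linear_nalg_gl] by (simp add: o_def)
  have AB: "A * B \<in> carrier_mat n n" using A B by simp
  note rules = hom_eq_degree_0[where h = "nalg_gl (A * B)" and k = "\<lambda>x. nalg_gl A (nalg_gl B x)"
      and n = n]
    hom_eq_degree_m1[where h = "nalg_gl (A * B)" and k = "\<lambda>x. nalg_gl A (nalg_gl B x)" and n = n]
  show "nalg_gl (A * B) x = nalg_gl A (nalg_gl B x)" if "x \<in> homogeneous n 0"
    by (rule rules(1)) (simp_all add: linear_nalg_gl lin nalg_gl_br nalg_gl_mult_gen[OF A B] that)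
  have "nalg_gl (A * B) (word (Gen {i, j})) = nalg_gl A (nalg_gl B (word (Gen {i, j})))"
    if "i < j" "j < n" for i j
    using that nalg_gl_wedge[OF A nalg_gl_homogeneous[OF B generator_homogeneous]
        nalg_gl_homogeneous[OF B generator_homogeneous], of i j]
    by (simp add: nalg_gl_pair[OF AB] nalg_gl_pair[OF B] nalg_gl_mult_gen[OF A B])
  note pair = this
  show "nalg_gl (A * B) x = nalg_gl A (nalg_gl B x)" if "x \<in> homogeneous n (- 1)"
    by (rule rules(2)) (simp_all add: linear_nalg_gl lin nalg_gl_br nalg_gl_mult_gen[OF A B] pair
        that)
qed

lemma gl_gla_cls:
  assumes "A \<in> carrier_mat n n" "p \<in> carrier (free_nalg n)"
  shows "gl_gla n A (cls n p) = cls n (nalg_gl A p)"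
  unfolding gl_gla_def gla_class_def nalg_gl_def[symmetric]
  by (rule gla.coset_map_coset)
    (simp_all add: assms nalg_gl_carrier linear_nalg_gl nalg_gl_lie_ideal)

lemma gl_g1_cls1:
  assumes A: "A \<in> carrier_mat n n" and p: "p \<in> homogeneous n (- 1)"
  shows "gl_g1 n A (cls1 n p) = cls1 n (nalg_gl A p)"
  unfolding gl_g1_def cls1_coset
  by (rule g1.coset_map_coset)
    (simp_all add: p nalg_gl_homogeneous[OF A] gl_gla_cls[OF A] homogeneous_carrier linear_nalg_gl
      cls_in_exact_brackets_iff nalg_gl_peiffer[OF A])

section \<open>The splitting\<close>

lemma lie_subalgebra:
  assumes L: "lie_algebra L" and C: "submodule class_ring C L"
    and mult: "\<And>x y. x \<in> C \<Longrightarrow> y \<in> C \<Longrightarrow> x \<otimes>\<^bsub>L\<^esub> y \<in> C"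
  shows "lie_algebra (L\<lparr>carrier := C\<rparr>)"
proof -
  have CL: "x \<in> carrier L" if "x \<in> C" for x using submodule.subset[OF C] that by blast
  interpret vectorspace class_ring L using L by (simp add: lie_algebra_def)
  have "vectorspace class_ring (L\<lparr>carrier := C\<rparr>)"
    using submodule_is_module[OF C] class_field.field_axioms by (simp add: vectorspace_def)
  then show ?thesis
    using L CL mult unfolding lie_algebra_def LinearCombinations.module_hom_def
    by (auto simp: Pi_iff)
qed

lemma vectorspace_mult_update:
  fixes V :: "(real, 'a) module"
  assumes "vectorspace class_ring V"
  shows "vectorspace class_ring (V\<lparr>mult := f\<rparr>)"
  using assms
  by (simp add: vectorspace_def Module.module_def module_axioms_def abelian_group_def
      abelian_monoid_def abelian_group_axioms_def)

lemma lie_algebra_direct_sum: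
  assumes L: "lie_algebra L" and M: "lie_algebra M"
  shows "lie_algebra (lie_direct_sum L M)"
proof -
  have vs: "vectorspace class_ring L" "vectorspace class_ring M"
    using L M by (simp_all add: lie_algebra_def)
  have "vectorspace class_ring (lie_direct_sum L M)"
    unfolding lie_direct_sum_def
    by (rule vectorspace_mult_update) (rule direct_sum_is_vs[OF vs])
  then show ?thesis
    using L M
    by (auto simp: lie_algebra_def LinearCombinations.module_hom_def lie_direct_sum_def
        direct_sum_def Pi_iff)
qed

lemma lie_direct_sum_simps:
  "carrier (lie_direct_sum L M) = carrier L \<times> carrier M"
  "v \<otimes>\<^bsub>lie_direct_sum L M\<^esub> w = (fst v \<otimes>\<^bsub>L\<^esub> fst w, snd v \<otimes>\<^bsub>M\<^esub> snd w)"
  "v \<oplus>\<^bsub>lie_direct_sum L M\<^esub> w = (fst v \<oplus>\<^bsub>L\<^esub> fst w, snd v \<oplus>\<^bsub>M\<^esub> snd w)"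
  "r \<odot>\<^bsub>lie_direct_sum L M\<^esub> v = (r \<odot>\<^bsub>L\<^esub> fst v, r \<odot>\<^bsub>M\<^esub> snd v)"
  by (simp_all add: lie_direct_sum_def direct_sum_def)

lemma gl_representation_direct_sum:
  assumes L: "gl_representation n L \<rho>" and M: "gl_representation n M \<sigma>"
  shows "gl_representation n (lie_direct_sum L M) (\<lambda>A. map_prod (\<rho> A) (\<sigma> A))"
proof -
  have vs: "vectorspace class_ring L" "vectorspace class_ring M"
    using L M by (simp_all add: gl_representation_def)
  have "vectorspace class_ring (lie_direct_sum L M)"
    unfolding lie_direct_sum_def
    by (rule vectorspace_mult_update) (rule direct_sum_is_vs[OF vs])
  then show ?thesis
    using L M
    by (auto simp: gl_representation_def LinearCombinations.module_hom_def lie_direct_sum_def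
        direct_sum_def Pi_iff)
qed

lemma gl_representation_sub:
  assumes L: "gl_representation n L \<rho>" and C: "submodule class_ring C L"
    and closed: "\<And>A x. A \<in> GL n \<Longrightarrow> x \<in> C \<Longrightarrow> \<rho> A x \<in> C"
  shows "gl_representation n (L\<lparr>carrier := C\<rparr>) \<rho>"
proof -
  have CL: "x \<in> carrier L" if "x \<in> C" for x using submodule.subset[OF C] that by blast
  interpret vectorspace class_ring L using L by (simp add: gl_representation_def)
  have "vectorspace class_ring (L\<lparr>carrier := C\<rparr>)"
    using submodule_is_module[OF C] class_field.field_axioms by (simp add: vectorspace_def)
  then show ?thesis
    using L CL closed unfolding gl_representation_def LinearCombinations.module_hom_def
    by (auto simp: Pi_iff)
qed

lemma GL_carrier: "A \<in> GL n \<Longrightarrow> A \<in> carrier_mat n n"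
  by (simp add: GL_def)

lemma gl_representation_g1: "gl_representation n (g1 n) (gl_g1 n)"
proof -
  note simps = G1.carrier_eq gl_g1_cls1[OF GL_carrier] nalg_gl_homogeneous[OF GL_carrier]
    G1.add_eq G1.smult_eq nalg_gl_simps
  have "gl_g1 n A \<in> module_hom class_ring (g1 n) (g1 n)" if "A \<in> GL n" for A
    using that by (auto simp: LinearCombinations.module_hom_def simps)
  moreover have "gl_g1 n (1\<^sub>m n) x = x" if "x \<in> carrier (g1 n)" for x
    using that by (auto simp: G1.carrier_eq gl_g1_cls1[OF one_carrier_mat] nalg_gl_one)
  moreover have "gl_g1 n (A * B) x = gl_g1 n A (gl_g1 n B x)"
    if "A \<in> GL n" "B \<in> GL n" "x \<in> carrier (g1 n)" for A B x
  proof -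
    have "A * B \<in> carrier_mat n n" using that GL_carrier by (meson mult_carrier_mat)
    then show ?thesis
      using that by (auto simp: simps gl_g1_cls1 nalg_gl_mult[OF GL_carrier GL_carrier])
  qed
  ultimately show ?thesis by (simp add: gl_representation_def G1.vectorspace)
qed

lemma gl_representation_g0: "gl_representation n (g0 n) (gl_gla n)"
proof -
  note simps = g0.carrier_eq gl_gla_cls[OF GL_carrier] nalg_gl_homogeneous[OF GL_carrier]
    g0.add_eq g0.smult_eq nalg_gl_simps homogeneous_carrier
  have "gl_gla n A \<in> module_hom class_ring (g0 n) (g0 n)" if "A \<in> GL n" for A
    using that by (auto simp: LinearCombinations.module_hom_def simps)
  moreover have "gl_gla n (1\<^sub>m n) x = x" if "x \<in> carrier (g0 n)" for x
    using that by (auto simp: g0.carrier_eq gl_gla_cls[OF one_carrier_mat] nalg_gl_one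
        homogeneous_carrier)
  moreover have "gl_gla n (A * B) x = gl_gla n A (gl_gla n B x)"
    if "A \<in> GL n" "B \<in> GL n" "x \<in> carrier (g0 n)" for A B x
  proof -
    have "A * B \<in> carrier_mat n n" using that GL_carrier by (meson mult_carrier_mat)
    then show ?thesis
      using that homogeneous_carrier[OF nalg_gl_homogeneous[OF GL_carrier]]
      by (auto simp: simps gl_gla_cls nalg_gl_mult[OF GL_carrier GL_carrier])
  qed
  ultimately show ?thesis by (simp add: gl_representation_def g0.vectorspace)
qed

section \<open>The kernel of \<open>tau\<close>\<close>

definition kernel_reps :: "nat \<Rightarrow> nalg set" where
  "kernel_reps n = {p \<in> homogeneous n (- 1). nalg_diff p \<in> lie_ideal n}"

lemma carrier_lie_kernel: "carrier (lie_kernel (g1 n) (g0 n) (tau n)) = cls1 n ` kernel_reps n"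
proof -
  have "tau n (cls1 n p) = \<zero>\<^bsub>g0 n\<^esub> \<longleftrightarrow> nalg_diff p \<in> lie_ideal n" if "p \<in> homogeneous n (- 1)" for p
    using that by (simp add: tau_cls1 g0.zero_eq zero_cls_iff nalg_diff_carrier homogeneous_carrier)
  then show ?thesis
    by (auto simp: lie_kernel_def a_kernel_def' G1.carrier_eq kernel_reps_def)
qed

lemma submodule_lie_kernel: "submodule class_ring (cls1 n ` kernel_reps n) (g1 n)"
proof (rule submodule.intro)
  show "Module.module class_ring (g1 n)" using G1.vectorspace by (simp add: vectorspace_def)
  have "0 \<in> kernel_reps n"
    by (simp add: kernel_reps_def linear_0[OF linear_nalg_diff] zero_in_lie_ideal
        homogeneous_zero)
  then show "\<zero>\<^bsub>g1 n\<^esub> \<in> cls1 n ` kernel_reps n" by (auto simp: G1.zero_eq)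
qed (auto simp: kernel_reps_def G1.carrier_eq G1.add_eq G1.smult_eq nalg_diff_simps
    intro!: imageI lie_ideal_add lie_ideal_scale)

lemma lie_kernel_eq:
  "lie_kernel (g1 n) (g0 n) (tau n) = (g1 n)\<lparr>carrier := cls1 n ` kernel_reps n\<rparr>"
  using carrier_lie_kernel[of n] by (simp add: lie_kernel_def)

lemma kernel_mult:
  assumes "p \<in> kernel_reps n" "q \<in> homogeneous n (- 1)"
  shows "cls1 n p \<otimes>\<^bsub>g1 n\<^esub> cls1 n q = cls1 n 0"
proof -
  have "br (nalg_diff p) q \<in> peiffer n"
    using assms by (intro lie_ideal_peiffer lie_ideal.br_right)
        (auto simp: kernel_reps_def homogeneous_carrier)
  then show ?thesis
    using assms by (simp add: kernel_reps_def g1_mult zero_cls1_iff nalg_diff_degree_m1)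
qed

lemma lie_algebra_kernel: "lie_algebra (lie_kernel (g1 n) (g0 n) (tau n))"
  unfolding lie_kernel_eq
proof (rule lie_subalgebra[OF lie_algebra_g1 submodule_lie_kernel])
  fix x y assume "x \<in> cls1 n ` kernel_reps n" "y \<in> cls1 n ` kernel_reps n"
  then have "x \<otimes>\<^bsub>g1 n\<^esub> y = \<zero>\<^bsub>g1 n\<^esub>"
    by (auto simp: kernel_mult G1.zero_eq) (auto simp: kernel_reps_def kernel_mult)
  then show "x \<otimes>\<^bsub>g1 n\<^esub> y \<in> cls1 n ` kernel_reps n"
    using submodule.zero_closed[OF submodule_lie_kernel] by simp
qed

lemma gl_representation_kernel: "gl_representation n (lie_kernel (g1 n) (g0 n) (tau n)) (gl_g1 n)"
  unfolding lie_kernel_eq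
proof (rule gl_representation_sub[OF gl_representation_g1 submodule_lie_kernel])
  fix A x assume A: "A \<in> GL n" and "x \<in> cls1 n ` kernel_reps n"
  then obtain p where p: "p \<in> homogeneous n (- 1)" "nalg_diff p \<in> lie_ideal n" "x = cls1 n p"
    by (auto simp: kernel_reps_def)
  have "nalg_diff (nalg_gl A p) = nalg_gl A (nalg_diff p) - (nalg_gl A (nalg_diff p) - nalg_diff
      (nalg_gl A p))"
    by simp
  also have "\<dots> \<in> lie_ideal n"
    using A p by (intro lie_ideal_diff nalg_gl_lie_ideal nalg_gl_diff GL_carrier)
  finally show "gl_g1 n A x \<in> cls1 n ` kernel_reps n"
    using A p by (auto simp: gl_g1_cls1[OF GL_carrier] kernel_reps_def nalg_gl_homogeneous[OF
        GL_carrier])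
qed

section \<open>The image of \<open>tau\<close> is the derived algebra\<close>

lemma bracket_nalg_diff:
  assumes g: "g \<in> homogeneous n 0" and h: "h \<in> homogeneous n 0"
  shows "\<exists>p\<in>homogeneous n (- 1). nalg_diff p - br g h \<in> lie_ideal n"
proof -
  let ?U = "{x. \<exists>p\<in>homogeneous n (- 1). nalg_diff p - x \<in> lie_ideal n}"
  have "subsp ?U"
  proof (rule real_vector.subspaceI)
    show "0 \<in> ?U"
      by (auto intro!: bexI[of _ 0] simp: linear_0[OF linear_nalg_diff] zero_in_lie_ideal
          homogeneous_zero)
    fix x y assume "x \<in> ?U" "y \<in> ?U"
    then obtain p q where "p \<in> homogeneous n (- 1)" "nalg_diff p - x \<in> lie_ideal n"
      "q \<in> homogeneous n (- 1)" "nalg_diff q - y \<in> lie_ideal n" by auto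
    then show "x + y \<in> ?U"
      using lie_ideal_add[of "nalg_diff p - x" n "nalg_diff q - y"]
      by (auto intro!: bexI[of _ "p + q"] simp: nalg_diff_simps algebra_simps
          homogeneous_add)
  next
    fix r x assume "x \<in> ?U"
    then obtain p where "p \<in> homogeneous n (- 1)" "nalg_diff p - x \<in> lie_ideal n" by auto
    then show "r *\<^sub>R x \<in> ?U"
      using lie_ideal_scale[of "nalg_diff p - x" n r]
      by (auto intro!: bexI[of _ "r *\<^sub>R p"] simp: nalg_diff_simps algebra_simps
          homogeneous_scale)
  qed
  then have "br g h \<in> ?U"
  proof (rule linear_homogeneous[OF linear_br_left _ _ g])
    fix t assume "set_bword t \<subseteq> symbols n" "wdeg t = 0"
    then show "br (word t) h \<in> ?U"
      using h
    proof (induction arbitrary: h rule: homogeneous_0_induct)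
      case (gen i)
      \<comment> \<open>If the left factor is a letter, a primitive of the bracket is
        W_i(h).\<close>
      then have "nalg_diff (wedge_der n (word (Gen {i})) h) - br (word (Gen {i})) h \<in> lie_ideal n"
        using lie_ideal_neg[OF nalg_diff_wedge_der[of h n "word (Gen {i})"]] by (simp add: lin1_gen)
      then show ?case by (auto intro!: bexI[of _ "wedge_der n (word (Gen {i})) h"])
    next
      case (br s t)
      then have s: "word s \<in> homogeneous n 0" and t: "word t \<in> homogeneous n 0"
        by (simp_all add: homogeneous_words)
      obtain p q where p: "p \<in> homogeneous n (- 1)" "nalg_diff p - br (word t) h \<in> lie_ideal n"
        and q: "q \<in> homogeneous n (- 1)" "nalg_diff q - br (word s) h \<in> lie_ideal n"
        using br.IH(1)[OF br.prems] br.IH(2)[OF br.prems] by blast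
      \<comment> \<open>By Jacobi, [[s, t], h] = [s, [t, h]] - [t, [s, h]]; the primitives p of
        [t, h] and q of [s, h] are acted on accordingly.\<close>
      have "nalg_diff (br (word s) p - br (word t) q) - br (br (word s) (word t)) h =
          br (word s) (nalg_diff p - br (word t) h) - br (word t) (nalg_diff q - br (word s) h) +
          (br (word s) (br (word t) h) - br (br (word s) (word t)) h - br (word t) (br (word s) h))"
        by (simp add: nalg_diff_simps nalg_diff_br_0_m1[OF s p(1)] nalg_diff_br_0_m1[OF t q(1)]
            br_simps del: br_word_word)
      also have "\<dots> \<in> lie_ideal n"
        using lie_ideal.br_left[OF homogeneous_carrier[OF s] p(2)]
          lie_ideal.br_left[OF homogeneous_carrier[OF t] q(2)] degree_0_jacobi[OF s t br.prems]
        by (simp only: lie_ideal_add lie_ideal_diff)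
      finally show ?case
        using s t p(1) q(1)
        by (auto intro!: bexI[of _ "br (word s) p - br (word t) q"]
            homogeneous_diff)
    qed
  qed
  then show ?thesis by simp
qed

lemma nalg_diff_bracket:
  assumes p: "p \<in> homogeneous n (- 1)"
  shows "nalg_diff p \<in> Real_Vector_Spaces.span {br g h | g h. g \<in> homogeneous n 0 \<and>
      h \<in> homogeneous n 0}"
    (is "_ \<in> Real_Vector_Spaces.span ?B")
proof (rule linear_homogeneous[OF linear_nalg_diff real_vector.subspace_span _ p])
  have B: "br g h \<in> Real_Vector_Spaces.span ?B" if "g \<in> homogeneous n 0" "h \<in> homogeneous n 0"
      for g h
    using that by (intro real_vector.span_base) blast
  fix t assume "set_bword t \<subseteq> symbols n" "wdeg t = - 1"
  then show "nalg_diff (word t) \<in> Real_Vector_Spaces.span ?B"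
  proof (induction rule: homogeneous_1_induct)
    case (gen i j)
    then show ?case
      using B[OF generator_homogeneous generator_homogeneous, of i j] by (simp add: nalg_diff_pair)
  next
    case (left s t)
    then have s: "word s \<in> homogeneous n 0" and t: "word t \<in> homogeneous n (- 1)"
      by (simp_all add: homogeneous_words)
    show ?case
      using nalg_diff_br_0_m1[OF s t] B[OF s nalg_diff_degree_m1[OF t]] by simp
  next
    case (right s t)
    then have s: "word s \<in> homogeneous n 0" and t: "word t \<in> homogeneous n (- 1)"
      by (simp_all add: homogeneous_words)
    show ?case
      using nalg_diff_br_m1_0[OF s t] B[OF nalg_diff_degree_m1[OF t] s] by simp
  qed
qed

lemma carrier_lie_derived:
  "carrier (lie_derived (g0 n)) = (\<lambda>p. cls n (nalg_diff p)) ` homogeneous n (- 1)"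
proof -
  let ?B = "{br g h | g h. g \<in> homogeneous n 0 \<and> h \<in> homogeneous n 0}"
  let ?D = "(\<lambda>p. cls n (nalg_diff p)) ` homogeneous n (- 1)"
  have B: "?B \<subseteq> homogeneous n 0" by auto
  have "{x \<otimes>\<^bsub>g0 n\<^esub> y | x y. x \<in> carrier (g0 n) \<and> y \<in> carrier (g0 n)} = cls n ` ?B"
  proof (intro equalityI subsetI)
    fix X assume "X \<in> {x \<otimes>\<^bsub>g0 n\<^esub> y | x y. x \<in> carrier (g0 n) \<and> y \<in> carrier (g0 n)}"
    then obtain g h where "g \<in> homogeneous n 0" "h \<in> homogeneous n 0" "X = cls n (br g h)"
      by (auto simp: g0.carrier_eq g0_mult)
    then show "X \<in> cls n ` ?B" by blast
  next
    fix X assume "X \<in> cls n ` ?B"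
    then obtain g h where "g \<in> homogeneous n 0" "h \<in> homogeneous n 0" "X = cls n g \<otimes>\<^bsub>g0 n\<^esub> cls n h"
      by (auto simp: g0_mult)
    then show "X \<in> {x \<otimes>\<^bsub>g0 n\<^esub> y | x y. x \<in> carrier (g0 n) \<and> y \<in> carrier (g0 n)}"
      using g0.class_closed by blast
  qed
  then have eq: "carrier (lie_derived (g0 n)) = cls n ` Real_Vector_Spaces.span ?B"
    by (simp add: lie_derived_def g0.span_image[OF B])
  have "cls n ` Real_Vector_Spaces.span ?B \<subseteq> ?D"
  proof -
    have "x \<in> homogeneous n 0 \<and> cls n x \<in> ?D" if "x \<in> Real_Vector_Spaces.span ?B" for x
      using that
    proof (induction rule: real_vector.span_induct_alt)
      case base
      show ?case
        by (auto intro!: image_eqI[of _ _ 0] simp: linear_0[OF linear_nalg_diff]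
            homogeneous_zero)
    next
      case (step r x y)
      then obtain g h where gh: "g \<in> homogeneous n 0" "h \<in> homogeneous n 0" "x = br g h" by auto
      obtain p where p: "p \<in> homogeneous n (- 1)" "nalg_diff p - x \<in> lie_ideal n"
        using bracket_nalg_diff[OF gh(1,2)] gh(3) by blast
      obtain q where q: "q \<in> homogeneous n (- 1)" "cls n y = cls n (nalg_diff q)"
        using step by blast
      have mem: "x \<in> homogeneous n 0" "y \<in> homogeneous n 0" "r *\<^sub>R x + y \<in> homogeneous n 0"
        "nalg_diff (r *\<^sub>R p + q) \<in> homogeneous n 0" "nalg_diff q \<in> homogeneous n 0"
        "r *\<^sub>R p + q \<in> homogeneous n (- 1)"
        using gh step p q
        by (auto intro!: homogeneous_add nalg_diff_degree_m1
            homogeneous_scale)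
      have "y - nalg_diff q \<in> lie_ideal n"
        using q(2) mem by (simp add: cls_eq_iff homogeneous_carrier)
      then have "(y - nalg_diff q) - r *\<^sub>R (nalg_diff p - x) \<in> lie_ideal n"
        using lie_ideal_diff lie_ideal_scale[OF p(2)] by blast
      then have "cls n (r *\<^sub>R x + y) = cls n (nalg_diff (r *\<^sub>R p + q))"
        using mem(3,4)[THEN homogeneous_carrier]
        by (intro cls_eqI) (simp_all add: nalg_diff_simps algebra_simps)
      then show ?case using mem by blast
    qed
    then show ?thesis by blast
  qed
  moreover have "?D \<subseteq> cls n ` Real_Vector_Spaces.span ?B"
    using nalg_diff_bracket by blast
  ultimately show ?thesis unfolding eq by (rule equalityI)
qed

lemma lie_derived_eq:
  "lie_derived (g0 n) = (g0 n)\<lparr>carrier := (\<lambda>p. cls n (nalg_diff p)) ` homogeneous n (- 1)\<rparr>"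
  using carrier_lie_derived[of n] by (simp add: lie_derived_def)

lemma submodule_lie_derived:
  "submodule class_ring ((\<lambda>p. cls n (nalg_diff p)) ` homogeneous n (- 1)) (g0 n)"
proof (rule submodule.intro)
  show "Module.module class_ring (g0 n)" using g0.vectorspace by (simp add: vectorspace_def)
  show "\<zero>\<^bsub>g0 n\<^esub> \<in> (\<lambda>p. cls n (nalg_diff p)) ` homogeneous n (- 1)"
    by (auto intro!: image_eqI[of _ _ 0] simp: linear_0[OF linear_nalg_diff] g0.zero_eq
        homogeneous_zero)
next
  fix v w assume "v \<in> (\<lambda>p. cls n (nalg_diff p)) ` homogeneous n (- 1)"
    "w \<in> (\<lambda>p. cls n (nalg_diff p)) ` homogeneous n (- 1)"
  then obtain p q where "p \<in> homogeneous n (- 1)" "q \<in> homogeneous n (- 1)"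
    "v = cls n (nalg_diff p)" "w = cls n (nalg_diff q)" by auto
  then show "v \<oplus>\<^bsub>g0 n\<^esub> w \<in> (\<lambda>p. cls n (nalg_diff p)) ` homogeneous n (- 1)"
    by (intro image_eqI[of _ _ "p + q"]) (simp_all add: g0.add_eq nalg_diff_degree_m1
        nalg_diff_simps)
next
  fix r :: real and v assume "v \<in> (\<lambda>p. cls n (nalg_diff p)) ` homogeneous n (- 1)"
  then obtain p where "p \<in> homogeneous n (- 1)" "v = cls n (nalg_diff p)" by auto
  then show "r \<odot>\<^bsub>g0 n\<^esub> v \<in> (\<lambda>p. cls n (nalg_diff p)) ` homogeneous n (- 1)"
    by (intro image_eqI[of _ _ "r *\<^sub>R p"]) (simp_all add: g0.smult_eq nalg_diff_degree_m1
        nalg_diff_simps)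
qed (auto intro: g0.class_closed nalg_diff_degree_m1)

lemma lie_algebra_derived: "lie_algebra (lie_derived (g0 n))"
  unfolding lie_derived_eq
proof (rule lie_subalgebra[OF lie_algebra_g0 submodule_lie_derived])
  fix v w assume "v \<in> (\<lambda>p. cls n (nalg_diff p)) ` homogeneous n (- 1)"
    "w \<in> (\<lambda>p. cls n (nalg_diff p)) ` homogeneous n (- 1)"
  then obtain p q where *: "p \<in> homogeneous n (- 1)" "q \<in> homogeneous n (- 1)"
    "v = cls n (nalg_diff p)" "w = cls n (nalg_diff q)" by auto
  then show "v \<otimes>\<^bsub>g0 n\<^esub> w \<in> (\<lambda>p. cls n (nalg_diff p)) ` homogeneous n (- 1)"
    using nalg_diff_br_0_m1[OF nalg_diff_degree_m1[OF *(1)] *(2)]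
    by (intro image_eqI[of _ _ "br (nalg_diff p) q"]) (simp_all add: g0_mult nalg_diff_degree_m1)
qed

lemma gl_gla_nalg_diff:
  assumes A: "A \<in> carrier_mat n n" and p: "p \<in> homogeneous n (- 1)"
  shows "gl_gla n A (cls n (nalg_diff p)) = cls n (nalg_diff (nalg_gl A p))"
proof -
  have "cls n (nalg_gl A (nalg_diff p)) = cls n (nalg_diff (nalg_gl A p))"
    using p nalg_gl_diff[OF A p] nalg_gl_homogeneous[OF A] nalg_diff_degree_m1
    by (intro cls_eqI) (blast intro: homogeneous_carrier)+
  then show ?thesis
    using p by (simp add: gl_gla_cls[OF A] homogeneous_carrier nalg_diff_carrier)
qed

lemma gl_representation_derived: "gl_representation n (lie_derived (g0 n)) (gl_gla n)"
  unfolding lie_derived_eq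
  by (rule gl_representation_sub[OF gl_representation_g0 submodule_lie_derived])
    (auto simp: gl_gla_nalg_diff[OF GL_carrier] intro!: imageI nalg_gl_homogeneous[OF GL_carrier])

definition splitting :: "nat \<Rightarrow> nalg set set \<Rightarrow> nalg set set \<times> nalg set" where
  "splitting n X = (G1.descend n (\<lambda>p. cls1 n (kernel_map n p)) X, tau n X)"

lemma splitting_cls1:
  assumes "p \<in> homogeneous n (- 1)"
  shows "splitting n (cls1 n p) = (cls1 n (kernel_map n p), cls n (nalg_diff p))"
proof -
  have "G1.descend n (\<lambda>p. cls1 n (kernel_map n p)) (cls1 n p) = cls1 n (kernel_map n p)"
  proof (rule G1.descend_class[OF _ assms])
    fix p q assume "p \<in> homogeneous n (- 1)" "q \<in> homogeneous n (- 1)" "cls1 n p = cls1 n q"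
    then have "kernel_map n (p - q) \<in> peiffer n" by (simp add: cls1_eq_iff kernel_map_peiffer)
    then show "cls1 n (kernel_map n p) = cls1 n (kernel_map n q)"
        by (simp add: cls1_eq_iff linear_diff[OF linear_kernel_map])
  qed
  then show ?thesis using assms by (simp add: splitting_def tau_cls1)
qed

lemma kernel_map_kernel_reps: "kernel_map n p \<in> kernel_reps n"
  by (simp add: kernel_reps_def nalg_diff_kernel_map)

text \<open>The map is triangular. Equal images under \<open>tau\<close> leave a difference in the
  kernel, where H is injective. For a target (k, dz), adding to z a kernel element u with H(u) = k -
  H(z) corrects the first component and keeps the second.\<close>

lemma splitting_bij:
  "bij_betw (splitting n) (carrier (g1 n))
     (cls1 n ` kernel_reps n \<times> (\<lambda>p. cls n (nalg_diff p)) ` homogeneous n (- 1))"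
proof (rule bij_betw_imageI)
  have sub: "p - q \<in> homogeneous n (- 1)" if "p \<in> homogeneous n (- 1)" "q \<in> homogeneous n (- 1)"
      for p q
    using that by (rule homogeneous_diff)
  show "inj_on (splitting n) (carrier (g1 n))"
  proof (rule inj_onI)
    fix X Y assume "X \<in> carrier (g1 n)" "Y \<in> carrier (g1 n)" and eq: "splitting n X = splitting n Y"
    then obtain p q where p: "p \<in> homogeneous n (- 1)" "X = cls1 n p"
      and q: "q \<in> homogeneous n (- 1)" "Y = cls1 n q" by (auto simp: G1.carrier_eq)
    from eq p q have "kernel_map n (p - q) \<in> peiffer n" "nalg_diff (p - q) \<in> lie_ideal n"
      by (simp_all add: splitting_cls1 cls1_eq_iff linear_diff[OF linear_kernel_map] cls_eq_iff
          nalg_diff_simps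
          homogeneous_carrier nalg_diff_carrier)
    then have "p - q \<in> peiffer n" using kernel_map_injective sub p(1) q(1) by blast
    then show "X = Y" using p q by (simp add: cls1_eq_iff)
  qed
  show "splitting n ` carrier (g1 n) =
      cls1 n ` kernel_reps n \<times> (\<lambda>p. cls n (nalg_diff p)) ` homogeneous n (- 1)"
  proof (intro equalityI subsetI)
    fix Y assume "Y \<in> cls1 n ` kernel_reps n \<times> (\<lambda>p. cls n (nalg_diff p)) ` homogeneous n (- 1)"
    then obtain k z where k: "k \<in> kernel_reps n" and z: "z \<in> homogeneous n (- 1)"
      and Y: "Y = (cls1 n k, cls n (nalg_diff z))" by auto
    have k_Hz: "k - kernel_map n z \<in> homogeneous n (- 1)"
        "nalg_diff (k - kernel_map n z) \<in> lie_ideal n"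
      using k sub nalg_diff_kernel_map by (auto simp: kernel_reps_def nalg_diff_simps
          lie_ideal_diff)
    then obtain u where u: "u \<in> homogeneous n (- 1)" "nalg_diff u \<in> lie_ideal n"
      "kernel_map n u - (k - kernel_map n z) \<in> peiffer n"
      using kernel_map_surjective by blast
    have zu: "z + u \<in> homogeneous n (- 1)"
      using z u by (simp add: homogeneous_add)
    have "cls1 n (kernel_map n (z + u)) = cls1 n k"
      using u(3) k by (simp add: cls1_eq_iff kernel_reps_def linear_add[OF linear_kernel_map]
          algebra_simps)
    moreover have "cls n (nalg_diff (z + u)) = cls n (nalg_diff z)"
      using u(2) z[THEN homogeneous_carrier] zu[THEN homogeneous_carrier]
      by (intro cls_eqI nalg_diff_carrier) (simp_all add: nalg_diff_simps)
    ultimately have "splitting n (cls1 n (z + u)) = Y" using zu Y by (simp add: splitting_cls1)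
    then show "Y \<in> splitting n ` carrier (g1 n)" using zu by (auto simp: G1.carrier_eq)
  qed (auto simp: G1.carrier_eq splitting_cls1 intro!: imageI kernel_map_kernel_reps)
qed

lemma splitting_iso:
  "lie_gl_iso n (g1 n) (gl_g1 n)
     (lie_direct_sum (lie_kernel (g1 n) (g0 n) (tau n)) (lie_derived (g0 n)))
     (\<lambda>A. map_prod (gl_g1 n A) (gl_gla n A)) (splitting n)"
  unfolding lie_gl_iso_def
proof (intro conjI ballI lie_algebra_g1 lie_algebra_direct_sum lie_algebra_kernel
    lie_algebra_derived
    gl_representation_g1 gl_representation_direct_sum gl_representation_kernel
        gl_representation_derived)
  show "bij_betw (splitting n) (carrier (g1 n))
      (carrier (lie_direct_sum (lie_kernel (g1 n) (g0 n) (tau n)) (lie_derived (g0 n))))"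
    using splitting_bij[of n]
    by (simp add: lie_direct_sum_def direct_sum_def carrier_lie_kernel carrier_lie_derived)
  let ?M = "lie_direct_sum (lie_kernel (g1 n) (g0 n) (tau n)) (lie_derived (g0 n))"
  show "splitting n \<in> lie_hom (g1 n) ?M"
    unfolding lie_hom_def LinearCombinations.module_hom_def
  proof (intro CollectI conjI ballI allI impI; (elim conjE)?)
    show "splitting n \<in> carrier (g1 n) \<rightarrow> carrier ?M"
      using splitting_bij[of n]
      by (auto simp: lie_direct_sum_simps carrier_lie_kernel carrier_lie_derived dest: bij_betwE)
    fix x y assume "x \<in> carrier (g1 n)" "y \<in> carrier (g1 n)"
    then obtain p q where p: "p \<in> homogeneous n (- 1)" "x = cls1 n p"
      and q: "q \<in> homogeneous n (- 1)" "y = cls1 n q" by (auto simp: G1.carrier_eq)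
    have sum: "p + q \<in> homogeneous n (- 1)"
      using p q by (simp add: homogeneous_add)
    show "splitting n (x \<oplus>\<^bsub>g1 n\<^esub> y) = splitting n x \<oplus>\<^bsub>?M\<^esub> splitting n y"
      using p q sum
      by (simp add: G1.add_eq splitting_cls1 lie_direct_sum_simps lie_kernel_eq lie_derived_eq
          linear_add[OF linear_kernel_map] nalg_diff_simps g0.add_eq nalg_diff_degree_m1)
    \<comment> \<open>In the first component both sides are zero: H kills the derived bracket, and
      the bracket of two kernel elements vanishes.\<close>
    have "cls1 n (kernel_map n (br (nalg_diff p) q)) = cls1 n 0"
      using p q by (simp add: zero_cls1_iff kernel_map_derived_bracket)
    moreover have "nalg_diff (br (nalg_diff p) q) = br (nalg_diff p) (nalg_diff q)"
      by (rule nalg_diff_br_0_m1[OF nalg_diff_degree_m1[OF p(1)] q(1)])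
    ultimately show "splitting n (x \<otimes>\<^bsub>g1 n\<^esub> y) = splitting n x \<otimes>\<^bsub>?M\<^esub> splitting n y"
      using p q kernel_mult[OF kernel_map_kernel_reps kernel_map_closed, of n p q]
      by (simp add: g1_mult splitting_cls1 lie_direct_sum_simps lie_kernel_eq lie_derived_eq
          nalg_diff_degree_m1 g0_mult)
  next
    fix r :: real and x assume "x \<in> carrier (g1 n)"
    then obtain p where p: "p \<in> homogeneous n (- 1)" "x = cls1 n p" by (auto simp: G1.carrier_eq)
    then show "splitting n (r \<odot>\<^bsub>g1 n\<^esub> x) = r \<odot>\<^bsub>?M\<^esub> splitting n x"
      by (simp add: G1.smult_eq splitting_cls1 lie_direct_sum_simps lie_kernel_eq lie_derived_eq
          linear_scale[OF linear_kernel_map] nalg_diff_simps g0.smult_eq nalg_diff_degree_m1)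
  qed
  fix A x assume A: "A \<in> GL n" and "x \<in> carrier (g1 n)"
  then obtain p where p: "p \<in> homogeneous n (- 1)" "x = cls1 n p" by (auto simp: G1.carrier_eq)
  have "kernel_map n (nalg_gl A p) - nalg_gl A (kernel_map n p) \<in> peiffer n"
    using peiffer_neg[OF nalg_gl_kernel_map[OF GL_carrier[OF A] p(1)]] by simp
  then have "cls1 n (kernel_map n (nalg_gl A p)) = cls1 n (nalg_gl A (kernel_map n p))"
    by (simp add: cls1_eq_iff nalg_gl_homogeneous[OF GL_carrier[OF A]])
  then show "splitting n (gl_g1 n A x) = map_prod (gl_g1 n A) (gl_gla n A) (splitting n x)"
    using p by (simp add: gl_g1_cls1[OF GL_carrier[OF A]] splitting_cls1
        nalg_gl_homogeneous[OF GL_carrier[OF A]] gl_gla_nalg_diff[OF GL_carrier[OF A]])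
qed

theorem theorem4p4:
  fixes n :: nat
  shows
    "crossed_module (g1 n) (g0 n) (tau n) (act n) \<and>
     free_crossed_module TYPE('h) TYPE('g) (g1 n) (g0 n) (tau n) (act n)
       {(i, j). i < j \<and> j < n}
       (\<lambda>(i, j). g1_class n (Z n {i, j}))
       (\<lambda>(i, j). Z n {i} \<otimes>\<^bsub>g0 n\<^esub> Z n {j}) \<and>
     free_lie_algebra TYPE('l) (module_vec TYPE(real) n) (g0 n) (g0_incl n) \<and>
     (\<exists>F. lie_gl_iso n
            (g1 n) (gl_g1 n)
            (lie_direct_sum (lie_kernel (g1 n) (g0 n) (tau n)) (lie_derived (g0 n)))
            (\<lambda>A. map_prod (gl_g1 n A) (gl_gla n A))
            F)"
  using crossed_module_g1 free_crossed_module_g1 free_lie_algebra_g0 splitting_iso by blast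

end
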